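(* Let $p\in[1,\infty)$ and let $Q\in L_p(\mathcal M_2)$ be of the form $Q=\begin{pmatrix} q_1&q_2\\ q_2&-q_1\end{pmatrix}$ with real-valued $q_1,q_2\in L_p(0,1)$. Then the eigenvalues $(\lambda_n)_{n\in\mathbb Z}$ and $(\mu_n)_{n\in\mathbb Z}$ of the Dirac operators $\mathcal A_1$ and $\mathcal A_2$ respectively can be enumerated so that they satisfy the interlacing condition $$\lambda_{n-1}<\mu_n<\lambda_n,\qquad n\in\mathbb Z,$$ and the asymptotics $$\lambda_n=\pi(n+\tfrac12)+e_n(g_1),\qquad \mu_n=\pi n+e_n(g_2),$$ where $g_1,g_2\in L_p(0,1)$ and $e_n(g):=\int_0^1e^{-2\pi nix}g(x)\,dx$ are the Fourier coefficients of a function $g$.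
   Context: $\mathcal M_2$ is the algebra of $2\times2$ complex matrices with the operator norm; $L_p(\mathcal M_2):=L_p((0,1),\mathcal M_2)$; $\mathbb H:=L_2(0,1)\times L_2(0,1)$; $B=\begin{pmatrix}0&1\\-1&0\end{pmatrix}$; $\ell_Q\mathbf u:=B\mathbf u'+Q\mathbf u$. For $j=1,2$, $\mathcal A_j$ is the operator in $\mathbb H$ acting as $\mathcal A_j\mathbf u=\ell_Q\mathbf u$ on $\mathrm{dom}\,\mathcal A_j=\{\mathbf u=(u_1,u_2)^{\mathrm t}: u_1,u_2\in\mathrm{AC}[0,1],\ \ell_Q\mathbf u\in\mathbb H,\ u_2(0)=u_j(1)=0\}$. These operators are selfadjoint with simple discrete spectra accumulating at $-\infty$ and $+\infty$. Functions in $L_p(0,1)$ may be complex-valued unless stated otherwise. *)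

theory Defs
  imports "HOL-Analysis.Analysis"
begin

abbreviation unit_meas :: "real measure" where
  "unit_meas \<equiv> lebesgue_on {0<..<1}"

(* L_p(0,1) for functions with values in a normed space whose norm nrm need not be the norm of the
   type class. Elements are representatives; almost everywhere equality is not quotiented out. *)
definition Lp_wrt :: "('a::real_normed_vector \<Rightarrow> real) \<Rightarrow> real \<Rightarrow> (real \<Rightarrow> 'a) set" where
  "Lp_wrt nrm p =
     {f \<in> borel_measurable unit_meas. integrable unit_meas (\<lambda>x. nrm (f x) powr p)}"

abbreviation Lp :: "real \<Rightarrow> (real \<Rightarrow> 'a::real_normed_vector) set" where
  "Lp \<equiv> Lp_wrt norm"

(* The type class norm on complex^2^2 is the Frobenius norm, hence the explicit operator norm. *)
definition Lp_M2 :: "real \<Rightarrow> (real \<Rightarrow> complex^2^2) set" where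
  "Lp_M2 p = Lp_wrt (\<lambda>A. onorm ((*v) A)) p"

definition HH :: "(real \<Rightarrow> complex^2) set" where
  "HH = {u. \<forall>i. (\<lambda>x. u x $ i) \<in> Lp 2}"

(* The elements of d are finitely many nonoverlapping compact intervals [Inf k, Sup k]
   contained in [0,1], which need not cover [0,1]. *)
definition AC01 :: "(real \<Rightarrow> complex) set" where
  "AC01 = {f. \<forall>\<epsilon>>0. \<exists>\<delta>>0. \<forall>d T. d division_of T \<and> T \<subseteq> {0..1} \<and>
       (\<Sum>k\<in>d. Sup k - Inf k) < \<delta> \<longrightarrow> (\<Sum>k\<in>d. norm (f (Sup k) - f (Inf k))) < \<epsilon>}"

definition B_mat :: "complex^2^2" where
  "B_mat = vector [vector [0, 1], vector [- 1, 0]]"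

(* Only meaningful at points of differentiability, that is, almost everywhere on (0,1)
   if the components of u are absolutely continuous. *)
definition dirac_expr :: "(real \<Rightarrow> complex^2^2) \<Rightarrow> (real \<Rightarrow> complex^2) \<Rightarrow> real \<Rightarrow> complex^2" where
  "dirac_expr Q u x = B_mat *v vector_derivative u (at x) + Q x *v u x"

(* The operator A_j acts as dirac_expr Q on dirac_dom j Q. Functions on [0,1] are represented by
   functions on the reals whose values outside [0,1] are irrelevant. An element of the domain is
   represented by its absolutely continuous representative. *)
definition dirac_dom :: "2 \<Rightarrow> (real \<Rightarrow> complex^2^2) \<Rightarrow> (real \<Rightarrow> complex^2) set" where
  "dirac_dom j Q =
     {u. (\<lambda>x. u x $ 1) \<in> AC01 \<and> (\<lambda>x. u x $ 2) \<in> AC01 \<and> dirac_expr Q u \<in> HH \<and>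
         u 0 $ 2 = 0 \<and> u 1 $ j = 0}"

(* Equality of elements of HH is equality almost everywhere. *)
definition dirac_eigenvalues :: "2 \<Rightarrow> (real \<Rightarrow> complex^2^2) \<Rightarrow> complex set" where
  "dirac_eigenvalues j Q =
     {z. \<exists>u \<in> dirac_dom j Q.
           \<not> (AE x in unit_meas. u x = 0) \<and>
           (AE x in unit_meas. dirac_expr Q u x = z *s u x)}"

definition fourier_coeff :: "int \<Rightarrow> (real \<Rightarrow> complex) \<Rightarrow> complex" where
  "fourier_coeff n g =
     (LINT x|unit_meas. exp (- 2 * of_real pi * of_int n * \<i> * of_real x) * g x)"

end

theory Submission
  imports Defs
begin

text \<open>
  Put \<open>q = q1 + \<i> q2\<close>. For real \<open>l\<close>, the solution with \<open>u(0) = (1, 0)\<close> is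
  \<open>u1 + \<i> u2 = exp (\<i> l x) z(x)\<close>, where \<open>z' = - \<i> q exp (- 2 \<i> l x) cnj z\<close> and \<open>z(0) = 1\<close>. Its
  argument, the Pruefer angle \<open>theta(x, l)\<close>, satisfies
  \<open>theta' = l - q1 cos (2 theta) - q2 sin (2 theta)\<close>, so \<open>theta(1, l)\<close> is a strictly increasing
  continuous function of \<open>l\<close> at bounded distance from \<open>l\<close>. The eigenvalues of the two operators are
  the points where it equals \<open>pi (n + 1/2)\<close> and \<open>pi n\<close>; this gives the enumeration and the
  interlacing.

  For the asymptotics, successive approximation shows \<open>z(1, l) = 1 + \<integral> G(r) exp (- 2 \<i> l r) dr\<close> with
  \<open>G\<close> in \<open>L_p(0,1)\<close>. Hence the remainders \<open>c n = \<mu> n - pi n\<close> solve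
  \<open>sin (c n) + \<integral> h(t) exp (- 2 pi \<i> n t) exp (\<i> c n (1 - 2 t)) dt = 0\<close> with \<open>h\<close> in \<open>L_p\<close>, and similarly for
  the other operator. Sequences of Fourier coefficients of functions in \<open>L_p\<close> form a Banach algebra,
  as convolution on the circle is bounded on \<open>L_p\<close>. Subtracting trigonometric polynomials makes all
  coefficients of this equation small at the cost of changing it for finitely many \<open>n\<close>, and then a
  contraction argument in the algebra yields \<open>c\<close>.
\<close>

section \<open>Jensen and Minkowski inequalities\<close>

text \<open>The phase \<open>exp (\<i> c n (1 - 2 t))\<close> comes from the boundary condition: at
  an eigenvalue \<open>exp (\<i> c n) z(1)\<close> is positive, so its imaginary part vanishes. When
  the imaginary part of the integral for \<open>z(1)\<close> is written as a difference of
  conjugates, reflecting \<open>t\<close> to \<open>1 - t\<close> turns the conjugate into an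
  integral with the same phase. Expanding the phase in powers of \<open>c n\<close> gives
  coefficients of norm at most \<open>H / fact j\<close>, so all but finitely many of them are small
  from the start. It is not known beforehand that \<open>c\<close> lies in the algebra. The
  iteration is therefore estimated twice: in the algebra, where it converges to some sequence, and
  for each single large \<open>n\<close>, where its limit is identified as \<open>c n\<close>. Two
  further points shape the proof. Eigenfunctions are absolutely continuous in the epsilon-delta
  sense, while the equations are used in integrated form; total variation and the Radon-Nikodym
  theorem match the two. And \<open>p = 1\<close> is included, so the estimates rest on Jensen's
  inequality and absolutely convergent series rather than on Hilbert space arguments.\<close>

lemma powr_above_tangent:
  fixes s y p :: real
  assumes "1 \<le> p" "0 < s" "0 \<le> y"
  shows "s powr p + p * s powr (p - 1) * (y - s) \<le> y powr p"
\<comment> \<open>The tangent inequality is taken from convexity on the open half-line, so the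
  endpoint \<open>0\<close> is treated by hand.\<close>
proof (cases "y = 0")
  case True
  have "s powr p = s powr (p - 1) * s"
    using assms by (metis powr_mult_base' add.commute diff_add_cancel less_eq_real_def mult.commute powr_mult_base)
  then have "s powr p + p * s powr (p - 1) * (y - s) = (1 - p) * s powr p"
    using True by (simp add: algebra_simps)
  also have "\<dots> \<le> 0" using assms by (simp add: mult_nonpos_nonneg)
  finally show ?thesis using True by simp
next
  case False
  have "(p * s powr (p - 1)) * (y - s) \<le> y powr p - s powr p"
  proof (rule convex_on_imp_above_tangent[OF powr_convex[OF assms(1)]])
    show "((\<lambda>x. x powr p) has_real_derivative p * s powr (p - 1)) (at s within {0<..})"
      using assms by (auto intro!: derivative_eq_intros)
  qed (use assms False in \<open>auto simp: interior_open\<close>)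
  then show ?thesis by simp
qed

lemma powr_le_add_one:
  fixes y p :: real
  assumes "1 \<le> p" "0 \<le> y" shows "y \<le> 1 + y powr p"
proof (cases "y \<le> 1")
  case True
  then show ?thesis using powr_ge_zero[of y p] by linarith
next
  case False
  then have "y powr 1 \<le> y powr p" using assms by (intro powr_mono) auto
  then show ?thesis using False by simp
qed

text \<open>Jensen's inequality for the measure with density \<open>w\<close>, obtained by
  integrating the tangent inequality at the mean of \<open>f\<close>. The mass of \<open>w\<close>
  is arbitrary because \<open>w\<close> will be the modulus of a factor in the convolution, the
  modulus of \<open>q\<close> in the kernel bounds and a summable sequence in Minkowski's
  inequality.\<close>

lemma weighted_power_mean:
  fixes w f :: "'a \<Rightarrow> real"
  assumes p: "1 \<le> p" and [measurable]: "f \<in> borel_measurable M"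
    and w: "integrable M w" and wf: "integrable M (\<lambda>x. w x * f x powr p)"
    and w0: "\<And>x. 0 \<le> w x" and f0: "\<And>x. 0 \<le> f x"
  shows "integrable M (\<lambda>x. w x * f x)"
    and "(\<integral>x. w x * f x \<partial>M) powr p \<le> (\<integral>x. w x \<partial>M) powr (p - 1) * (\<integral>x. w x * f x powr p \<partial>M)"
proof -
  have [measurable]: "w \<in> borel_measurable M" using w by auto
  show i: "integrable M (\<lambda>x. w x * f x)"
  proof (rule Bochner_Integration.integrable_bound[OF Bochner_Integration.integrable_add[OF w wf]])
    have "w x * f x \<le> w x * (1 + f x powr p)" for x
      using powr_le_add_one[OF p f0] w0 by (intro mult_left_mono) auto
    then show "AE x in M. norm (w x * f x) \<le> norm (w x + w x * f x powr p)"
      using w0 f0 by (auto simp: algebra_simps)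
  qed measurable
  let ?W = "\<integral>x. w x \<partial>M" and ?F = "\<integral>x. w x * f x \<partial>M" and ?P = "\<integral>x. w x * f x powr p \<partial>M"
  have W0: "0 \<le> ?W" and F0: "0 \<le> ?F" and P0: "0 \<le> ?P" using w0 f0 by (auto intro!: integral_nonneg)
  show "?F powr p \<le> ?W powr (p - 1) * ?P"
  proof (cases "?F = 0")
    case True then show ?thesis using P0 p by simp
  next
    case False
    have Wp: "0 < ?W"
    proof (rule ccontr)
      assume "\<not> 0 < ?W"
      then have "?W = 0" using W0 by simp
      then have "AE x in M. w x = 0" using w w0 by (subst integral_nonneg_eq_0_iff_AE[symmetric]) auto
      then have "?F = 0" by (intro integral_eq_zero_AE) auto
      then show False using False by simp
    qed
    \<comment> \<open>At the mean \<open>s\<close> the linear part of the tangent integrates to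
      zero. The preceding case distinctions make \<open>s\<close> positive.\<close>
    define s where "s = ?F / ?W"
    have s: "0 < s" "?W * s = ?F" using Wp F0 False by (auto simp: s_def)
    have i1: "integrable M (\<lambda>x. w x * (s powr p + p * s powr (p - 1) * (f x - s)))"
    proof -
      have "integrable M (\<lambda>x. (s powr p - p * s powr (p - 1) * s) * w x + (p * s powr (p - 1)) * (w x * f x))"
        using w i by auto
      then show ?thesis by (simp add: algebra_simps)
    qed
    have "(\<integral>x. w x * (s powr p + p * s powr (p - 1) * (f x - s)) \<partial>M) \<le> ?P"
      using powr_above_tangent[OF p s(1) f0] w0 by (intro integral_mono[OF i1 wf] mult_left_mono) auto
    also have "(\<integral>x. w x * (s powr p + p * s powr (p - 1) * (f x - s)) \<partial>M)
      = (\<integral>x. (s powr p - p * s powr (p - 1) * s) * w x + (p * s powr (p - 1)) * (w x * f x) \<partial>M)"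
      by (simp add: algebra_simps)
    also have "\<dots> = (s powr p - p * s powr (p - 1) * s) * ?W + (p * s powr (p - 1)) * ?F"
      using w i by simp
    also have "\<dots> = s powr p * ?W" using s(2) by (simp add: algebra_simps flip: s(2))
    finally have *: "s powr p * ?W \<le> ?P" .
    have "?F powr p = (?W * s) powr p" using s(2) by simp
    also have "\<dots> = ?W powr p * s powr p" by (rule powr_mult)
    also have "\<dots> = ?W powr (p - 1) * (s powr p * ?W)"
      using Wp by (simp add: powr_diff)
    also have "\<dots> \<le> ?W powr (p - 1) * ?P" using * by (intro mult_left_mono) auto
    finally show ?thesis .
  qed
qed

text \<open>Jensen's inequality in \<open>ennreal\<close>: it will be applied for every value of an
  outer variable, and finiteness of the right-hand side is then known only almost everywhere, after
  Tonelli.\<close>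

lemma norm_integral_powr_le:
  fixes w f :: "'a \<Rightarrow> real" and h :: "'a \<Rightarrow> 'b::{banach, second_countable_topology}"
  assumes p: "1 \<le> p" and [measurable]: "f \<in> borel_measurable M" "h \<in> borel_measurable M"
    and w: "integrable M w"
    and w0: "\<And>x. 0 \<le> w x" and f0: "\<And>x. 0 \<le> f x" and h: "\<And>x. norm (h x) \<le> w x * f x"
  shows "ennreal (norm (\<integral>x. h x \<partial>M) powr p)
     \<le> ennreal ((\<integral>x. w x \<partial>M) powr (p - 1)) * (\<integral>\<^sup>+x. ennreal (w x * f x powr p) \<partial>M)"
proof (cases "(\<integral>\<^sup>+x. ennreal (w x * f x powr p) \<partial>M) = \<infinity>")
  case True
  \<comment> \<open>The product of \<open>0\<close> and infinity is \<open>0\<close> in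
    \<open>ennreal\<close>, so a weight of mass zero is separated; in that case \<open>h\<close>
    vanishes almost everywhere.\<close>
  show ?thesis
  proof (cases "(\<integral>x. w x \<partial>M) = 0")
    case z: True
    then have "AE x in M. w x = 0" using w w0 by (subst integral_nonneg_eq_0_iff_AE[symmetric]) auto
    then have "AE x in M. h x = 0"
    proof eventually_elim
      case (elim x)
      then show ?case using h[of x] by simp
    qed
    then have "(\<integral>x. h x \<partial>M) = 0" by (intro integral_eq_zero_AE)
    then show ?thesis using p by simp
  next
    case False
    then have "0 < (\<integral>x. w x \<partial>M)" using w0 by (simp add: less_le integral_nonneg)
    then have "ennreal ((\<integral>x. w x \<partial>M) powr (p - 1)) > 0" by (simp add: ennreal_zero_less_mult_iff)
    then show ?thesis using True by (simp add: ennreal_mult_top)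
  qed
next
  case False
  have [measurable]: "w \<in> borel_measurable M" using w by auto
  have wf: "integrable M (\<lambda>x. w x * f x powr p)"
    using False w0 by (intro integrableI_nonneg) (auto simp: less_top)
  note J = weighted_power_mean[OF p _ w wf w0 f0]
  have i: "integrable M (\<lambda>x. w x * f x)" by (rule J(1)) measurable
  have ih: "integrable M h" by (rule Bochner_Integration.integrable_bound[OF i]) (use h w0 f0 in auto)
  have "norm (\<integral>x. h x \<partial>M) \<le> (\<integral>x. norm (h x) \<partial>M)" by (rule integral_norm_bound)
  also have "\<dots> \<le> (\<integral>x. w x * f x \<partial>M)" using ih i h by (intro integral_mono) auto
  finally have "norm (\<integral>x. h x \<partial>M) \<le> (\<integral>x. w x * f x \<partial>M)" .
  then have "norm (\<integral>x. h x \<partial>M) powr p \<le> (\<integral>x. w x * f x \<partial>M) powr p"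
    using p by (intro powr_mono2) auto
  also have "\<dots> \<le> (\<integral>x. w x \<partial>M) powr (p - 1) * (\<integral>x. w x * f x powr p \<partial>M)" by (rule J(2)) measurable
  finally have "ennreal (norm (\<integral>x. h x \<partial>M) powr p) \<le> ennreal ((\<integral>x. w x \<partial>M) powr (p - 1) * (\<integral>x. w x * f x powr p \<partial>M))"
    by (rule ennreal_leI)
  also have "\<dots> = ennreal ((\<integral>x. w x \<partial>M) powr (p - 1)) * (\<integral>\<^sup>+x. ennreal (w x * f x powr p) \<partial>M)"
    using wf w0 by (subst nn_integral_eq_integral) (auto simp: ennreal_mult' integral_nonneg)
  finally show ?thesis .
qed

text \<open>Jensen's inequality for the counting measure with weights \<open>C k\<close> and values
  \<open>a k / C k\<close>; the exponent \<open>1 - p\<close> is what remains of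
  \<open>C k * (a k / C k) powr p\<close>.\<close>

lemma powr_suminf_le:
  fixes C a :: "nat \<Rightarrow> real"
  assumes p: "1 \<le> p" and C0: "\<And>k. 0 < C k" and C: "summable C" and a0: "\<And>k. 0 \<le> a k"
    and s: "summable (\<lambda>k. C k powr (1 - p) * a k powr p)"
  shows "summable a" "suminf a powr p \<le> suminf C powr (p - 1) * (\<Sum>k. C k powr (1 - p) * a k powr p)"
proof -
  let ?M = "count_space (UNIV :: nat set)"
  have eq: "C k * (a k / C k) powr p = C k powr (1 - p) * a k powr p" for k
    using C0[of k] unfolding powr_divide powr_diff by simp
  have w: "integrable ?M C"
    using C C0 by (simp add: integrable_count_space_nat_iff less_imp_le)
  have wf: "integrable ?M (\<lambda>k. C k * (a k / C k) powr p)"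
    unfolding eq using s by (simp add: integrable_count_space_nat_iff)
  have f0: "0 \<le> a k / C k" for k using a0[of k] C0[of k] by simp
  have m: "(\<lambda>k. a k / C k) \<in> borel_measurable ?M" by simp
  note J = weighted_power_mean[OF p m w wf less_imp_le[OF C0] f0]
  have ca: "C k * (a k / C k) = a k" for k using C0[of k] by simp
  have i: "integrable ?M a" using J(1) unfolding ca .
  then show "summable a" using a0 by (simp add: integrable_count_space_nat_iff)
  show "suminf a powr p \<le> suminf C powr (p - 1) * (\<Sum>k. C k powr (1 - p) * a k powr p)"
    using J(2) unfolding eq ca
    using integral_count_space_nat[OF i] integral_count_space_nat[OF w]
      integral_count_space_nat[OF wf[unfolded eq]] by simp
qed

text \<open>The triangle inequality for series in L_p. The norm bounds \<open>C k\<close> themselves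
  serve as Jensen weights: \<open>C k powr (1 - p) * norm (g k x) powr p\<close> has integral at
  most \<open>C k\<close>, so the sum of these functions is finite almost everywhere, and
  \<open>powr_suminf_le\<close> turns it into the bound for \<open>G\<close>.\<close>

lemma Minkowski_suminf:
  fixes g :: "nat \<Rightarrow> 'a \<Rightarrow> complex" and C :: "nat \<Rightarrow> real"
  defines "G \<equiv> \<lambda>x. if summable (\<lambda>k. norm (g k x)) then \<Sum>k. g k x else 0"
  assumes p: "1 \<le> p" and [measurable]: "\<And>k. g k \<in> borel_measurable M"
    and C0: "\<And>k. 0 < C k" and C: "summable C"
    and g: "\<And>k. (\<integral>\<^sup>+x. ennreal (norm (g k x) powr p) \<partial>M) \<le> ennreal (C k powr p)"
  shows "AE x in M. summable (\<lambda>k. norm (g k x))"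
    and "G \<in> borel_measurable M"
    and "(\<integral>\<^sup>+x. ennreal (norm (G x) powr p) \<partial>M) \<le> ennreal (suminf C powr p)"
proof -
  define b where "b k x = C k powr (1 - p) * norm (g k x) powr p" for k x
  have [measurable]: "b k \<in> borel_measurable M" for k unfolding b_def by measurable
  have b0: "0 \<le> b k x" for k x unfolding b_def by simp
  have S0: "0 < suminf C" using C C0 by (simp add: suminf_pos)
  have bk: "(\<integral>\<^sup>+x. ennreal (b k x) \<partial>M) \<le> ennreal (C k)" for k
  proof -
    have "(\<integral>\<^sup>+x. ennreal (b k x) \<partial>M) = ennreal (C k powr (1 - p)) * (\<integral>\<^sup>+x. ennreal (norm (g k x) powr p) \<partial>M)"
      unfolding b_def by (simp add: ennreal_mult' nn_integral_cmult)
    also have "\<dots> \<le> ennreal (C k powr (1 - p)) * ennreal (C k powr p)"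
      by (intro mult_left_mono g) auto
    also have "\<dots> = ennreal (C k)" using C0[of k] by (simp flip: ennreal_mult' powr_add)
    finally show ?thesis .
  qed
  have fin: "(\<integral>\<^sup>+x. (\<Sum>k. ennreal (b k x)) \<partial>M) \<le> ennreal (suminf C)"
  proof -
    have "(\<integral>\<^sup>+x. (\<Sum>k. ennreal (b k x)) \<partial>M) = (\<Sum>k. \<integral>\<^sup>+x. ennreal (b k x) \<partial>M)"
      by (intro nn_integral_suminf) measurable
    also have "\<dots> \<le> (\<Sum>k. ennreal (C k))" by (intro suminf_le bk) auto
    also have "\<dots> = ennreal (suminf C)" using C C0 by (intro suminf_ennreal2) (auto simp: less_imp_le)
    finally show ?thesis .
  qed
  have "AE x in M. (\<Sum>k. ennreal (b k x)) \<noteq> \<infinity>"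
    using fin by (intro nn_integral_PInf_AE) (auto simp: top_unique)
  then have ae: "AE x in M. summable (\<lambda>k. b k x)"
    by eventually_elim (auto intro!: summable_suminf_not_top b0)
  have pt: "summable (\<lambda>k. norm (g k x)) \<and> (\<Sum>k. norm (g k x)) powr p \<le> suminf C powr (p - 1) * (\<Sum>k. b k x)"
    if "summable (\<lambda>k. b k x)" for x
    using powr_suminf_le[OF p C0 C, of "\<lambda>k. norm (g k x)"] that unfolding b_def by auto
  show "AE x in M. summable (\<lambda>k. norm (g k x))" using ae by eventually_elim (use pt in blast)
  have [measurable]: "Measurable.pred M (\<lambda>x. summable (\<lambda>k. norm (g k x)))"
  proof -
    have "summable (\<lambda>k. norm (g k x)) \<longleftrightarrow> (\<Sum>k. ennreal (norm (g k x))) < top" for x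
      using summable_suminf_not_top[of "\<lambda>k. norm (g k x)"] suminf_ennreal2[of "\<lambda>k. norm (g k x)"]
      by (metis ennreal_less_top norm_ge_zero order_less_irrefl)
    then have eq: "(\<lambda>x. summable (\<lambda>k. norm (g k x))) = (\<lambda>x. (\<Sum>k. ennreal (norm (g k x))) < top)" by blast
    show ?thesis unfolding eq by measurable
  qed
  show [measurable]: "G \<in> borel_measurable M" unfolding G_def by measurable
  have "(\<integral>\<^sup>+x. ennreal (norm (G x) powr p) \<partial>M)
      \<le> (\<integral>\<^sup>+x. ennreal (suminf C powr (p - 1)) * (\<Sum>k. ennreal (b k x)) \<partial>M)"
  proof (rule nn_integral_mono_AE)
    show "AE x in M. ennreal (norm (G x) powr p) \<le> ennreal (suminf C powr (p - 1)) * (\<Sum>k. ennreal (b k x))"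
      using ae
    proof eventually_elim
      case (elim x)
      have "norm (G x) \<le> (\<Sum>k. norm (g k x))"
        using pt[OF elim] by (simp add: G_def summable_norm)
      then have "norm (G x) powr p \<le> (\<Sum>k. norm (g k x)) powr p" using p by (intro powr_mono2) auto
      also have "\<dots> \<le> suminf C powr (p - 1) * (\<Sum>k. b k x)" using pt[OF elim] by simp
      finally show ?case
        using suminf_ennreal2[OF b0 elim] by (simp flip: ennreal_mult' add: ennreal_leI)
    qed
  qed
  also have "\<dots> = ennreal (suminf C powr (p - 1)) * (\<integral>\<^sup>+x. (\<Sum>k. ennreal (b k x)) \<partial>M)"
    by (intro nn_integral_cmult) measurable
  also have "\<dots> \<le> ennreal (suminf C powr (p - 1)) * ennreal (suminf C)"
    by (intro mult_left_mono fin) auto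
  also have "\<dots> = ennreal (suminf C powr p)"
    using S0 by (simp flip: ennreal_mult' add: powr_diff)
  finally show "(\<integral>\<^sup>+x. ennreal (norm (G x) powr p) \<partial>M) \<le> ennreal (suminf C powr p)" .
qed

section \<open>Convolution on the circle\<close>

text \<open>Working with Borel functions on the whole line keeps substitutions such as
  \<open>frac (x - t)\<close> and \<open>s - r\<close>, and joint measurability for Fubini,
  unproblematic. The passage from and to \<open>unit_meas\<close> takes place at the very
  end.\<close>

definition unit_lborel :: "real measure" where
  "unit_lborel = density lborel (indicator {0<..<1})"

lemma sets_unit_lborel [simp, measurable_cong]: "sets unit_lborel = sets borel"
  by (simp add: unit_lborel_def)

lemma space_unit_lborel [simp]: "space unit_lborel = UNIV"
  by (simp add: unit_lborel_def)

lemma AE_unit_lborel: "(AE x in unit_lborel. P x) \<longleftrightarrow> (AE x in lborel. x \<in> {0<..<1} \<longrightarrow> P x)"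
  unfolding unit_lborel_def by (subst AE_density) (auto simp: indicator_def intro!: arg_cong[where f="\<lambda>P. eventually P _"])

lemma nn_integral_unit_lborel:
  "f \<in> borel_measurable borel \<Longrightarrow>
    (\<integral>\<^sup>+x. f x \<partial>unit_lborel) = (\<integral>\<^sup>+x. f x * indicator {0<..<1} x \<partial>lborel)"
  by (simp add: unit_lborel_def nn_integral_density mult.commute)

lemma unit_lborel_eq: "unit_lborel = density lborel (\<lambda>x. ennreal (indicat_real {0<..<1} x))"
  unfolding unit_lborel_def by (intro density_cong) (auto simp: indicator_def)

lemma integral_unit_lborel:
  fixes f :: "real \<Rightarrow> 'a::{banach, second_countable_topology}"
  assumes [measurable]: "f \<in> borel_measurable borel"
  shows "(\<integral>x. f x \<partial>unit_lborel) = (\<integral>x. indicator {0<..<1} x *\<^sub>R f x \<partial>lborel)"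
    and "integrable unit_lborel f \<longleftrightarrow> integrable lborel (\<lambda>x. indicator {0<..<1} x *\<^sub>R f x)"
  unfolding unit_lborel_eq by (simp_all add: integral_density integrable_density)

lemma emeasure_unit_lborel_UNIV [simp]: "emeasure unit_lborel UNIV = 1"
  by (simp add: unit_lborel_def emeasure_density)

interpretation unit_lborel: finite_measure unit_lborel
  by standard simp

interpretation unit_lborel2: pair_sigma_finite unit_lborel unit_lborel ..

text \<open>An upper bound for the L_p norm instead of the norm itself. Positivity of
  \<open>C\<close> allows it to be used as a Jensen weight.\<close>

definition Lp_le :: "real \<Rightarrow> real \<Rightarrow> (real \<Rightarrow> complex) \<Rightarrow> bool" where
  "Lp_le p C g \<longleftrightarrow> g \<in> borel_measurable borel \<and> 0 < C \<and>
     (\<integral>\<^sup>+x. ennreal (norm (g x) powr p) \<partial>unit_lborel) \<le> ennreal (C powr p)"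

lemma Lp_le_measurable [measurable_dest]: "Lp_le p C g \<Longrightarrow> g \<in> borel_measurable borel"
  and Lp_le_pos: "Lp_le p C g \<Longrightarrow> 0 < C"
  by (auto simp: Lp_le_def)

lemma Lp_le_mult_bounded:
  assumes "1 \<le> p" "Lp_le p C g" "0 < K" "K * C \<le> D" and [measurable]: "f \<in> borel_measurable borel"
    and f: "\<And>x. 0 < x \<Longrightarrow> x < 1 \<Longrightarrow> norm (f x) \<le> K"
  shows "Lp_le p D (\<lambda>x. f x * g x)"
proof -
  have [measurable]: "g \<in> borel_measurable borel" and C: "0 < C"
    and g: "(\<integral>\<^sup>+x. ennreal (norm (g x) powr p) \<partial>unit_lborel) \<le> ennreal (C powr p)"
    using assms by (auto simp: Lp_le_def)
  have ae: "AE x in unit_lborel. ennreal (norm (f x * g x) powr p) \<le> ennreal (K powr p) * ennreal (norm (g x) powr p)"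
    unfolding AE_unit_lborel
  proof (intro always_eventually allI impI)
    fix x :: real assume "x \<in> {0<..<1}"
    then have "norm (f x * g x) \<le> K * norm (g x)" using f by (auto simp: norm_mult intro!: mult_right_mono)
    then have "norm (f x * g x) powr p \<le> (K * norm (g x)) powr p" using assms by (intro powr_mono2) auto
    also have "\<dots> = K powr p * norm (g x) powr p" by (rule powr_mult)
    finally show "ennreal (norm (f x * g x) powr p) \<le> ennreal (K powr p) * ennreal (norm (g x) powr p)"
      by (simp flip: ennreal_mult')
  qed
  have "(\<integral>\<^sup>+x. ennreal (norm (f x * g x) powr p) \<partial>unit_lborel)
      \<le> (\<integral>\<^sup>+x. ennreal (K powr p) * ennreal (norm (g x) powr p) \<partial>unit_lborel)"
    by (intro nn_integral_mono_AE ae)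
  also have "\<dots> = ennreal (K powr p) * (\<integral>\<^sup>+x. ennreal (norm (g x) powr p) \<partial>unit_lborel)"
    by (intro nn_integral_cmult) measurable
  also have "\<dots> \<le> ennreal (K powr p) * ennreal (C powr p)" by (intro mult_left_mono g) auto
  also have "\<dots> = ennreal ((K * C) powr p)" by (simp add: ennreal_mult' powr_mult)
  also have "\<dots> \<le> ennreal (D powr p)"
    using assms C by (intro ennreal_leI powr_mono2) auto
  finally have *: "(\<integral>\<^sup>+x. ennreal (norm (f x * g x) powr p) \<partial>unit_lborel) \<le> ennreal (D powr p)" .
  have "0 < K * C" using assms(3) C by simp
  then have "0 < D" using assms(4) by linarith
  with * show ?thesis unfolding Lp_le_def by simp
qed

lemma Lp_le_mono: "Lp_le p C g \<Longrightarrow> 1 \<le> p \<Longrightarrow> C \<le> D \<Longrightarrow> Lp_le p D g"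
  using Lp_le_mult_bounded[of p C g 1 D "\<lambda>_. 1"] by simp

lemma Lp_le_bounded:
  assumes "1 \<le> p" and [measurable]: "g \<in> borel_measurable borel" and "0 < K"
    and g: "\<And>x. 0 < x \<Longrightarrow> x < 1 \<Longrightarrow> norm (g x) \<le> K"
  shows "Lp_le p K g"
proof -
  have "Lp_le p 1 (\<lambda>_. 1)" by (simp add: Lp_le_def)
  from Lp_le_mult_bounded[OF assms(1) this assms(3) _ assms(2) g, of K] show ?thesis by simp
qed

text \<open>The two-term analogue of \<open>powr_suminf_le\<close>: both tangents are taken at
  \<open>(a + b) / (C + D)\<close>, and with weights \<open>C\<close> and \<open>D\<close> their
  linear parts cancel.\<close>

lemma powr_add_le:
  fixes a b C D p :: real
  assumes p: "1 \<le> p" and "0 < C" "0 < D" "0 \<le> a" "0 \<le> b"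
  shows "(a + b) powr p \<le> (C + D) powr (p - 1) * (C powr (1 - p) * a powr p + D powr (1 - p) * b powr p)"
proof (cases "a + b = 0")
  case True then show ?thesis using assms by simp
next
  case False
  define s where "s = (a + b) / (C + D)"
  have s: "0 < s" using assms False unfolding s_def by auto
  have sab: "(C + D) * s = a + b" using assms unfolding s_def by simp
  have 1: "C * (s powr p + p * s powr (p - 1) * (a / C - s)) \<le> C * (a / C) powr p"
    using assms s by (intro mult_left_mono powr_above_tangent) auto
  have 2: "D * (s powr p + p * s powr (p - 1) * (b / D - s)) \<le> D * (b / D) powr p"
    using assms s by (intro mult_left_mono powr_above_tangent) auto
  have "C * (s powr p + p * s powr (p - 1) * (a / C - s)) + D * (s powr p + p * s powr (p - 1) * (b / D - s))
    = (C + D) * s powr p + p * s powr (p - 1) * ((a + b) - (C + D) * s)"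
    using assms by (simp add: field_simps)
  also have "\<dots> = (C + D) * s powr p" unfolding sab by simp
  finally have 3: "(C + D) * s powr p \<le> C * (a / C) powr p + D * (b / D) powr p" using 1 2 by linarith
  have "(a + b) powr p = ((C + D) * s) powr p" unfolding sab ..
  also have "\<dots> = (C + D) powr p * s powr p" by (rule powr_mult)
  also have "\<dots> = (C + D) powr (p - 1) * ((C + D) * s powr p)"
    using assms by (simp add: powr_diff)
  also have "\<dots> \<le> (C + D) powr (p - 1) * (C * (a / C) powr p + D * (b / D) powr p)"
    by (intro mult_left_mono 3) auto
  also have "\<dots> = (C + D) powr (p - 1) * (C powr (1 - p) * a powr p + D powr (1 - p) * b powr p)"
    using assms unfolding powr_divide powr_diff[of _ 1 p] by simp
  finally show ?thesis .
qed

lemma Lp_le_add: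
  assumes p: "1 \<le> p" and f: "Lp_le p C f" and g: "Lp_le p D g"
  shows "Lp_le p (C + D) (\<lambda>x. f x + g x)"
proof -
  have [measurable]: "f \<in> borel_measurable borel" "g \<in> borel_measurable borel" and CD: "0 < C" "0 < D"
    and f': "(\<integral>\<^sup>+x. ennreal (norm (f x) powr p) \<partial>unit_lborel) \<le> ennreal (C powr p)"
    and g': "(\<integral>\<^sup>+x. ennreal (norm (g x) powr p) \<partial>unit_lborel) \<le> ennreal (D powr p)"
    using f g by (auto simp: Lp_le_def)
  have "(\<integral>\<^sup>+x. ennreal (norm (f x + g x) powr p) \<partial>unit_lborel)
    \<le> (\<integral>\<^sup>+x. ennreal ((C + D) powr (p - 1)) * (ennreal (C powr (1 - p)) * ennreal (norm (f x) powr p) + ennreal (D powr (1 - p)) * ennreal (norm (g x) powr p)) \<partial>unit_lborel)"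
  proof (intro nn_integral_mono)
    fix x
    have "norm (f x + g x) powr p \<le> (norm (f x) + norm (g x)) powr p"
      using p by (intro powr_mono2 norm_triangle_ineq) auto
    also have "\<dots> \<le> (C + D) powr (p - 1) * (C powr (1 - p) * norm (f x) powr p + D powr (1 - p) * norm (g x) powr p)"
      using p CD by (intro powr_add_le) auto
    finally show "ennreal (norm (f x + g x) powr p) \<le> ennreal ((C + D) powr (p - 1)) * (ennreal (C powr (1 - p)) * ennreal (norm (f x) powr p) + ennreal (D powr (1 - p)) * ennreal (norm (g x) powr p))"
      by (simp flip: ennreal_mult' ennreal_plus)
  qed
  also have "\<dots> = ennreal ((C + D) powr (p - 1)) * (ennreal (C powr (1 - p)) * (\<integral>\<^sup>+x. ennreal (norm (f x) powr p) \<partial>unit_lborel) + ennreal (D powr (1 - p)) * (\<integral>\<^sup>+x. ennreal (norm (g x) powr p) \<partial>unit_lborel))"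
    by (simp add: nn_integral_cmult nn_integral_add)
  also have "\<dots> \<le> ennreal ((C + D) powr (p - 1)) * (ennreal (C powr (1 - p)) * ennreal (C powr p) + ennreal (D powr (1 - p)) * ennreal (D powr p))"
    by (intro mult_left_mono add_mono f' g') auto
  also have "\<dots> = ennreal ((C + D) powr p)"
    using CD by (simp flip: ennreal_mult' ennreal_plus powr_add) (simp add: powr_diff)
  finally show ?thesis using CD unfolding Lp_le_def by simp
qed

lemma Lp_le_L1:
  assumes p: "1 \<le> p" and g: "Lp_le p C g"
  shows "integrable unit_lborel g" and "(\<integral>x. norm (g x) \<partial>unit_lborel) \<le> C"
proof -
  have [measurable]: "g \<in> borel_measurable borel" and C: "0 < C"
    and g': "(\<integral>\<^sup>+x. ennreal (norm (g x) powr p) \<partial>unit_lborel) \<le> ennreal (C powr p)"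
    using g by (auto simp: Lp_le_def)
  have wf: "integrable unit_lborel (\<lambda>x. 1 * norm (g x) powr p)"
  proof (rule integrableI_nonneg)
    have "(\<integral>\<^sup>+x. ennreal (1 * norm (g x) powr p) \<partial>unit_lborel) \<le> ennreal (C powr p)" using g' by simp
    also have "\<dots> < \<infinity>" by simp
    finally show "(\<integral>\<^sup>+x. ennreal (1 * norm (g x) powr p) \<partial>unit_lborel) < \<infinity>" .
  qed auto
  have one: "integrable unit_lborel (\<lambda>x. 1::real)" by simp
  have m: "(\<lambda>x. norm (g x)) \<in> borel_measurable unit_lborel" by measurable
  note J = weighted_power_mean[OF p m one wf]
  have i: "integrable unit_lborel (\<lambda>x. norm (g x))" using J(1) by simp
  then show "integrable unit_lborel g" by (subst (asm) integrable_norm_iff) auto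
  have m1: "measure unit_lborel UNIV = 1" by (simp add: measure_def)
  have "(\<integral>x. norm (g x) \<partial>unit_lborel) powr p \<le> (\<integral>x. norm (g x) powr p \<partial>unit_lborel)"
    using J(2) m1 by simp
  also have "\<dots> \<le> C powr p"
    using g' wf by (subst (asm) nn_integral_eq_integral) auto
  finally have *: "(\<integral>x. norm (g x) \<partial>unit_lborel) powr p \<le> C powr p" .
  show "(\<integral>x. norm (g x) \<partial>unit_lborel) \<le> C"
  proof (rule ccontr)
    assume "\<not> ?thesis"
    then have "C powr p < (\<integral>x. norm (g x) \<partial>unit_lborel) powr p" using C p by (intro powr_less_mono2) auto
    with * show False by simp
  qed
qed

lemma Lp_le_1_iff:
  assumes [measurable]: "g \<in> borel_measurable borel"
  shows "Lp_le 1 C g \<longleftrightarrow> 0 < C \<and> integrable unit_lborel g \<and> (\<integral>x. norm (g x) \<partial>unit_lborel) \<le> C"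
proof
  assume g: "Lp_le 1 C g"
  show "0 < C \<and> integrable unit_lborel g \<and> (\<integral>x. norm (g x) \<partial>unit_lborel) \<le> C"
    using Lp_le_L1[OF _ g] Lp_le_pos[OF g] by auto
next
  assume "0 < C \<and> integrable unit_lborel g \<and> (\<integral>x. norm (g x) \<partial>unit_lborel) \<le> C"
  then show "Lp_le 1 C g" unfolding Lp_le_def
    by (simp add: nn_integral_eq_integral)
qed

lemma Lp_le_exists:
  assumes "1 \<le> p" and [measurable]: "g \<in> borel_measurable borel"
    and "integrable unit_lborel (\<lambda>x. norm (g x) powr p)"
  obtains C where "Lp_le p C g"
proof
  let ?I = "\<integral>x. norm (g x) powr p \<partial>unit_lborel"
  have I: "0 \<le> ?I" by simp
  have "?I \<le> 1 * (1 + ?I)" by simp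
  also have "\<dots> \<le> (1 + ?I) powr p"
    using I assms(1) powr_mono[of 1 p "1 + ?I"] by simp
  finally show "Lp_le p (1 + ?I) g"
    using I assms(3) unfolding Lp_le_def by (auto simp: nn_integral_eq_integral intro: add_pos_nonneg)
qed

text \<open>Termwise integration is stated for every bounded \<open>\<phi>\<close>, as it serves
  both Fourier coefficients and transforms at arbitrary real frequencies.\<close>

lemma Lp_le_suminf:
  fixes g :: "nat \<Rightarrow> real \<Rightarrow> complex"
  assumes p: "1 \<le> p" and g: "\<And>k. Lp_le p (C k) (g k)" and C: "summable C"
  obtains G where "Lp_le p (suminf C) G" "AE x in unit_lborel. summable (\<lambda>k. norm (g k x))"
    "\<And>\<phi> K. \<phi> \<in> borel_measurable borel \<Longrightarrow> (\<And>x. norm (\<phi> x) \<le> K) \<Longrightarrow>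
       (\<lambda>k. \<integral>x. \<phi> x * g k x \<partial>unit_lborel) sums (\<integral>x. \<phi> x * G x \<partial>unit_lborel)"
proof -
  let ?G = "\<lambda>x. if summable (\<lambda>k. norm (g k x)) then \<Sum>k. g k x else 0"
  have [measurable]: "g k \<in> borel_measurable borel" and C0: "0 < C k"
    and gk: "(\<integral>\<^sup>+x. ennreal (norm (g k x) powr p) \<partial>unit_lborel) \<le> ennreal (C k powr p)" for k
    using g by (auto simp: Lp_le_def)
  have "g k \<in> borel_measurable unit_lborel" for k by measurable
  note M = Minkowski_suminf[OF p this C0 C gk]
  have G: "Lp_le p (suminf C) ?G"
    unfolding Lp_le_def using M(2,3) C C0 by (auto intro!: suminf_pos)
  have "(\<lambda>k. \<integral>x. \<phi> x * g k x \<partial>unit_lborel) sums (\<integral>x. \<phi> x * ?G x \<partial>unit_lborel)"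
    if [measurable]: "\<phi> \<in> borel_measurable borel" and K: "\<And>x. norm (\<phi> x) \<le> K" for \<phi> K
  proof -
    have K0: "0 \<le> K" using K[of 0] norm_ge_zero order_trans by blast
    have i: "integrable unit_lborel (\<lambda>x. \<phi> x * g k x)" for k
    proof (rule Bochner_Integration.integrable_bound)
      show "integrable unit_lborel (\<lambda>x. K * norm (g k x))" using Lp_le_L1(1)[OF p g] by simp
      show "AE x in unit_lborel. norm (\<phi> x * g k x) \<le> norm (K * norm (g k x))"
        using K K0 by (auto simp: norm_mult intro!: mult_right_mono)
    qed measurable
    have "(\<lambda>k. \<integral>x. \<phi> x * g k x \<partial>unit_lborel) sums (\<integral>x. (\<Sum>k. \<phi> x * g k x) \<partial>unit_lborel)"
    proof (rule sums_integral[OF i])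
      show "AE x in unit_lborel. summable (\<lambda>k. norm (\<phi> x * g k x))"
        using M(1) by eventually_elim (auto simp: norm_mult)
      show "summable (\<lambda>k. \<integral>x. norm (\<phi> x * g k x) \<partial>unit_lborel)"
      proof (rule summable_comparison_test'[OF summable_mult[OF C, of K]])
        fix k
        have "(\<integral>x. norm (\<phi> x * g k x) \<partial>unit_lborel) \<le> (\<integral>x. K * norm (g k x) \<partial>unit_lborel)"
          using K by (intro integral_mono integrable_norm i integrable_mult_right Lp_le_L1(1)[OF p g]) (auto simp: norm_mult intro!: mult_right_mono)
        also have "\<dots> \<le> K * C k" using Lp_le_L1(2)[OF p g, of k] K0 by (simp add: mult_left_mono)
        finally show "norm (\<integral>x. norm (\<phi> x * g k x) \<partial>unit_lborel) \<le> K * C k" by simp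
      qed
    qed
    also have "(\<integral>x. (\<Sum>k. \<phi> x * g k x) \<partial>unit_lborel) = (\<integral>x. \<phi> x * ?G x \<partial>unit_lborel)"
    proof (rule integral_cong_AE)
      show "AE x in unit_lborel. (\<Sum>k. \<phi> x * g k x) = \<phi> x * ?G x"
        using M(1)
      proof eventually_elim
        case (elim x)
        show ?case using elim suminf_mult[OF summable_norm_cancel[OF elim], of "\<phi> x"] by simp
      qed
    qed (use M(2) in measurable)
    finally show ?thesis .
  qed
  from that[OF G M(1) this] show ?thesis .
qed

section \<open>Rotations and the reflection of the circle\<close>

lemma borel_measurable_frac [measurable]: "(frac :: real \<Rightarrow> real) \<in> borel_measurable borel"
  unfolding frac_def[abs_def] by measurable

lemma distr_frac_unit_lborel: "distr unit_lborel borel (\<lambda>x. frac (x - t)) = unit_lborel"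
proof (rule measure_eqI)
  fix A assume "A \<in> sets (distr unit_lborel borel (\<lambda>x. frac (x - t)))"
  then have A [measurable]: "A \<in> sets borel" by simp
  \<comment> \<open>Modulo one, subtracting \<open>t\<close> is subtracting \<open>s\<close>. The
    rotation cuts the interval at \<open>s\<close> and exchanges the two pieces, so the measure is
    compared piece by piece.\<close>
  define s where "s = frac t"
  have s: "0 \<le> s" "s < 1" unfolding s_def by (auto simp: frac_lt_1)
  have fr: "frac (x - t) = (if x < s then x - s + 1 else x - s)" if "0 < x" "x < 1" for x
  proof -
    have "x - t - (x - s + 1) = of_int (- \<lfloor>t\<rfloor> - 1)" "x - t - (x - s) = of_int (- \<lfloor>t\<rfloor>)"
      unfolding s_def frac_def by simp_all
    then have "x - t - (x - s + 1) \<in> \<int>" "x - t - (x - s) \<in> \<int>" by (metis Ints_of_int)+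
    then show ?thesis using that s unfolding frac_unique_iff by auto
  qed
  have "emeasure (distr unit_lborel borel (\<lambda>x. frac (x - t))) A = (\<integral>\<^sup>+x. indicator A (frac (x - t)) \<partial>unit_lborel)"
    by (simp add: nn_integral_distr flip: nn_integral_indicator)
  also have "\<dots> = (\<integral>\<^sup>+x. indicator A (frac (x - t)) * indicator {0<..<1} x \<partial>lborel)"
    by (intro nn_integral_unit_lborel) measurable
  also have "\<dots> = (\<integral>\<^sup>+x. indicator A (x - s + 1) * indicator {0<..<s} x + indicator A (x - s) * indicator {s..<1} x \<partial>lborel)"
  proof (rule nn_integral_cong_AE)
    have "AE x in lborel. x \<noteq> (0::real)" by (rule AE_lborel_singleton)
    then show "AE x in lborel. indicator A (frac (x - t)) * indicator {0<..<1} x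
      = (indicator A (x - s + 1) * indicator {0<..<s} x + indicator A (x - s) * indicator {s..<1} x :: ennreal)"
    proof eventually_elim
      case (elim x)
      show ?case using elim s fr[of x] by (auto simp: indicator_def)
    qed
  qed
  also have "\<dots> = (\<integral>\<^sup>+x. indicator A (x - s + 1) * indicator {0<..<s} x \<partial>lborel) + (\<integral>\<^sup>+x. indicator A (x - s) * indicator {s..<1} x \<partial>lborel)"
    by (intro nn_integral_add) measurable
  also have "(\<integral>\<^sup>+x. indicator A (x - s + 1) * indicator {0<..<s} x \<partial>lborel)
    = (\<integral>\<^sup>+y. indicator A y * indicator {1 - s<..<1} y \<partial>lborel)"
    by (subst nn_integral_real_affine[of _ 1 "s - 1"]) (auto simp: indicator_def intro!: nn_integral_cong)
  also have "(\<integral>\<^sup>+x. indicator A (x - s) * indicator {s..<1} x \<partial>lborel)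
    = (\<integral>\<^sup>+y. indicator A y * indicator {0..<1 - s} y \<partial>lborel)"
    by (subst nn_integral_real_affine[of _ 1 s]) (auto simp: indicator_def intro!: nn_integral_cong)
  also have "(\<integral>\<^sup>+y. indicator A y * indicator {1 - s<..<1} y \<partial>lborel) + (\<integral>\<^sup>+y. indicator A y * indicator {0..<1 - s} y \<partial>lborel)
    = (\<integral>\<^sup>+y. indicator A y * indicator {1 - s<..<1} y + indicator A y * indicator {0..<1 - s} y \<partial>lborel)"
    by (intro nn_integral_add[symmetric]) measurable
  also have "\<dots> = (\<integral>\<^sup>+y. indicator A y * indicator {0<..<1} y \<partial>lborel)"
  proof (rule nn_integral_cong_AE)
    have "AE x in lborel. x \<noteq> (0::real)" "AE x in lborel. x \<noteq> 1 - s" by (rule AE_lborel_singleton)+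
    then show "AE y in lborel. indicator A y * indicator {1 - s<..<1} y + indicator A y * indicator {0..<1 - s} y
       = (indicator A y * indicator {0<..<1} y :: ennreal)"
      by eventually_elim (use s in \<open>auto simp: indicator_def\<close>)
  qed
  also have "\<dots> = (\<integral>\<^sup>+x. indicator A x \<partial>unit_lborel)"
    by (intro nn_integral_unit_lborel[symmetric]) measurable
  also have "\<dots> = emeasure unit_lborel A" by simp
  finally show "emeasure (distr unit_lborel borel (\<lambda>x. frac (x - t))) A = emeasure unit_lborel A" .
qed simp

lemma distr_reflect_unit_lborel: "distr unit_lborel borel (\<lambda>x. 1 - x) = unit_lborel"
proof (rule measure_eqI)
  fix A assume "A \<in> sets (distr unit_lborel borel (\<lambda>x. 1 - x))"
  then have A [measurable]: "A \<in> sets borel" by simp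
  have "emeasure (distr unit_lborel borel (\<lambda>x. 1 - x)) A = (\<integral>\<^sup>+x. indicator A (1 - x) \<partial>unit_lborel)"
    by (simp add: nn_integral_distr flip: nn_integral_indicator)
  also have "\<dots> = (\<integral>\<^sup>+x. indicator A (1 - x) * indicator {0<..<1} x \<partial>lborel)"
    by (intro nn_integral_unit_lborel) measurable
  also have "\<dots> = (\<integral>\<^sup>+x. indicator A x * indicator {0<..<1} x \<partial>lborel)"
    by (subst nn_integral_real_affine[of _ "-1" 1]) (auto simp: indicator_def intro!: nn_integral_cong)
  also have "\<dots> = (\<integral>\<^sup>+x. indicator A x \<partial>unit_lborel)"
    by (intro nn_integral_unit_lborel[symmetric]) measurable
  also have "\<dots> = emeasure unit_lborel A" by simp
  finally show "emeasure (distr unit_lborel borel (\<lambda>x. 1 - x)) A = emeasure unit_lborel A" .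
qed simp

definition fexp :: "int \<Rightarrow> real \<Rightarrow> complex" where
  "fexp n x = exp (- 2 * of_real pi * of_int n * \<i> * of_real x)"

lemma fexp_measurable [measurable]: "fexp n \<in> borel_measurable borel"
  unfolding fexp_def by measurable

lemma norm_fexp [simp]: "norm (fexp n x) = 1"
  by (simp add: fexp_def)

lemma fexp_add: "fexp n (x + y) = fexp n x * fexp n y"
  by (simp add: fexp_def algebra_simps flip: exp_add)

lemma fexp_add_index: "fexp (m + n) x = fexp m x * fexp n x"
  by (simp add: fexp_def algebra_simps flip: exp_add)

lemma fexp_int [simp]: "fexp n (of_int m) = 1"
  unfolding fexp_def exp_eq_1 by (auto intro!: exI[of _ "- n * m"])

lemma fexp_frac [simp]: "fexp n (frac x) = fexp n x"
proof -
  have "fexp n x = fexp n (frac x + of_int \<lfloor>x\<rfloor>)" by (simp add: frac_def)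
  then show ?thesis unfolding fexp_add by simp
qed

text \<open>Young's inequality. Jensen with weight \<open>norm (f t)\<close>, Tonelli and rotation
  invariance bound the p-th power of the norm of the convolution by that of the L_1 norm of
  \<open>f\<close> times the L_p norm of \<open>g\<close>, and on an interval of length one the L_1
  norm is at most the L_p norm. Coefficients multiply because \<open>fexp n\<close> is a character
  of the circle.\<close>

lemma circle_convolution:
  assumes p: "1 \<le> p" and f: "Lp_le p C f" and g: "Lp_le p D g"
  obtains k where "Lp_le p (C * D) k"
    "\<And>n. (\<integral>x. fexp n x * k x \<partial>unit_lborel)
      = (\<integral>x. fexp n x * f x \<partial>unit_lborel) * (\<integral>x. fexp n x * g x \<partial>unit_lborel)"
proof -
  have [measurable]: "f \<in> borel_measurable borel" "g \<in> borel_measurable borel" and CD: "0 < C" "0 < D"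
    and g': "(\<integral>\<^sup>+x. ennreal (norm (g x) powr p) \<partial>unit_lborel) \<le> ennreal (D powr p)"
    using f g by (auto simp: Lp_le_def)
  note fi = Lp_le_L1[OF p f] and gi = Lp_le_L1[OF p g]
  define k where "k x = (\<integral>t. f t * g (frac (x - t)) \<partial>unit_lborel)" for x
  have k [measurable]: "k \<in> borel_measurable borel" unfolding k_def by measurable
  let ?F = "\<integral>t. norm (f t) \<partial>unit_lborel"
  have F0: "0 \<le> ?F" by simp
  have rot_nn: "(\<integral>\<^sup>+x. h (frac (x - t)) \<partial>unit_lborel) = (\<integral>\<^sup>+x. h x \<partial>unit_lborel)"
    if [measurable]: "h \<in> borel_measurable borel" for h :: "real \<Rightarrow> ennreal" and t
    by (subst distr_frac_unit_lborel[of t, symmetric]) (simp add: nn_integral_distr)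
  have rot: "(\<integral>x. h (frac (x - t)) \<partial>unit_lborel) = (\<integral>x. h x \<partial>unit_lborel)"
    if [measurable]: "h \<in> borel_measurable borel" for h :: "real \<Rightarrow> 'b::{banach, second_countable_topology}" and t
    by (subst distr_frac_unit_lborel[of t, symmetric]) (simp add: integral_distr)
  have rot_i: "integrable unit_lborel (\<lambda>x. h (frac (x - t)))"
    if [measurable]: "h \<in> borel_measurable borel" and "integrable unit_lborel h" for h :: "real \<Rightarrow> complex" and t
    using that(2) by (subst (asm) distr_frac_unit_lborel[of t, symmetric]) (simp add: integrable_distr_eq)
  have "(\<integral>\<^sup>+x. ennreal (norm (k x) powr p) \<partial>unit_lborel)
     \<le> (\<integral>\<^sup>+x. ennreal (?F powr (p - 1)) * (\<integral>\<^sup>+t. ennreal (norm (f t) * norm (g (frac (x - t))) powr p) \<partial>unit_lborel) \<partial>unit_lborel)"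
  proof (rule nn_integral_mono)
    fix x
    show "ennreal (norm (k x) powr p) \<le> ennreal (?F powr (p - 1)) * (\<integral>\<^sup>+t. ennreal (norm (f t) * norm (g (frac (x - t))) powr p) \<partial>unit_lborel)"
      unfolding k_def using fi by (intro norm_integral_powr_le p) (auto simp: norm_mult)
  qed
  also have "\<dots> = ennreal (?F powr (p - 1)) * (\<integral>\<^sup>+x. (\<integral>\<^sup>+t. ennreal (norm (f t) * norm (g (frac (x - t))) powr p) \<partial>unit_lborel) \<partial>unit_lborel)"
    by (intro nn_integral_cmult) measurable
  also have "(\<integral>\<^sup>+x. (\<integral>\<^sup>+t. ennreal (norm (f t) * norm (g (frac (x - t))) powr p) \<partial>unit_lborel) \<partial>unit_lborel)
     = (\<integral>\<^sup>+t. (\<integral>\<^sup>+x. ennreal (norm (f t) * norm (g (frac (x - t))) powr p) \<partial>unit_lborel) \<partial>unit_lborel)"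
    by (intro unit_lborel2.Fubini') measurable
  also have "\<dots> = (\<integral>\<^sup>+t. ennreal (norm (f t)) * (\<integral>\<^sup>+x. ennreal (norm (g x) powr p) \<partial>unit_lborel) \<partial>unit_lborel)"
  proof (rule nn_integral_cong)
    fix t
    show "(\<integral>\<^sup>+x. ennreal (norm (f t) * norm (g (frac (x - t))) powr p) \<partial>unit_lborel)
      = ennreal (norm (f t)) * (\<integral>\<^sup>+x. ennreal (norm (g x) powr p) \<partial>unit_lborel)"
      using rot_nn[of "\<lambda>x. ennreal (norm (g x) powr p)" t] by (simp add: ennreal_mult' nn_integral_cmult)
  qed
  also have "\<dots> = (\<integral>\<^sup>+t. ennreal (norm (f t)) \<partial>unit_lborel) * (\<integral>\<^sup>+x. ennreal (norm (g x) powr p) \<partial>unit_lborel)"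
    by (intro nn_integral_multc) measurable
  also have "(\<integral>\<^sup>+t. ennreal (norm (f t)) \<partial>unit_lborel) = ennreal ?F"
    using fi by (intro nn_integral_eq_integral) auto
  also have "ennreal (?F powr (p - 1)) * (ennreal ?F * (\<integral>\<^sup>+x. ennreal (norm (g x) powr p) \<partial>unit_lborel))
    \<le> ennreal (?F powr (p - 1)) * (ennreal ?F * ennreal (D powr p))"
    by (intro mult_left_mono g') auto
  also have "\<dots> = ennreal (?F powr p * D powr p)"
    using F0 by (cases "?F = 0") (auto simp: powr_diff simp flip: ennreal_mult')
  also have "\<dots> \<le> ennreal ((C * D) powr p)"
    unfolding powr_mult using fi CD p by (intro ennreal_leI mult_right_mono powr_mono2) auto
  finally have kp: "Lp_le p (C * D) k" using CD by (simp add: Lp_le_def)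
  have "(\<integral>x. fexp n x * k x \<partial>unit_lborel)
      = (\<integral>x. fexp n x * f x \<partial>unit_lborel) * (\<integral>x. fexp n x * g x \<partial>unit_lborel)" for n
  proof -
    have inner: "integrable unit_lborel (\<lambda>x. fexp n x * (f t * g (frac (x - t))))" for t
    proof (rule Bochner_Integration.integrable_bound)
      show "integrable unit_lborel (\<lambda>x. norm (f t) * norm (g (frac (x - t))))"
        using rot_i[of g t] gi by auto
    qed (auto simp: norm_mult)
    have I: "integrable (unit_lborel \<Otimes>\<^sub>M unit_lborel) (\<lambda>(t, x). fexp n x * (f t * g (frac (x - t))))"
    proof (rule unit_lborel2.Fubini_integrable)
      show "integrable unit_lborel (\<lambda>t. \<integral>x. norm (case (t, x) of (t, x) \<Rightarrow> fexp n x * (f t * g (frac (x - t)))) \<partial>unit_lborel)"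
        using rot[of "\<lambda>x. norm (g x)"] fi by (simp add: norm_mult)
    qed (use inner in auto)
    have "(\<integral>x. fexp n x * k x \<partial>unit_lborel) = (\<integral>x. (\<integral>t. fexp n x * (f t * g (frac (x - t))) \<partial>unit_lborel) \<partial>unit_lborel)"
      unfolding k_def by simp
    also have "\<dots> = (\<integral>t. (\<integral>x. fexp n x * (f t * g (frac (x - t))) \<partial>unit_lborel) \<partial>unit_lborel)"
      using unit_lborel2.Fubini_integral[OF I] by simp
    also have "\<dots> = (\<integral>t. fexp n t * f t * (\<integral>x. fexp n x * g x \<partial>unit_lborel) \<partial>unit_lborel)"
    proof (rule Bochner_Integration.integral_cong[OF refl])
      fix t
      have "(\<integral>x. fexp n x * (f t * g (frac (x - t))) \<partial>unit_lborel)
        = (\<integral>x. (fexp n t * f t) * (fexp n (frac (x - t)) * g (frac (x - t))) \<partial>unit_lborel)"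
      proof (rule Bochner_Integration.integral_cong[OF refl])
        fix x
        show "fexp n x * (f t * g (frac (x - t))) = (fexp n t * f t) * (fexp n (frac (x - t)) * g (frac (x - t)))"
          using fexp_add[of n t "x - t"] by simp
      qed
      also have "\<dots> = (fexp n t * f t) * (\<integral>x. fexp n (frac (x - t)) * g (frac (x - t)) \<partial>unit_lborel)"
        by (rule integral_mult_right_zero)
      also have "(\<integral>x. fexp n (frac (x - t)) * g (frac (x - t)) \<partial>unit_lborel) = (\<integral>x. fexp n x * g x \<partial>unit_lborel)"
        using rot[of "\<lambda>x. fexp n x * g x" t] by simp
      finally show "(\<integral>x. fexp n x * (f t * g (frac (x - t))) \<partial>unit_lborel) = fexp n t * f t * (\<integral>x. fexp n x * g x \<partial>unit_lborel)" .
    qed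
    also have "\<dots> = (\<integral>x. fexp n x * f x \<partial>unit_lborel) * (\<integral>x. fexp n x * g x \<partial>unit_lborel)"
      by (rule integral_mult_left_zero)
    finally show ?thesis .
  qed
  from that[OF kp this] show ?thesis .
qed

section \<open>Trigonometric polynomials\<close>

lemma norm_integral_exp_le:
  fixes s :: real
  assumes "s \<noteq> 0"
  shows "(\<integral>x. exp (\<i> * of_real (s * x)) \<partial>unit_lborel) = (exp (\<i> * of_real s) - 1) / (\<i> * of_real s)"
    and "norm (\<integral>x. exp (\<i> * of_real (s * x)) \<partial>unit_lborel) \<le> 2 / \<bar>s\<bar>"
proof -
  let ?f = "\<lambda>x. exp (\<i> * of_real (s * x))" and ?F = "\<lambda>x. exp (\<i> * of_real (s * x)) / (\<i> * of_real s)"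
  have "(\<integral>x. ?f x \<partial>unit_lborel) = (\<integral>x. indicator {0<..<1} x *\<^sub>R ?f x \<partial>lborel)"
    by (intro integral_unit_lborel) measurable
  also have "\<dots> = (\<integral>x. indicator {0..1} x *\<^sub>R ?f x \<partial>lborel)"
  proof (rule integral_cong_AE)
    have "AE x in lborel. x \<noteq> (0::real)" "AE x in lborel. x \<noteq> (1::real)" by (rule AE_lborel_singleton)+
    then show "AE x in lborel. indicat_real {0<..<1} x *\<^sub>R ?f x = indicator {0..1} x *\<^sub>R ?f x"
      by eventually_elim (auto simp: indicator_def)
  qed auto
  also have "\<dots> = ?F 1 - ?F 0"
  proof (rule integral_FTC_Icc)
    fix x :: real
    show "(?F has_vector_derivative ?f x) (at x within {0..1})"
    proof -
      have "((\<lambda>z. exp (\<i> * (of_real s * z)) / (\<i> * of_real s)) has_field_derivative exp (\<i> * (of_real s * of_real x)) * (\<i> * of_real s) / (\<i> * of_real s)) (at (of_real x))"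
      proof -
        have ii: "- (\<i> * (X * \<i>)) = X" for X by (simp add: complex_eq_iff)
        show ?thesis using assms by (auto intro!: derivative_eq_intros simp: ii)
      qed
      from has_vector_derivative_real_field[OF this] show ?thesis using assms by simp
    qed
  qed (auto intro!: continuous_intros)
  finally show eq: "(\<integral>x. ?f x \<partial>unit_lborel) = (exp (\<i> * of_real s) - 1) / (\<i> * of_real s)"
    by (simp add: diff_divide_distrib)
  have "norm (exp (\<i> * of_real s) - 1) \<le> norm (exp (\<i> * of_real s)) + norm (1::complex)"
    by (rule norm_triangle_ineq4)
  then have "norm (exp (\<i> * of_real s) - 1) \<le> 2" by simp
  then show "norm (\<integral>x. ?f x \<partial>unit_lborel) \<le> 2 / \<bar>s\<bar>"
    unfolding eq by (simp add: norm_divide norm_mult divide_right_mono)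
qed

lemma integral_fexp: "(\<integral>x. fexp n x \<partial>unit_lborel) = (if n = 0 then 1 else 0)"
proof (cases "n = 0")
  case True
  then show ?thesis by (simp add: fexp_def measure_def)
next
  case False
  have eq: "fexp n = (\<lambda>x. exp (\<i> * of_real ((- 2 * pi * of_int n) * x)))"
    by (simp add: fexp_def fun_eq_iff algebra_simps)
  have "fexp n 1 = 1" using fexp_int[of n 1] by simp
  then show ?thesis
    using False norm_integral_exp_le(1)[of "- 2 * pi * of_int n"] unfolding eq by simp
qed

inductive trigpoly :: "(real \<Rightarrow> complex) \<Rightarrow> bool" where
  monom: "trigpoly (\<lambda>x. c * fexp k x)"
| add: "trigpoly f \<Longrightarrow> trigpoly g \<Longrightarrow> trigpoly (\<lambda>x. f x + g x)"

lemma trigpoly_const: "trigpoly (\<lambda>x. c)"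
  using trigpoly.monom[of c 0] by (simp add: fexp_def)

lemma trigpoly_mult:
  assumes "trigpoly f" "trigpoly g" shows "trigpoly (\<lambda>x. f x * g x)"
  using assms
proof (induction f)
  case (monom c k)
  from monom.prems show ?case
  proof (induction g)
    case (monom d m)
    have "(\<lambda>x. c * fexp k x * (d * fexp m x)) = (\<lambda>x. (c * d) * fexp (k + m) x)"
      by (simp add: fexp_add_index fun_eq_iff)
    then show ?case by (simp only: trigpoly.monom)
  next
    case (add g1 g2)
    then show ?case by (simp add: distrib_left trigpoly.add)
  qed
next
  case (add f1 f2)
  then show ?case by (simp add: distrib_right trigpoly.add)
qed

lemma trigpoly_measurable: "trigpoly f \<Longrightarrow> f \<in> borel_measurable borel"
  by (induction rule: trigpoly.induct) auto

lemma trigpoly_bounded: "trigpoly f \<Longrightarrow> \<exists>K. \<forall>x. norm (f x) \<le> K"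
proof (induction rule: trigpoly.induct)
  case (monom c k)
  then show ?case by (auto simp: norm_mult)
next
  case (add f g)
  then obtain K L where "\<forall>x. norm (f x) \<le> K" "\<forall>x. norm (g x) \<le> L" by auto
  then have "norm (f x + g x) \<le> K + L" for x by (meson add_mono norm_triangle_ineq order_trans)
  then show ?case by auto
qed

lemma trigpoly_integrable:
  assumes "trigpoly f" and [measurable]: "h \<in> borel_measurable borel" and "\<And>x. norm (h x) \<le> K"
  shows "integrable unit_lborel (\<lambda>x. h x * f x)"
proof -
  note [measurable] = trigpoly_measurable[OF assms(1)]
  obtain L where L: "norm (f x) \<le> L" for x using trigpoly_bounded[OF assms(1)] by auto
  have "norm (h x * f x) \<le> K * L" for x
    unfolding norm_mult using assms(3) L by (intro mult_mono) (auto intro: order_trans[OF norm_ge_zero])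
  then show ?thesis by (intro unit_lborel.integrable_const_bound[of _ "K * L"]) auto
qed

text \<open>Orthogonality of the characters. Consequently, subtracting a trigonometric polynomial
  leaves all coefficients of large index unchanged.\<close>

lemma trigpoly_coeff: "trigpoly f \<Longrightarrow> \<exists>M. \<forall>n. M \<le> \<bar>n\<bar> \<longrightarrow> (\<integral>x. fexp n x * f x \<partial>unit_lborel) = 0"
proof (induction rule: trigpoly.induct)
  case (monom c k)
  have "(\<integral>x. fexp n x * (c * fexp k x) \<partial>unit_lborel) = 0" if "\<bar>k\<bar> + 1 \<le> \<bar>n\<bar>" for n
  proof -
    have "(\<integral>x. fexp n x * (c * fexp k x) \<partial>unit_lborel) = (\<integral>x. c * fexp (n + k) x \<partial>unit_lborel)"
      by (simp add: fexp_add_index mult_ac)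
    also have "\<dots> = c * (\<integral>x. fexp (n + k) x \<partial>unit_lborel)" by (rule integral_mult_right_zero)
    finally show ?thesis using that by (simp add: integral_fexp)
  qed
  then show ?case by blast
next
  case (add f g)
  then obtain M N where M: "M \<le> \<bar>n\<bar> \<Longrightarrow> (\<integral>x. fexp n x * f x \<partial>unit_lborel) = 0"
     and N: "N \<le> \<bar>n\<bar> \<Longrightarrow> (\<integral>x. fexp n x * g x \<partial>unit_lborel) = 0" for n by blast
  have "(\<integral>x. fexp n x * (f x + g x) \<partial>unit_lborel) = (\<integral>x. fexp n x * f x \<partial>unit_lborel) + (\<integral>x. fexp n x * g x \<partial>unit_lborel)" for n
    unfolding distrib_left using add.hyps
    by (intro Bochner_Integration.integral_add trigpoly_integrable[where K=1]) auto
  then show ?case using M N by (intro exI[of _ "max M N"]) auto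
qed

lemma trigpoly_Riemann_Lebesgue:
  "trigpoly f \<Longrightarrow> \<forall>\<epsilon>>0. \<exists>M. \<forall>l. M \<le> \<bar>l\<bar> \<longrightarrow> norm (\<integral>x. exp (\<i> * of_real (l * x)) * f x \<partial>unit_lborel) < \<epsilon>"
proof (induction rule: trigpoly.induct)
  case (monom c k)
  show ?case
  proof (intro allI impI)
    fix \<epsilon> :: real assume \<epsilon>: "0 < \<epsilon>"
    \<comment> \<open>Beyond \<open>M\<close> the frequency is far from the resonance
      \<open>2 pi k\<close>: the integral is at most \<open>2 * norm c\<close> divided by that
      distance. The summand \<open>1\<close> keeps the inequality for the distance strict.\<close>
    define M where "M = 2 * pi * \<bar>of_int k\<bar> + 1 + 2 * (norm c + 1) / \<epsilon>"
    have "norm (\<integral>x. exp (\<i> * of_real (l * x)) * (c * fexp k x) \<partial>unit_lborel) < \<epsilon>" if l: "M \<le> \<bar>l\<bar>" for l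
    proof -
      let ?s = "l - 2 * pi * of_int k"
      have "\<bar>2 * pi * of_int k\<bar> = 2 * pi * \<bar>of_int k\<bar>" by (simp add: abs_mult)
      then have s: "1 + 2 * (norm c + 1) / \<epsilon> \<le> \<bar>?s\<bar>" using l unfolding M_def by linarith
      have pos: "0 \<le> 2 * (norm c + 1) / \<epsilon>" using \<epsilon> by simp
      then have s0: "?s \<noteq> 0" and s1: "2 * (norm c + 1) / \<epsilon> < \<bar>?s\<bar>" using s by linarith+
      have "(\<integral>x. exp (\<i> * of_real (l * x)) * (c * fexp k x) \<partial>unit_lborel) = (\<integral>x. c * exp (\<i> * of_real (?s * x)) \<partial>unit_lborel)"
        by (intro Bochner_Integration.integral_cong refl) (simp add: fexp_def algebra_simps flip: exp_add)
      also have "\<dots> = c * (\<integral>x. exp (\<i> * of_real (?s * x)) \<partial>unit_lborel)" by (rule integral_mult_right_zero)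
      also have "norm \<dots> \<le> norm c * (2 / \<bar>?s\<bar>)"
        unfolding norm_mult by (intro mult_left_mono norm_integral_exp_le s0) auto
      also have "\<dots> < \<epsilon>"
      proof -
        have "2 * (norm c + 1) < \<bar>?s\<bar> * \<epsilon>" using s1 \<epsilon> by (simp add: field_simps)
        then have "norm c * 2 < \<bar>?s\<bar> * \<epsilon>" by (simp add: algebra_simps)
        then show ?thesis using s0 by (simp add: field_simps)
      qed
      finally show ?thesis .
    qed
    then show "\<exists>M. \<forall>l. M \<le> \<bar>l\<bar> \<longrightarrow> norm (\<integral>x. exp (\<i> * of_real (l * x)) * (c * fexp k x) \<partial>unit_lborel) < \<epsilon>" by blast
  qed
next
  case (add f g)
  show ?case
  proof (intro allI impI)
    fix \<epsilon> :: real assume \<epsilon>: "0 < \<epsilon>"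
    let ?I = "\<lambda>l h. \<integral>x. exp (\<i> * of_real (l * x)) * h x \<partial>unit_lborel"
    obtain M where M: "\<And>l. M \<le> \<bar>l\<bar> \<Longrightarrow> norm (?I l f) < \<epsilon> / 2"
      using add.IH(1) half_gt_zero[OF \<epsilon>] by blast
    obtain N where N: "\<And>l. N \<le> \<bar>l\<bar> \<Longrightarrow> norm (?I l g) < \<epsilon> / 2"
      using add.IH(2) half_gt_zero[OF \<epsilon>] by blast
    have "?I l (\<lambda>x. f x + g x) = ?I l f + ?I l g" for l
      unfolding distrib_left using add.hyps
      by (intro Bochner_Integration.integral_add trigpoly_integrable[where K=1]) auto
    moreover have "norm (?I l f + ?I l g) < \<epsilon>" if "max M N \<le> \<bar>l\<bar>" for l
      using M[of l] N[of l] that norm_triangle_ineq[of "?I l f" "?I l g"] by simp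
    ultimately show "\<exists>M. \<forall>l. M \<le> \<bar>l\<bar> \<longrightarrow> norm (?I l (\<lambda>x. f x + g x)) < \<epsilon>"
      by (intro exI[of _ "max M N"]) simp
  qed
qed

text \<open>On the unit circle the coordinates \<open>Re\<close> and \<open>Im\<close> are
  combinations of \<open>fexp 1\<close> and its conjugate \<open>fexp (-1)\<close>, and
  trigonometric polynomials are closed under products.\<close>

lemma real_polynomial_trigpoly:
  fixes P :: "complex \<Rightarrow> real"
  assumes "real_polynomial_function P"
  shows "trigpoly (\<lambda>x. of_real (P (fexp 1 x)))"
  using assms
proof (induction P rule: real_polynomial_function.induct)
  case (linear f)
  interpret bounded_linear f by fact
  have f: "f z = f 1 * Re z + f \<i> * Im z" for z
  proof -
    have "z = Re z *\<^sub>R 1 + Im z *\<^sub>R \<i>" by (simp add: complex_eq_iff)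
    then have "f z = f (Re z *\<^sub>R 1 + Im z *\<^sub>R \<i>)" by simp
    also have "\<dots> = f 1 * Re z + f \<i> * Im z" by (simp add: add scaleR)
    finally show ?thesis .
  qed
  have "cnj (fexp 1 x) = fexp (-1) x" for x by (simp add: fexp_def exp_cnj)
  moreover have "of_real (Re w) = (1/2) * w + (1/2) * cnj w" "of_real (Im w) = (-\<i>/2) * w + (\<i>/2) * cnj w" for w
    by (simp_all add: complex_eq_iff)
  ultimately have cs: "of_real (Re (fexp 1 x)) = (1/2) * fexp 1 x + (1/2) * fexp (-1) x"
    "of_real (Im (fexp 1 x)) = (-\<i>/2) * fexp 1 x + (\<i>/2) * fexp (-1) x" for x
    by metis+
  have "trigpoly (\<lambda>x. of_real (f 1) * ((1/2) * fexp 1 x + (1/2) * fexp (-1) x) + of_real (f \<i>) * ((-\<i>/2) * fexp 1 x + (\<i>/2) * fexp (-1) x))"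
    by (intro trigpoly.add trigpoly_mult trigpoly_const trigpoly.monom)
  then show ?case unfolding cs[symmetric] by (subst f) simp
next
  case (const c)
  show ?case by (rule trigpoly_const)
next
  case (add f g)
  then show ?case by (simp add: trigpoly.add)
next
  case (mult f g)
  then show ?case by (simp add: trigpoly_mult)
qed

text \<open>Because of \<open>\<psi> 0 = \<psi> 1\<close> the function descends to the unit circle,
  where the Stone-Weierstrass theorem supplies a polynomial in the two coordinates.\<close>

lemma trigpoly_uniformly_dense:
  fixes \<psi> :: "real \<Rightarrow> complex"
  assumes \<psi>: "continuous_on {0..1} \<psi>" "\<psi> 0 = \<psi> 1" and "0 < \<epsilon>"
  obtains T where "trigpoly T" "\<And>x. 0 \<le> x \<Longrightarrow> x \<le> 1 \<Longrightarrow> norm (\<psi> x - T x) < \<epsilon>"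
proof -
  define E where "E x = exp (\<i> * of_real (2 * pi * x))" for x :: real
  define \<Psi> where "\<Psi> z = \<psi> (Arg2pi z / (2 * pi))" for z
  let ?S = "sphere (0::complex) 1"
  have E_arg: "E (Arg2pi z / (2 * pi)) = z" and arg: "Arg2pi z / (2 * pi) \<in> {0..1}" if "z \<in> ?S" for z
  proof -
    have "z = of_real (norm z) * exp (\<i> * of_real (Arg2pi z))" by (rule Arg2pi_eq)
    then show "E (Arg2pi z / (2 * pi)) = z" using that by (simp add: E_def)
    show "Arg2pi z / (2 * pi) \<in> {0..1}"
      using Arg2pi_ge_0[of z] Arg2pi_lt_2pi[of z] by (simp add: field_simps)
  qed
  have Psi_E: "\<Psi> (E x) = \<psi> x" if "x \<in> {0..1}" for x
  proof (cases "x = 1")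
    case True
    have "E 1 = 1" by (simp add: E_def mult_ac exp_two_pi_i)
    moreover have "Arg2pi 1 = 0" by (rule Arg2pi_unique[of 1]) auto
    ultimately show ?thesis using True \<psi>(2) by (simp add: \<Psi>_def)
  next
    case False
    have "Arg2pi (E x) = 2 * pi * x"
      using that False by (intro Arg2pi_unique[of 1]) (auto simp: E_def)
    then show ?thesis by (simp add: \<Psi>_def)
  qed
  have E_S: "E x \<in> ?S" for x by (simp add: E_def)
  have cE: "continuous_on A E" for A unfolding E_def by (intro continuous_intros)
  \<comment> \<open>\<open>Arg2pi\<close> jumps at \<open>1\<close>, so continuity is not inherited
    from it. Instead the preimage of a closed set under \<open>\<Psi>\<close> is the image under
    \<open>E\<close> of a compact set.\<close>
  have "continuous_on ?S \<Psi>"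
    unfolding continuous_on_closed_vimage[OF closed_sphere]
  proof (intro allI impI)
    fix B :: "complex set" assume B: "closed B"
    have "\<Psi> -` B \<inter> ?S = E ` ({0..1} \<inter> \<psi> -` B)"
    proof (intro set_eqI iffI)
      fix z assume z: "z \<in> \<Psi> -` B \<inter> ?S"
      then have "Arg2pi z / (2 * pi) \<in> {0..1} \<inter> \<psi> -` B" using arg[of z] by (auto simp: \<Psi>_def)
      then show "z \<in> E ` ({0..1} \<inter> \<psi> -` B)" using E_arg[of z] z by (metis IntD2 image_eqI)
    next
      fix z assume "z \<in> E ` ({0..1} \<inter> \<psi> -` B)"
      then obtain x where "x \<in> {0..1}" "\<psi> x \<in> B" "z = E x" by auto
      then show "z \<in> \<Psi> -` B \<inter> ?S" using Psi_E E_S by auto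
    qed
    moreover have "compact ({0..1} \<inter> \<psi> -` B)"
    proof -
      have "closed (\<psi> -` B \<inter> {0..1})"
        using \<psi>(1) B by (simp add: continuous_on_closed_vimage)
      then show ?thesis by (metis Int_commute Int_lower1 bounded_closed_interval bounded_subset compact_eq_bounded_closed)
    qed
    ultimately show "closed (\<Psi> -` B \<inter> ?S)"
      by (metis cE compact_continuous_image compact_imp_closed)
  qed
  from Stone_Weierstrass_polynomial_function[OF compact_sphere this \<open>0 < \<epsilon>\<close>]
  obtain P where P: "polynomial_function P" "\<And>z. z \<in> ?S \<Longrightarrow> norm (\<Psi> z - P z) < \<epsilon>" by auto
  \<comment> \<open>The exponent of \<open>fexp\<close> carries a minus sign, so \<open>E x\<close>
    is the conjugate of \<open>fexp 1 x\<close>.\<close>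
  let ?P = "\<lambda>z. P (cnj z)"
  have cp: "polynomial_function ?P"
    using polynomial_function_compose[OF polynomial_function_bounded_linear[OF bounded_linear_cnj] P(1)] by (simp add: o_def)
  have "real_polynomial_function (\<lambda>z. Re (?P z))" "real_polynomial_function (\<lambda>z. Im (?P z))"
    using cp bounded_linear_Re bounded_linear_Im unfolding polynomial_function_def by (auto simp: o_def)
  then have "trigpoly (\<lambda>x. of_real (Re (?P (fexp 1 x))) + \<i> * of_real (Im (?P (fexp 1 x))))"
    by (intro trigpoly.add trigpoly_mult trigpoly_const real_polynomial_trigpoly)
  also have "(\<lambda>x. of_real (Re (?P (fexp 1 x))) + \<i> * of_real (Im (?P (fexp 1 x)))) = (\<lambda>x. P (E x))"
    by (auto simp: fun_eq_iff E_def fexp_def exp_cnj mult_ac simp flip: complex_eq)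
  finally have T: "trigpoly (\<lambda>x. P (E x))" .
  show ?thesis
  proof (rule that[OF T])
    fix x :: real assume "0 \<le> x" "x \<le> 1"
    then show "norm (\<psi> x - P (E x)) < \<epsilon>" using P(2)[OF E_S[of x]] Psi_E[of x] by simp
  qed
qed

lemma Lp_le_tendsto_0:
  fixes h :: "nat \<Rightarrow> real \<Rightarrow> complex"
  assumes p: "1 \<le> p" and [measurable]: "\<And>k. h k \<in> borel_measurable borel"
    and w: "integrable unit_lborel w" "\<And>k. AE x in unit_lborel. norm (h k x) powr p \<le> w x"
    and lim: "AE x in unit_lborel. (\<lambda>k. h k x) \<longlonglongrightarrow> 0" and \<epsilon>: "0 < \<epsilon>"
  shows "\<exists>k. Lp_le p \<epsilon> (h k)"
proof -
  have [measurable]: "w \<in> borel_measurable unit_lborel" using w by auto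
  have *: "AE x in unit_lborel. (\<lambda>k. norm (h k x) powr p) \<longlonglongrightarrow> 0"
    using lim
  proof eventually_elim
    case (elim x)
    have "(\<lambda>k. norm (h k x) powr p) \<longlonglongrightarrow> 0 powr p"
      using p by (intro tendsto_powr' tendsto_norm_zero elim tendsto_const) auto
    then show ?case using p by simp
  qed
  have bd: "AE x in unit_lborel. norm (norm (h k x) powr p) \<le> w x" for k using w(2)[of k] by simp
  have "(\<lambda>k. \<integral>x. norm (h k x) powr p \<partial>unit_lborel) \<longlonglongrightarrow> (\<integral>x. 0 \<partial>unit_lborel)"
    by (rule integral_dominated_convergence[OF _ _ w(1) * bd]) auto
  then have "(\<lambda>k. \<integral>x. norm (h k x) powr p \<partial>unit_lborel) \<longlonglongrightarrow> 0" by simp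
  then have "eventually (\<lambda>k. (\<integral>x. norm (h k x) powr p \<partial>unit_lborel) < \<epsilon> powr p) sequentially"
    using \<epsilon> by (intro order_tendstoD) auto
  then obtain k where k: "(\<integral>x. norm (h k x) powr p \<partial>unit_lborel) < \<epsilon> powr p"
    by (auto simp: eventually_sequentially)
  have "integrable unit_lborel (\<lambda>x. norm (h k x) powr p)"
    by (rule Bochner_Integration.integrable_bound[OF w(1)]) (use w(2)[of k] in auto)
  then have "Lp_le p \<epsilon> (h k)"
    using k \<epsilon> by (auto simp: Lp_le_def nn_integral_eq_integral intro!: ennreal_leI)
  then show ?thesis ..
qed

text \<open>Large values are cut off, and the bounded remainder is an almost everywhere limit of
  continuous functions that can be kept bounded and made to vanish at both ends. Dominated
  convergence measures the error of each of the two steps.\<close>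

lemma continuous_dense_Lp:
  assumes p: "1 \<le> p" and g: "Lp_le p C g" and \<epsilon>: "0 < \<epsilon>"
  obtains \<psi> where "continuous_on UNIV \<psi>" "\<psi> 0 = 0" "\<psi> 1 = 0" "Lp_le p \<epsilon> (\<lambda>x. g x - \<psi> x)"
proof -
  have [measurable]: "g \<in> borel_measurable borel" using g by (auto simp: Lp_le_def)
  have "(\<integral>\<^sup>+x. ennreal (norm (g x) powr p) \<partial>unit_lborel) < \<infinity>"
    using g by (auto simp: Lp_le_def less_top intro: le_less_trans)
  then have gi: "integrable unit_lborel (\<lambda>x. norm (g x) powr p)" by (intro integrableI_nonneg) auto
  have "\<exists>k. Lp_le p (\<epsilon> / 2) (\<lambda>x. if norm (g x) \<le> real k then 0 else g x)"
  proof (rule Lp_le_tendsto_0[OF p _ gi])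
    have "(\<lambda>k. if norm (g x) \<le> real k then 0 else g x) \<longlonglongrightarrow> 0" for x
    proof (rule tendsto_eventually)
      obtain m where "norm (g x) \<le> real m" using real_arch_simple by blast
      then show "\<forall>\<^sub>F k in sequentially. (if norm (g x) \<le> real k then 0 else g x) = 0"
        by (auto simp: eventually_sequentially intro!: exI[of _ m])
    qed
    then show "AE x in unit_lborel. (\<lambda>k. if norm (g x) \<le> real k then 0 else g x) \<longlonglongrightarrow> 0" by simp
  qed (use \<epsilon> in auto)
  then obtain K where K: "Lp_le p (\<epsilon> / 2) (\<lambda>x. if norm (g x) \<le> real K then 0 else g x)" by blast
  define g' where "g' x = (if norm (g x) \<le> real K then g x else 0)" for x
  have [measurable]: "g' \<in> borel_measurable borel" unfolding g'_def by measurable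
  have g'K: "norm (g' x) \<le> real K" for x by (simp add: g'_def)
  have "g' \<in> borel_measurable lebesgue" by (rule measurable_completion) simp
  then have "g' measurable_on UNIV" by (simp add: lebesgue_measurable_imp_measurable_on)
  then obtain N \<phi> where N: "negligible N" and \<phi>: "\<And>n. continuous_on UNIV (\<phi> n)"
      "\<And>x. x \<notin> N \<Longrightarrow> (\<lambda>n. \<phi> n x) \<longlonglongrightarrow> g' x"
    unfolding measurable_on_def by auto
  \<comment> \<open>The approximants \<open>\<phi> n\<close> need not be bounded; projecting onto
    the ball containing the values of \<open>g'\<close> gives a uniform bound and preserves the
    limit.\<close>
  let ?c = "closest_point (cball (0::complex) (real K))"
  have cne: "cball (0::complex) (real K) \<noteq> {}" by simp
  have cc: "continuous_on UNIV ?c" by (rule continuous_on_closest_point[OF convex_cball closed_cball cne])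
  have cK: "norm (?c z) \<le> real K" for z
    using closest_point_in_set[OF closed_cball cne, of z] by simp
  \<comment> \<open>A trapezoid that vanishes at \<open>0\<close> and \<open>1\<close> and
    eventually equals \<open>1\<close> at each interior point; it makes the approximants
    periodic.\<close>
  define cut where "cut n x = max 0 (min 1 (min (real n * x) (real n * (1 - x))))" for n x
  define \<psi> where "\<psi> n x = of_real (cut n x) * ?c (\<phi> n x)" for n x
  have cpsi: "continuous_on UNIV (\<psi> n)" for n
    unfolding \<psi>_def cut_def
    by (intro continuous_intros continuous_on_compose2[OF cc \<phi>(1)]) auto
  then have [measurable]: "\<psi> n \<in> borel_measurable borel" for n by (rule borel_measurable_continuous_onI)
  have bpsi: "norm (\<psi> n x) \<le> real K" for n x
  proof -
    have "\<bar>cut n x\<bar> \<le> 1" by (auto simp: cut_def)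
    then show ?thesis unfolding \<psi>_def norm_mult using cK[of "\<phi> n x"] mult_mono[of "\<bar>cut n x\<bar>" 1 "norm (?c (\<phi> n x))" "real K"] by simp
  qed
  have "AE x in lborel. x \<notin> N"
    using N by (metis AE_completion_iff AE_not_in negligible_iff_null_sets)
  then have lim: "AE x in unit_lborel. (\<lambda>n. g' x - \<psi> n x) \<longlonglongrightarrow> 0"
    unfolding AE_unit_lborel
  proof eventually_elim
    case (elim x)
    show ?case
    proof
      assume x: "x \<in> {0<..<1}"
      have "(\<lambda>n. ?c (\<phi> n x)) \<longlonglongrightarrow> ?c (g' x)"
        using cc \<phi>(2)[OF elim] by (auto simp: continuous_on_eq_continuous_at intro: isCont_tendsto_compose)
      moreover have "?c (g' x) = g' x" using g'K by (intro closest_point_self) simp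
      moreover have "(\<lambda>n. of_real (cut n x) :: complex) \<longlonglongrightarrow> 1"
      proof (rule tendsto_eventually)
        obtain m where m: "1 / min x (1 - x) \<le> real m" using real_arch_simple by blast
        have "cut n x = 1" if "m \<le> n" for n
        proof -
          have "1 / min x (1 - x) \<le> real n" using m that by linarith
          then have "1 \<le> real n * min x (1 - x)" using x by (simp add: divide_le_eq min_def split: if_splits)
          then have "1 \<le> real n * x" "1 \<le> real n * (1 - x)"
            using mult_left_mono[of "min x (1 - x)" x "real n"] mult_left_mono[of "min x (1 - x)" "1 - x" "real n"] by linarith+
          then show ?thesis by (simp add: cut_def)
        qed
        then show "\<forall>\<^sub>F n in sequentially. of_real (cut n x) = (1::complex)"
          by (auto simp: eventually_sequentially)
      qed
      ultimately have "(\<lambda>n. \<psi> n x) \<longlonglongrightarrow> 1 * g' x" unfolding \<psi>_def by (intro tendsto_mult) auto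
      then show "(\<lambda>n. g' x - \<psi> n x) \<longlonglongrightarrow> 0" using tendsto_diff[OF tendsto_const[of "g' x"]] by fastforce
    qed
  qed
  have "\<exists>n. Lp_le p (\<epsilon> / 2) (\<lambda>x. g' x - \<psi> n x)"
  proof (rule Lp_le_tendsto_0[OF p _ _ _ lim])
    show "integrable unit_lborel (\<lambda>x. (2 * real K) powr p)" by simp
    fix n
    have "norm (g' x - \<psi> n x) powr p \<le> (2 * real K) powr p" for x
      using p g'K[of x] bpsi[of n x] norm_triangle_ineq4[of "g' x" "\<psi> n x"] by (intro powr_mono2) auto
    then show "AE x in unit_lborel. norm (g' x - \<psi> n x) powr p \<le> (2 * real K) powr p" by simp
  qed (use \<epsilon> in auto)
  then obtain n where n: "Lp_le p (\<epsilon> / 2) (\<lambda>x. g' x - \<psi> n x)" by blast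
  have "(\<lambda>x. (if norm (g x) \<le> real K then 0 else g x) + (g' x - \<psi> n x)) = (\<lambda>x. g x - \<psi> n x)"
    by (auto simp: g'_def)
  then have "Lp_le p \<epsilon> (\<lambda>x. g x - \<psi> n x)" using Lp_le_add[OF p K n] by simp
  then show ?thesis by (intro that[OF cpsi]) (auto simp: \<psi>_def cut_def)
qed

lemma trigpoly_dense_Lp:
  assumes p: "1 \<le> p" and g: "Lp_le p C g" and \<epsilon>: "0 < \<epsilon>"
  obtains T where "trigpoly T" "Lp_le p \<epsilon> (\<lambda>x. g x - T x)"
proof -
  obtain \<psi> where \<psi>: "continuous_on UNIV \<psi>" "\<psi> 0 = 0" "\<psi> 1 = 0" "Lp_le p (\<epsilon> / 2) (\<lambda>x. g x - \<psi> x)"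
    using continuous_dense_Lp[OF p g, of "\<epsilon> / 2"] \<epsilon> by auto
  obtain T where T: "trigpoly T" "\<And>x. 0 \<le> x \<Longrightarrow> x \<le> 1 \<Longrightarrow> norm (\<psi> x - T x) < \<epsilon> / 2"
  proof (rule trigpoly_uniformly_dense)
    show "continuous_on {0..1} \<psi>" by (rule continuous_on_subset[OF \<psi>(1)]) simp
    show "\<psi> 0 = \<psi> 1" "0 < \<epsilon> / 2" using \<psi> \<epsilon> by auto
  qed blast
  note [measurable] = trigpoly_measurable[OF T(1)] borel_measurable_continuous_onI[OF \<psi>(1)]
  have "Lp_le p (\<epsilon> / 2) (\<lambda>x. \<psi> x - T x)"
    using \<epsilon> T(2) by (intro Lp_le_bounded[OF p]) (auto intro: less_imp_le)
  from Lp_le_add[OF p \<psi>(4) this] that[OF T(1)] show ?thesis by simp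
qed

text \<open>Real frequencies are allowed, since the spectral parameter tends to infinity through
  arbitrary values. For a trigonometric polynomial close to \<open>g\<close> in L_1 the claim is
  explicit.\<close>

lemma Riemann_Lebesgue:
  assumes g: "integrable unit_lborel g" and [measurable]: "g \<in> borel_measurable borel" and \<epsilon>: "0 < \<epsilon>"
  obtains M where "\<And>l. M \<le> \<bar>l\<bar> \<Longrightarrow> norm (\<integral>x. exp (\<i> * of_real (l * x)) * g x \<partial>unit_lborel) < \<epsilon>"
proof -
  have "(\<integral>x. norm (g x) \<partial>unit_lborel) \<ge> 0" by simp
  then have "Lp_le 1 (1 + (\<integral>x. norm (g x) \<partial>unit_lborel)) g" using g by (subst Lp_le_1_iff) (auto intro: add_pos_nonneg)
  then obtain T where T: "trigpoly T" and "Lp_le 1 (\<epsilon> / 2) (\<lambda>x. g x - T x)"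
    using trigpoly_dense_Lp[of 1 _ g "\<epsilon> / 2"] \<epsilon> by auto
  from Lp_le_L1[OF order_refl this(2)]
  have d: "integrable unit_lborel (\<lambda>x. g x - T x)" "(\<integral>x. norm (g x - T x) \<partial>unit_lborel) \<le> \<epsilon> / 2" .
  obtain M where M: "\<And>l. M \<le> \<bar>l\<bar> \<Longrightarrow> norm (\<integral>x. exp (\<i> * of_real (l * x)) * T x \<partial>unit_lborel) < \<epsilon> / 2"
    using trigpoly_Riemann_Lebesgue[OF T] half_gt_zero[OF \<epsilon>] by blast
  have "norm (\<integral>x. exp (\<i> * of_real (l * x)) * g x \<partial>unit_lborel) < \<epsilon>" if "M \<le> \<bar>l\<bar>" for l
  proof -
    let ?e = "\<lambda>x. exp (\<i> * of_real (l * x))"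
    have i1: "integrable unit_lborel (\<lambda>x. ?e x * (g x - T x))"
      by (rule Bochner_Integration.integrable_bound[OF d(1)]) (use trigpoly_measurable[OF T] in \<open>auto simp: norm_mult\<close>)
    have i2: "integrable unit_lborel (\<lambda>x. ?e x * T x)"
      by (rule trigpoly_integrable[OF T, where K=1]) auto
    have "(\<integral>x. ?e x * g x \<partial>unit_lborel) = (\<integral>x. ?e x * (g x - T x) + ?e x * T x \<partial>unit_lborel)"
      by (simp add: algebra_simps)
    also have "\<dots> = (\<integral>x. ?e x * (g x - T x) \<partial>unit_lborel) + (\<integral>x. ?e x * T x \<partial>unit_lborel)"
      by (rule Bochner_Integration.integral_add[OF i1 i2])
    finally have eq: "(\<integral>x. ?e x * g x \<partial>unit_lborel) = \<dots>" .
    have "norm (\<integral>x. ?e x * (g x - T x) \<partial>unit_lborel) \<le> (\<integral>x. norm (?e x * (g x - T x)) \<partial>unit_lborel)"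
      by (rule integral_norm_bound)
    also have "\<dots> \<le> \<epsilon> / 2" using d(2) by (simp add: norm_mult)
    finally show ?thesis unfolding eq using M[OF that] norm_triangle_ineq
      by (smt (verit) field_sum_of_halves)
  qed
  then show ?thesis by (rule that)
qed

section \<open>The algebra of Fourier coefficients\<close>

definition Lp_coeffs :: "real \<Rightarrow> real \<Rightarrow> (int \<Rightarrow> complex) \<Rightarrow> bool" where
  "Lp_coeffs p C a \<longleftrightarrow> (\<exists>g. Lp_le p C g \<and> (\<forall>n. a n = (\<integral>x. fexp n x * g x \<partial>unit_lborel)))"

lemma integrable_fexp_mult:
  assumes "1 \<le> p" "Lp_le p C g"
  shows "integrable unit_lborel (\<lambda>x. fexp n x * g x)"
proof (rule Bochner_Integration.integrable_bound)
  show "integrable unit_lborel (\<lambda>x. norm (g x))" using Lp_le_L1[OF assms] by simp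
qed (use Lp_le_measurable[OF assms(2)] in \<open>auto simp: norm_mult\<close>)

lemma Lp_coeffs_mono: "Lp_coeffs p C a \<Longrightarrow> 1 \<le> p \<Longrightarrow> C \<le> D \<Longrightarrow> Lp_coeffs p D a"
  unfolding Lp_coeffs_def using Lp_le_mono by blast

lemma Lp_coeffs_add:
  assumes p: "1 \<le> p" and "Lp_coeffs p C a" "Lp_coeffs p D b"
  shows "Lp_coeffs p (C + D) (\<lambda>n. a n + b n)"
proof -
  obtain f g where f: "Lp_le p C f" "\<And>n. a n = (\<integral>x. fexp n x * f x \<partial>unit_lborel)"
    and g: "Lp_le p D g" "\<And>n. b n = (\<integral>x. fexp n x * g x \<partial>unit_lborel)"
    using assms unfolding Lp_coeffs_def by auto
  have "a n + b n = (\<integral>x. fexp n x * (f x + g x) \<partial>unit_lborel)" for n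
    unfolding f(2) g(2) distrib_left using integrable_fexp_mult[OF p f(1)] integrable_fexp_mult[OF p g(1)]
    by (intro Bochner_Integration.integral_add[symmetric])
  with Lp_le_add[OF p f(1) g(1)] show ?thesis unfolding Lp_coeffs_def by auto
qed

lemma Lp_coeffs_cmult:
  assumes p: "1 \<le> p" and "Lp_coeffs p C a" "norm s \<le> K" "0 < K"
  shows "Lp_coeffs p (K * C) (\<lambda>n. s * a n)"
proof -
  obtain f where f: "Lp_le p C f" "\<And>n. a n = (\<integral>x. fexp n x * f x \<partial>unit_lborel)"
    using assms unfolding Lp_coeffs_def by auto
  have "Lp_le p (K * C) (\<lambda>x. s * f x)"
    by (rule Lp_le_mult_bounded[OF p f(1) assms(4) order_refl]) (use assms in auto)
  moreover have "s * a n = (\<integral>x. fexp n x * (s * f x) \<partial>unit_lborel)" for n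
    unfolding f(2) by (subst integral_mult_right_zero[symmetric]) (simp add: mult_ac)
  ultimately show ?thesis unfolding Lp_coeffs_def by blast
qed

lemma Lp_coeffs_mult:
  assumes p: "1 \<le> p" and "Lp_coeffs p C a" "Lp_coeffs p D b"
  shows "Lp_coeffs p (C * D) (\<lambda>n. a n * b n)"
proof -
  obtain f g where f: "Lp_le p C f" "\<And>n. a n = (\<integral>x. fexp n x * f x \<partial>unit_lborel)"
    and g: "Lp_le p D g" "\<And>n. b n = (\<integral>x. fexp n x * g x \<partial>unit_lborel)"
    using assms unfolding Lp_coeffs_def by auto
  from circle_convolution[OF p f(1) g(1)] show ?thesis
    unfolding Lp_coeffs_def f(2) g(2) by metis
qed

lemma Lp_coeffs_bound:
  assumes p: "1 \<le> p" and "Lp_coeffs p C a"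
  shows "norm (a n) \<le> C"
proof -
  obtain f where f: "Lp_le p C f" "\<And>n. a n = (\<integral>x. fexp n x * f x \<partial>unit_lborel)"
    using assms unfolding Lp_coeffs_def by auto
  have "norm (a n) \<le> (\<integral>x. norm (fexp n x * f x) \<partial>unit_lborel)"
    unfolding f(2) by (rule integral_norm_bound)
  then show ?thesis using Lp_le_L1(2)[OF p f(1)] by (simp add: norm_mult)
qed

lemma Lp_coeffs_zero: "1 \<le> p \<Longrightarrow> 0 < C \<Longrightarrow> Lp_coeffs p C (\<lambda>n. 0)"
  unfolding Lp_coeffs_def by (intro exI[of _ "\<lambda>x. 0"]) (auto intro: Lp_le_bounded)

lemma Lp_coeffs_suminf:
  fixes a :: "nat \<Rightarrow> int \<Rightarrow> complex"
  assumes p: "1 \<le> p" and a: "\<And>k. Lp_coeffs p (C k) (a k)" and C: "summable C"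
  shows "\<exists>b. Lp_coeffs p (suminf C) b \<and> (\<forall>n. (\<lambda>k. a k n) sums b n)"
proof -
  obtain g where g: "\<And>k. Lp_le p (C k) (g k)" "\<And>k n. a k n = (\<integral>x. fexp n x * g k x \<partial>unit_lborel)"
    using a unfolding Lp_coeffs_def by metis
  show ?thesis
  proof (rule Lp_le_suminf[OF p g(1) C])
    fix G
    assume G: "Lp_le p (suminf C) G" and sums: "\<And>\<phi> K. \<phi> \<in> borel_measurable borel \<Longrightarrow> (\<And>x. norm (\<phi> x) \<le> K) \<Longrightarrow>
       (\<lambda>k. \<integral>x. \<phi> x * g k x \<partial>unit_lborel) sums (\<integral>x. \<phi> x * G x \<partial>unit_lborel)"
    have "(\<lambda>k. a k n) sums (\<integral>x. fexp n x * G x \<partial>unit_lborel)" for n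
      unfolding g(2) by (rule sums[where K=1]) auto
    then show ?thesis using G unfolding Lp_coeffs_def
      by (intro exI[of _ "\<lambda>n. \<integral>x. fexp n x * G x \<partial>unit_lborel"]) blast
  qed
qed

text \<open>Smallness in norm is bought by removing a trigonometric polynomial close to the
  representing function, which affects finitely many coefficients.\<close>

lemma Lp_coeffs_truncate:
  assumes p: "1 \<le> p" and "Lp_coeffs p C a" and "0 < \<epsilon>"
  shows "\<exists>b M. Lp_coeffs p \<epsilon> b \<and> (\<forall>n. M \<le> \<bar>n\<bar> \<longrightarrow> b n = a n)"
proof -
  obtain f where f: "Lp_le p C f" "\<And>n. a n = (\<integral>x. fexp n x * f x \<partial>unit_lborel)"
    using assms unfolding Lp_coeffs_def by auto
  obtain T where T: "trigpoly T" "Lp_le p \<epsilon> (\<lambda>x. f x - T x)"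
    using trigpoly_dense_Lp[OF p f(1) \<open>0 < \<epsilon>\<close>] by blast
  obtain M where M: "\<And>n. M \<le> \<bar>n\<bar> \<Longrightarrow> (\<integral>x. fexp n x * T x \<partial>unit_lborel) = 0"
    using trigpoly_coeff[OF T(1)] by blast
  let ?b = "\<lambda>n. \<integral>x. fexp n x * (f x - T x) \<partial>unit_lborel"
  have "Lp_coeffs p \<epsilon> ?b" unfolding Lp_coeffs_def using T(2) by blast
  moreover have "?b n = a n" if "M \<le> \<bar>n\<bar>" for n
  proof -
    have "?b n = a n - (\<integral>x. fexp n x * T x \<partial>unit_lborel)"
      unfolding f(2) right_diff_distrib
      by (intro Bochner_Integration.integral_diff integrable_fexp_mult[OF p f(1)] trigpoly_integrable[OF T(1), where K=1]) auto
    then show ?thesis using M[OF that] by simp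
  qed
  ultimately show ?thesis by blast
qed

text \<open>The counterpart of truncation: a finitely supported correction belongs to a
  trigonometric polynomial, so disagreement at finitely many indices is harmless.\<close>

lemma Lp_coeffs_finite:
  assumes p: "1 \<le> p" and fin: "finite {n. a n \<noteq> 0}"
  shows "\<exists>C. Lp_coeffs p C a"
proof -
  let ?S = "{n. a n \<noteq> 0}"
  let ?g = "\<lambda>x. \<Sum>k\<in>?S. a k * fexp (- k) x"
  have [measurable]: "?g \<in> borel_measurable borel" by measurable
  have "norm (?g x) \<le> 1 + (\<Sum>k\<in>?S. norm (a k))" for x
    using norm_sum[of "\<lambda>k. a k * fexp (- k) x" ?S] by (simp add: norm_mult)
  then have g: "Lp_le p (1 + (\<Sum>k\<in>?S. norm (a k))) ?g"
    by (intro Lp_le_bounded[OF p] add_pos_nonneg sum_nonneg) auto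
  have "a n = (\<integral>x. fexp n x * ?g x \<partial>unit_lborel)" for n
  proof -
    have i: "integrable unit_lborel (\<lambda>x. fexp n x * (a k * fexp (- k) x))" for k
      by (rule trigpoly_integrable[OF trigpoly.monom, where K=1]) auto
    have "(\<integral>x. fexp n x * ?g x \<partial>unit_lborel) = (\<integral>x. (\<Sum>k\<in>?S. fexp n x * (a k * fexp (- k) x)) \<partial>unit_lborel)"
      by (simp add: sum_distrib_left)
    also have "\<dots> = (\<Sum>k\<in>?S. \<integral>x. fexp n x * (a k * fexp (- k) x) \<partial>unit_lborel)"
      by (intro Bochner_Integration.integral_sum i)
    also have "\<dots> = (\<Sum>k\<in>?S. if k = n then a k else 0)"
    proof (rule sum.cong[OF refl])
      fix k
      have "(\<integral>x. fexp n x * (a k * fexp (- k) x) \<partial>unit_lborel) = (\<integral>x. a k * fexp (n + (- k)) x \<partial>unit_lborel)"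
        unfolding fexp_add_index by (simp add: mult_ac)
      also have "\<dots> = a k * (\<integral>x. fexp (n + (- k)) x \<partial>unit_lborel)" by (rule integral_mult_right_zero)
      finally show "(\<integral>x. fexp n x * (a k * fexp (- k) x) \<partial>unit_lborel) = (if k = n then a k else 0)"
        by (auto simp: integral_fexp)
    qed
    also have "\<dots> = a n" using fin by (simp add: sum.delta)
    finally show ?thesis ..
  qed
  then show ?thesis using g unfolding Lp_coeffs_def by blast
qed

text \<open>The exponent starts at one because the algebra has no unit: by Riemann-Lebesgue the
  constant sequence \<open>1\<close> does not belong to it.\<close>

lemma Lp_coeffs_power:
  assumes p: "1 \<le> p" and "Lp_coeffs p r v"
  shows "Lp_coeffs p (r ^ Suc j) (\<lambda>n. v n ^ Suc j)"
proof (induction j)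
  case (Suc j)
  from Lp_coeffs_mult[OF p assms(2) Suc] show ?case by simp
qed (use assms in simp)

lemma Lp_coeffs_power_diff:
  assumes p: "1 \<le> p" and v: "Lp_coeffs p r v" and w: "Lp_coeffs p r w" and d: "Lp_coeffs p \<delta> (\<lambda>n. v n - w n)"
  shows "Lp_coeffs p (real (Suc j) * r ^ j * \<delta>) (\<lambda>n. v n ^ Suc j - w n ^ Suc j)"
proof (induction j)
  case 0
  then show ?case using d by simp
next
  case (Suc j)
  have "Lp_coeffs p (r * (real (Suc j) * r ^ j * \<delta>) + \<delta> * r ^ Suc j)
     (\<lambda>n. v n * (v n ^ Suc j - w n ^ Suc j) + (v n - w n) * w n ^ Suc j)"
    by (intro Lp_coeffs_add Lp_coeffs_mult Lp_coeffs_power p Suc v w d)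
  then show ?case by (simp add: algebra_simps)
qed

text \<open>The scalar counterpart of \<open>Lp_coeffs_power_diff\<close>, for comparing iterates
  with \<open>c n\<close> at a single index before \<open>c\<close> is known to lie in the
  algebra.\<close>

lemma norm_power_diff_le:
  fixes v w :: complex
  assumes "norm v \<le> r" "norm w \<le> r"
  shows "norm (v ^ Suc j - w ^ Suc j) \<le> real (Suc j) * r ^ j * norm (v - w)"
proof (induction j)
  case (Suc j)
  have r: "0 \<le> r" using assms(1) norm_ge_zero order_trans by blast
  have "v ^ Suc (Suc j) - w ^ Suc (Suc j) = v * (v ^ Suc j - w ^ Suc j) + (v - w) * w ^ Suc j"
    by (simp add: algebra_simps)
  also have "norm \<dots> \<le> norm v * norm (v ^ Suc j - w ^ Suc j) + norm (v - w) * norm w ^ Suc j"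
    by (metis norm_mult norm_power norm_triangle_ineq)
  also have "\<dots> \<le> r * (real (Suc j) * r ^ j * norm (v - w)) + norm (v - w) * r ^ Suc j"
    using assms r Suc by (intro add_mono mult_mono power_mono) auto
  also have "\<dots> = real (Suc (Suc j)) * r ^ Suc j * norm (v - w)" by (simp add: algebra_simps)
  finally show ?case .
qed simp

text \<open>The equation is rewritten as the fixed point equation \<open>c n = c n - sin (c n) - \<Sum>j. a j n * c n ^ j\<close>.
  After the coefficients \<open>a j\<close> have been replaced by sequences which agree with them for large
  \<open>n\<close> and which have small norms, it can be solved by iteration in the convolution algebra.\<close>

lemma Lp_coeffs_implicit:
  fixes c :: "int \<Rightarrow> complex"
  assumes p: "1 \<le> p" and h: "Lp_le p H h"
    and eq: "\<And>n. sin (c n) + (\<integral>t. fexp n t * (h t * exp (\<i> * c n * of_real (1 - 2 * t))) \<partial>unit_lborel) = 0"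
    and small: "\<And>r. 0 < r \<Longrightarrow> finite {n. r < norm (c n)}"
  shows "\<exists>C. Lp_coeffs p C c"
proof -
  note [measurable] = Lp_le_measurable[OF h]
  have H: "0 < H" using h by (rule Lp_le_pos)
  \<comment> \<open>The coefficient of \<open>w ^ j\<close> in the expansion of
    \<open>h t * exp (\<i> * w * of_real (1 - 2 * t))\<close>. As \<open>1 - 2 * t\<close> has
    modulus at most one, its norm is at most \<open>H / fact j\<close>.\<close>
  define hj where "hj j t = (\<i> * of_real (1 - 2 * t)) ^ j / fact j * h t" for j t
  define a where "a j n = (\<integral>t. fexp n t * hj j t \<partial>unit_lborel)" for j n
  have hj: "Lp_le p (H / fact j) (hj j)" for j
    unfolding hj_def
  proof (rule Lp_le_mult_bounded[OF p h, of "1 / fact j"])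
    fix t :: real assume "0 < t" "t < 1"
    then have "\<bar>1 - 2 * t\<bar> ^ j \<le> 1" by (intro power_le_one) auto
    moreover have "norm ((\<i> * of_real (1 - 2 * t)) ^ j / fact j) = \<bar>1 - 2 * t\<bar> ^ j / fact j"
      by (simp add: norm_divide norm_power norm_mult flip: of_real_diff of_real_mult del: of_real_power)
    ultimately show "norm ((\<i> * of_real (1 - 2 * t)) ^ j / fact j) \<le> 1 / fact j"
      by (simp add: divide_right_mono)
  qed (auto simp: mult.commute)
  have aj: "Lp_coeffs p (H / fact j) (a j)" for j
    unfolding Lp_coeffs_def a_def using hj by blast
  have a_sums: "(\<lambda>j. a j n * w ^ j) sums (\<integral>t. fexp n t * (h t * exp (\<i> * w * of_real (1 - 2 * t))) \<partial>unit_lborel)" for n w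
  proof -
    let ?f = "\<lambda>j t. fexp n t * hj j t * w ^ j"
    have fi: "integrable unit_lborel (?f j)" for j
      using integrable_fexp_mult[OF p hj] by (intro integrable_mult_left)
    have pt: "?f j t = fexp n t * h t * ((\<i> * w * of_real (1 - 2 * t)) ^ j /\<^sub>R fact j)" for j t
    proof -
      define X :: complex where "X = of_real (1 - 2 * t)"
      show ?thesis unfolding hj_def X_def[symmetric]
        by (simp add: fun_eq_iff scaleR_conv_of_real power_mult_distrib field_simps)
    qed
    have "(\<lambda>j. \<integral>t. ?f j t \<partial>unit_lborel) sums (\<integral>t. (\<Sum>j. ?f j t) \<partial>unit_lborel)"
    proof (rule sums_integral[OF fi])
      have "summable (\<lambda>j. norm (?f j t))" for t
        unfolding pt norm_mult[of "fexp n t * h t"] by (intro summable_mult summable_norm_exp)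
      then show "AE t in unit_lborel. summable (\<lambda>j. norm (?f j t))" by simp
      show "summable (\<lambda>j. \<integral>t. norm (?f j t) \<partial>unit_lborel)"
      proof (rule summable_comparison_test'[OF summable_mult[OF summable_exp[of "norm w"], of H]])
        fix j
        have "(\<integral>t. norm (?f j t) \<partial>unit_lborel) = (\<integral>t. norm (hj j t) \<partial>unit_lborel) * norm w ^ j"
          by (simp add: norm_mult norm_power)
        also have "\<dots> \<le> H / fact j * norm w ^ j"
          using Lp_le_L1(2)[OF p hj] by (intro mult_right_mono) auto
        finally show "norm (\<integral>t. norm (?f j t) \<partial>unit_lborel) \<le> H * (inverse (fact j) * norm w ^ j)"
          by (simp add: field_simps)
      qed
    qed
    also have "(\<lambda>j. \<integral>t. ?f j t \<partial>unit_lborel) = (\<lambda>j. a j n * w ^ j)"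
      by (simp add: a_def)
    also have "(\<lambda>t. \<Sum>j. ?f j t) = (\<lambda>t. fexp n t * (h t * exp (\<i> * w * of_real (1 - 2 * t))))"
    proof
      fix t
      have "(\<lambda>j. ?f j t) sums (fexp n t * h t * exp (\<i> * w * of_real (1 - 2 * t)))"
        unfolding pt by (intro sums_mult exp_converges)
      then show "(\<Sum>j. ?f j t) = fexp n t * (h t * exp (\<i> * w * of_real (1 - 2 * t)))"
        by (simp add: sums_iff mult.assoc)
    qed
    finally show ?thesis .
  qed
  \<comment> \<open>The iteration stays in the ball of radius \<open>r\<close>. The choice
    \<open>\<kappa> = r / 4\<close> makes the bound \<open>r * (1 - 1 / 2 ^ Suc m)\<close> for the
    iterates reproduce itself when an increment of size \<open>\<kappa> / 2 ^ m\<close> is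
    added.\<close>
  define r \<kappa> :: real where "r = 1 / 16" and "\<kappa> = 1 / 64"
  \<comment> \<open>Since the factorial outgrows \<open>4 ^ j\<close>, truncation happens for
    finitely many \<open>j\<close> only. Recording \<open>M = 0\<close> in the other cases is what
    yields one threshold \<open>M'\<close> for all \<open>j\<close>.\<close>
  have "\<exists>b M. Lp_coeffs p (\<kappa> / 4 ^ j) b \<and> (\<forall>n. M \<le> \<bar>n\<bar> \<longrightarrow> b n = - a j n) \<and> (H / fact j \<le> \<kappa> / 4 ^ j \<longrightarrow> M = 0)" for j
  proof -
    have ma: "Lp_coeffs p (H / fact j) (\<lambda>n. - a j n)"
      using Lp_coeffs_cmult[OF p aj, of "-1" 1 j] by simp
    show ?thesis
    proof (cases "H / fact j \<le> \<kappa> / 4 ^ j")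
      case True
      then show ?thesis using Lp_coeffs_mono[OF ma p] by blast
    next
      case False
      then show ?thesis using Lp_coeffs_truncate[OF p ma, of "\<kappa> / 4 ^ j"] by (auto simp: \<kappa>_def)
    qed
  qed
  then obtain b M where b: "\<And>j. Lp_coeffs p (\<kappa> / 4 ^ j) (b j)" "\<And>j n. M j \<le> \<bar>n\<bar> \<Longrightarrow> b j n = - a j n"
    and M: "\<And>j. H / fact j \<le> \<kappa> / 4 ^ j \<Longrightarrow> M j = 0" by metis
  obtain M' where M': "\<And>j. M j \<le> M'"
  proof -
    have "(\<lambda>j. H * (inverse (fact j) * 4 ^ j)) \<longlonglongrightarrow> H * (0::real)"
      by (intro tendsto_mult tendsto_const summable_LIMSEQ_zero summable_exp)
    then have "eventually (\<lambda>j. H * (inverse (fact j) * 4 ^ j) < \<kappa>) sequentially"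
      by (intro order_tendstoD) (auto simp: \<kappa>_def)
    then obtain J where J: "\<And>j. J \<le> j \<Longrightarrow> H * (inverse (fact j) * 4 ^ j) < \<kappa>"
      by (auto simp: eventually_sequentially)
    have "M j = 0" if "J \<le> j" for j
      using J[OF that] by (intro M) (simp add: field_simps)
    then have "M j \<le> Max (insert 0 (M ` {..<J}))" for j
      by (cases "j < J") (auto intro!: Max_ge)
    then show ?thesis by (rule that)
  qed
  \<comment> \<open>The Taylor coefficients of \<open>w - sin w\<close>, which start in degree
    three. Together with \<open>b j n\<close> they are the coefficients of the map to be
    iterated.\<close>
  define s :: "nat \<Rightarrow> real" where "s j = (if j = 1 then 1 else 0) - sin_coeff j" for j
  define e where "e j n = of_real (s j) + b j n" for j n
  have s_small: "s j = 0" if "j < 3" for j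
  proof -
    from that have "j = 0 \<or> j = 1 \<or> j = 2" by linarith
    then show ?thesis by (auto simp: s_def sin_coeff_def)
  qed
  have s_le: "\<bar>s j\<bar> \<le> 1 / fact j" for j
  proof (cases "j < 3")
    case False
    then have "s j = - sin_coeff j" by (simp add: s_def)
    then show ?thesis by (auto simp: sin_coeff_def abs_mult power_abs)
  qed (simp add: s_small)
  \<comment> \<open>The Lipschitz constant of a single Taylor term on the ball. Of the two factors
    in \<open>r ^ j = (1 / 4) ^ j * (1 / 4) ^ j\<close>, one provides the decay and the other is at
    most \<open>1 / 16\<close>, because nonzero terms have \<open>j \<ge> 2\<close>.\<close>
  have s_bound: "\<bar>s (Suc j)\<bar> * (real (Suc j) * r ^ j) \<le> 1 / 8 / 4 ^ Suc j" for j
  proof (cases "j < 2")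
    case True then show ?thesis by (simp add: s_small)
  next
    case False
    then obtain i where j: "j = Suc (Suc i)" by (metis add_2_eq_Suc le_iff_add not_le)
    have "\<bar>s (Suc j)\<bar> * (real (Suc j) * r ^ j) \<le> 1 / fact (Suc j) * (real (Suc j) * r ^ j)"
      by (intro mult_right_mono s_le) (auto simp: r_def)
    also have "\<dots> = r ^ j / fact j" by (simp del: of_nat_Suc)
    also have "\<dots> \<le> r ^ j / 2"
      using fact_mono[of 2 j, where 'a=real] False by (intro divide_left_mono) (auto simp: r_def numeral_2_eq_2)
    also have "\<dots> = (1/4) ^ j * (1 / 4) ^ j / 2"
      by (simp add: r_def flip: power_mult_distrib)
    also have "\<dots> \<le> (1/16) * (1 / 4) ^ j / 2"
      unfolding j by (intro divide_right_mono mult_right_mono) (auto simp: power_le_one)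
    also have "\<dots> = 1 / 8 / 4 ^ Suc j" by (simp add: power_divide)
    finally show ?thesis .
  qed
  have jr: "real (Suc j) * r ^ j \<le> 1" for j
  proof -
    have "real (Suc j) \<le> 16 ^ j"
    proof (induction j)
      case (Suc j)
      have "real (Suc (Suc j)) \<le> 16 * real (Suc j)" by simp
      also have "\<dots> \<le> 16 * 16 ^ j" using Suc by (intro mult_left_mono) auto
      finally show ?case by simp
    qed simp
    then show ?thesis by (simp add: r_def power_divide)
  qed
  have r0: "0 < r" by (simp add: r_def)
  have b_bound: "norm (b j n) \<le> \<kappa> / 4 ^ j" for j n by (rule Lp_coeffs_bound[OF p b(1)])
  have e_sum: "summable (\<lambda>j. norm (e j n * v ^ j))" if v: "norm v \<le> r" for n v
  proof (rule summable_comparison_test'[of "\<lambda>j. 2 * (1 / 16) ^ j" 0])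
    fix j
    have "\<kappa> / 4 ^ j \<le> \<kappa> / 1" by (intro divide_left_mono) (auto simp: \<kappa>_def)
    then have "norm (b j n) \<le> 1" using b_bound[of j n] unfolding \<kappa>_def by linarith
    moreover have "1 / fact j \<le> (1::real)" by simp
    then have "\<bar>s j\<bar> \<le> 1" using s_le[of j] by linarith
    ultimately have "norm (e j n) \<le> 2" unfolding e_def by (intro norm_triangle_le) auto
    moreover have "norm v ^ j \<le> (1 / 16) ^ j" using v by (intro power_mono) (auto simp: r_def)
    ultimately show "norm (norm (e j n * v ^ j)) \<le> 2 * (1 / 16) ^ j"
      by (auto simp: norm_mult norm_power intro!: mult_mono)
  qed (intro summable_mult summable_geometric, simp)
  define T where "T v n = (\<Sum>j. e j n * v n ^ j)" for v :: "int \<Rightarrow> complex" and n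
  \<comment> \<open>A bound for the Lipschitz constant of the term of degree \<open>j\<close>:
    \<open>s j\<close> contributes the factor \<open>1 / 8\<close> and \<open>b j\<close> at most
    \<open>1 / 4\<close>. The geometric series sums to the contraction factor
    \<open>1 / 2\<close>.\<close>
  define D :: "nat \<Rightarrow> real" where "D j = 3 / 8 * (1 / 4) ^ j" for j
  have D_sums: "D sums (1 / 2)"
    unfolding D_def using sums_mult[OF geometric_sums[of "1/4::real"], of "3/8"] by simp
  have T_contraction: "Lp_coeffs p (\<delta> / 2) (\<lambda>n. T v n - T w n)"
    if v: "Lp_coeffs p r v" and w: "Lp_coeffs p r w" and d: "Lp_coeffs p \<delta> (\<lambda>n. v n - w n)" and \<delta>: "0 < \<delta>" for v w \<delta>
  proof -
    have terms: "Lp_coeffs p (D j * \<delta>) (\<lambda>n. e j n * v n ^ j - e j n * w n ^ j)" for j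
    proof (cases j)
      case 0
      then show ?thesis using \<delta> by (auto simp: D_def intro!: Lp_coeffs_zero p)
    next
      case (Suc i)
      define L q where "L = real (Suc i) * r ^ i" and "q = (1 / 4 :: real) ^ Suc i"
      have L: "0 < L" "L \<le> 1" and q: "0 < q" using r0 jr[of i] by (auto simp: L_def q_def)
      have q': "\<kappa> / 4 ^ Suc i = \<kappa> * q" "1 / 8 / 4 ^ Suc i = q / 8" by (simp_all add: q_def power_divide)
      \<comment> \<open>\<open>s j\<close> may be zero, but the factor bound passed to
        \<open>Lp_coeffs_cmult\<close> has to be positive.\<close>
      define K where "K = q / 8 / L"
      have K: "norm (of_real (s j) :: complex) \<le> K" "0 < K"
        using s_bound[of i, folded L_def, unfolded q'] L q unfolding Suc K_def norm_of_real
        by (simp_all add: pos_le_divide_eq)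
      have "Lp_coeffs p (K * (L * \<delta>) + \<kappa> / 4 ^ j * (L * \<delta>))
         (\<lambda>n. of_real (s j) * (v n ^ Suc i - w n ^ Suc i) + b j n * (v n ^ Suc i - w n ^ Suc i))"
        unfolding L_def by (intro Lp_coeffs_add Lp_coeffs_cmult Lp_coeffs_mult Lp_coeffs_power_diff p v w d b K)
      then have "Lp_coeffs p (K * (L * \<delta>) + \<kappa> / 4 ^ j * (L * \<delta>)) (\<lambda>n. e j n * v n ^ j - e j n * w n ^ j)"
        unfolding Suc e_def by (simp add: algebra_simps del: of_nat_Suc)
      moreover have "K * (L * \<delta>) + \<kappa> / 4 ^ j * (L * \<delta>) \<le> D j * \<delta>"
      proof -
        have "K * (L * \<delta>) = q / 8 * \<delta>" using L by (simp add: K_def)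
        moreover have "\<kappa> * q * (L * \<delta>) \<le> \<kappa> * q * (1 * \<delta>)"
          using L \<delta> q by (intro mult_left_mono mult_right_mono) (auto simp: \<kappa>_def)
        moreover have "q / 8 * \<delta> + \<kappa> * q * (1 * \<delta>) \<le> 3 / 8 * q * \<delta>"
          using q \<delta> by (simp add: \<kappa>_def)
        ultimately show ?thesis unfolding Suc D_def q' q_def[symmetric] by linarith
      qed
      ultimately show ?thesis using Lp_coeffs_mono[OF _ p] by blast
    qed
    have "(\<lambda>j. D j * \<delta>) sums (1 / 2 * \<delta>)" by (intro sums_mult2 D_sums)
    then have sm: "summable (\<lambda>j. D j * \<delta>)" "(\<Sum>j. D j * \<delta>) = \<delta> / 2" by (simp_all add: sums_iff)
    from Lp_coeffs_suminf[OF p terms sm(1)] obtain f where f: "Lp_coeffs p (\<delta> / 2) f"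
      "\<And>n. (\<lambda>j. e j n * v n ^ j - e j n * w n ^ j) sums f n" unfolding sm(2) by blast
    have "T v n - T w n = f n" for n
    proof -
      have "summable (\<lambda>j. e j n * v n ^ j)" "summable (\<lambda>j. e j n * w n ^ j)"
        using e_sum Lp_coeffs_bound[OF p v] Lp_coeffs_bound[OF p w] by (auto intro: summable_norm_cancel)
      from suminf_diff[OF this] show ?thesis using f(2)[of n] unfolding T_def by (simp add: sums_iff)
    qed
    then show ?thesis using f(1) by presburger
  qed
  define w where "w m = (T ^^ m) (\<lambda>n. 0)" for m
  have w0: "w 0 = (\<lambda>n. 0)" and wS: "w (Suc m) = T (w m)" for m by (auto simp: w_def)
  have w1: "w (Suc 0) n = b 0 n" for n
  proof -
    have "(\<lambda>j. e j n * 0 ^ j) sums e 0 n" using powser_sums_zero[of "\<lambda>j. e j n"] by simp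
    then show ?thesis by (simp add: wS w0 T_def sums_iff e_def s_small)
  qed
  \<comment> \<open>The first increment is \<open>b 0\<close>, of norm at most
    \<open>\<kappa>\<close>. Both bounds are carried together: the radius permits the contraction
    estimate, and halving the increments keeps the radius below \<open>r\<close>.\<close>
  have w: "Lp_coeffs p (r * (1 - 1 / 2 ^ Suc m)) (w m) \<and> Lp_coeffs p (\<kappa> / 2 ^ m) (\<lambda>n. w (Suc m) n - w m n)" for m
  proof (induction m)
    case 0
    then show ?case using b(1)[of 0] by (auto simp: w0 w1 r0 intro!: Lp_coeffs_zero p)
  next
    case (Suc m)
    have "Lp_coeffs p (r * (1 - 1 / 2 ^ Suc m) + \<kappa> / 2 ^ m) (\<lambda>n. w m n + (w (Suc m) n - w m n))"
      using Suc by (intro Lp_coeffs_add p) auto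
    also have "r * (1 - 1 / 2 ^ Suc m) + \<kappa> / 2 ^ m = r * (1 - 1 / 2 ^ Suc (Suc m))"
      by (simp add: r_def \<kappa>_def field_simps)
    finally have 1: "Lp_coeffs p (r * (1 - 1 / 2 ^ Suc (Suc m))) (w (Suc m))" by simp
    have "r * (1 - 1 / 2 ^ Suc k) \<le> r" for k using r0 by simp
    then have "Lp_coeffs p r (w m)" "Lp_coeffs p r (w (Suc m))"
      using 1 Suc Lp_coeffs_mono[OF _ p] by blast+
    from T_contraction[OF this(2,1), of "\<kappa> / 2 ^ m"] Suc
    have "Lp_coeffs p (\<kappa> / 2 ^ Suc m) (\<lambda>n. w (Suc (Suc m)) n - w (Suc m) n)"
      by (simp add: wS \<kappa>_def)
    with 1 show ?case ..
  qed
  have "summable (\<lambda>m. \<kappa> * (1 / 2) ^ m)" by (intro summable_mult summable_geometric) simp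
  then have "summable (\<lambda>m. \<kappa> / 2 ^ m)" by (simp add: power_divide)
  from Lp_coeffs_suminf[OF p conjunct2[OF w] this]
  obtain c' where c': "Lp_coeffs p (\<Sum>m. \<kappa> / 2 ^ m) c'" "\<And>n. (\<lambda>m. w (Suc m) n - w m n) sums c' n" by blast
  \<comment> \<open>For such \<open>n\<close> the modified coefficients are the original ones, so
    \<open>c n\<close> is a fixed point of the scalar map. This map halves distances to
    \<open>c n\<close> on the disc of radius \<open>r\<close>, hence the iterates at index
    \<open>n\<close> converge to \<open>c n\<close>.\<close>
  have agree: "c' n = c n" if n: "M' \<le> \<bar>n\<bar>" "norm (c n) \<le> r" for n
  proof -
    have fix_c: "(\<lambda>j. e j n * c n ^ j) sums c n"
    proof -
      have "(\<lambda>j. (if j = 1 then 1 else 0) * c n ^ j) sums (c n ^ 1)"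
        by (rule sums_cong[THEN iffD1, OF _ sums_single[of 1 "\<lambda>j. c n ^ j"]]) auto
      moreover have "(\<lambda>j. of_real (sin_coeff j) * c n ^ j) sums sin (c n)"
        using sin_converges[of "c n"] by (simp add: scaleR_conv_of_real)
      ultimately have "(\<lambda>j. (if j = 1 then 1 else 0) * c n ^ j - of_real (sin_coeff j) * c n ^ j - a j n * c n ^ j)
         sums (c n ^ 1 - sin (c n) - (\<integral>t. fexp n t * (h t * exp (\<i> * c n * of_real (1 - 2 * t))) \<partial>unit_lborel))"
        by (intro sums_diff a_sums)
      also have "c n ^ 1 - sin (c n) - (\<integral>t. fexp n t * (h t * exp (\<i> * c n * of_real (1 - 2 * t))) \<partial>unit_lborel) = c n"
        using eq[of n] by (simp add: algebra_simps add_eq_0_iff)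
      also have "(\<lambda>j. (if j = 1 then 1 else 0) * c n ^ j - of_real (sin_coeff j) * c n ^ j - a j n * c n ^ j) = (\<lambda>j. e j n * c n ^ j)"
        using b(2)[OF order_trans[OF M' n(1)]] by (auto simp: e_def s_def fun_eq_iff algebra_simps)
      finally show ?thesis .
    qed
    have contr: "norm (T v n - c n) \<le> norm (v n - c n) / 2" if v: "norm (v n) \<le> r" for v
    proof -
      have sv: "summable (\<lambda>j. e j n * v n ^ j)" using e_sum[OF v] by (rule summable_norm_cancel)
      have sums: "(\<lambda>j. e j n * v n ^ j - e j n * c n ^ j) sums (T v n - c n)"
        unfolding T_def using sv fix_c by (intro sums_diff) (auto simp: summable_sums)
      have le: "norm (e j n * v n ^ j - e j n * c n ^ j) \<le> D j * norm (v n - c n)" for j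
      proof (cases j)
        case (Suc i)
        let ?L = "real (Suc i) * r ^ i"
        have "norm (e j n * v n ^ j - e j n * c n ^ j) = norm (e j n) * norm (v n ^ Suc i - c n ^ Suc i)"
          unfolding Suc by (simp flip: norm_mult right_diff_distrib)
        also have "\<dots> \<le> (\<bar>s j\<bar> + \<kappa> / 4 ^ j) * (?L * norm (v n - c n))"
        proof (intro mult_mono norm_power_diff_le v n)
          show "norm (e j n) \<le> \<bar>s j\<bar> + \<kappa> / 4 ^ j"
            unfolding e_def using b_bound[of j n] by (intro norm_triangle_le) auto
        qed (auto simp: \<kappa>_def)
        also have "\<dots> = (\<bar>s j\<bar> * ?L + \<kappa> / 4 ^ j * ?L) * norm (v n - c n)" by (simp add: algebra_simps)
        also have "\<dots> \<le> (1 / 8 / 4 ^ Suc i + \<kappa> / 4 ^ j * 1) * norm (v n - c n)"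
          using s_bound[of i] jr[of i] unfolding Suc
          by (intro mult_right_mono add_mono mult_left_mono) (auto simp: \<kappa>_def)
        also have "\<dots> = (1 / 8 + \<kappa>) * ((1 / 4) ^ j * norm (v n - c n))"
          unfolding Suc by (simp add: field_simps)
        also have "\<dots> \<le> 3 / 8 * ((1 / 4) ^ j * norm (v n - c n))" by (intro mult_right_mono) (auto simp: \<kappa>_def)
        finally show ?thesis by (simp add: D_def)
      qed (simp add: D_def)
      have "(\<lambda>j. D j * norm (v n - c n)) sums (1 / 2 * norm (v n - c n))" by (intro sums_mult2 D_sums)
      then have "norm (\<Sum>j. e j n * v n ^ j - e j n * c n ^ j) \<le> 1 / 2 * norm (v n - c n)"
        using norm_suminf_le[of "\<lambda>j. e j n * v n ^ j - e j n * c n ^ j", OF le] by (auto simp: sums_iff)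
      then show ?thesis using sums by (simp add: sums_iff)
    qed
    have wr: "norm (w m n) \<le> r" for m
    proof -
      have "norm (w m n) \<le> r * (1 - 1 / 2 ^ Suc m)" by (rule Lp_coeffs_bound[OF p conjunct1[OF w]])
      also have "\<dots> \<le> r" using r0 by simp
      finally show ?thesis .
    qed
    have dist: "norm (w m n - c n) \<le> norm (c n) * (1 / 2) ^ m" for m
    proof (induction m)
      case (Suc m)
      then show ?case using contr[of "w m", OF wr] by (simp add: wS)
    qed (simp add: w0)
    have "(\<lambda>m. norm (c n) * (1 / 2) ^ m) \<longlonglongrightarrow> norm (c n) * 0"
      by (intro tendsto_mult tendsto_const LIMSEQ_power_zero) simp
    then have "(\<lambda>m. w m n - c n) \<longlonglongrightarrow> 0"
      by (intro Lim_null_comparison[OF always_eventually[OF allI[OF dist]]]) simp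
    then have "(\<lambda>m. w m n) \<longlonglongrightarrow> c n" by (simp add: LIM_zero_iff)
    then have "(\<lambda>m. w (Suc m) n - w m n) sums (c n - w 0 n)" by (rule telescope_sums)
    then show ?thesis using c'(2)[of n] sums_unique2 by (fastforce simp: w0)
  qed
  \<comment> \<open>The exceptional indices are those changed by truncation and those where
    \<open>c n\<close> lies outside the disc; both sets are finite.\<close>
  have "{n. c n - c' n \<noteq> 0} \<subseteq> {- \<bar>M'\<bar>..\<bar>M'\<bar>} \<union> {n. r < norm (c n)}"
  proof
    fix n assume "n \<in> {n. c n - c' n \<noteq> 0}"
    then show "n \<in> {- \<bar>M'\<bar>..\<bar>M'\<bar>} \<union> {n. r < norm (c n)}"
      using agree[of n] by (cases "M' \<le> \<bar>n\<bar>") auto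
  qed
  then have "finite {n. c n - c' n \<noteq> 0}" using small[OF r0] by (auto intro: finite_subset)
  from Lp_coeffs_finite[OF p this] obtain C where "Lp_coeffs p C (\<lambda>n. c n - c' n)" by blast
  from Lp_coeffs_add[OF p c'(1) this] show ?thesis by auto
qed

section \<open>Absolutely continuous functions\<close>

text \<open>The integrated form of "f is absolutely continuous with derivative g almost everywhere".
  Carrying the integrand along allows differential equations to be handled as equations between
  integrands.\<close>

definition indef_integral :: "(real \<Rightarrow> 'a::euclidean_space) \<Rightarrow> (real \<Rightarrow> 'a) \<Rightarrow> bool" where
  "indef_integral f g \<longleftrightarrow> g absolutely_integrable_on {0..1} \<and>
     (\<forall>x\<in>{0..1}. (g has_integral (f x - f 0)) {0..x})"

lemma indef_integral_has_integral:
  assumes "indef_integral f g" "0 \<le> a" "a \<le> b" "b \<le> 1"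
  shows "(g has_integral (f b - f a)) {a..b}"
proof -
  have i: "g integrable_on {0..1}" using assms(1) by (simp add: indef_integral_def absolutely_integrable_on_def)
  have "g integrable_on {a..b}" by (rule integrable_on_subinterval[OF i]) (use assms in auto)
  moreover have "g integrable_on {0..b}" by (rule integrable_on_subinterval[OF i]) (use assms in auto)
  moreover have "integral {0..a} g = f a - f 0" "integral {0..b} g = f b - f 0"
    using assms unfolding indef_integral_def by (auto intro!: integral_unique)
  ultimately show ?thesis
    using Henstock_Kurzweil_Integration.integral_combine[of 0 a b g] assms
    by (metis add_diff_cancel_left' diff_diff_eq2 diff_add_cancel integrable_integral add.commute)
qed

lemma negligible_uminus:
  fixes N :: "real set" assumes "negligible N" shows "negligible (uminus ` N)"
  by (rule negligible_differentiable_image_negligible[OF order_refl assms])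
    (auto intro!: differentiable_on_minus)

text \<open>The library provides the derivative from the right; reflection yields the derivative from
  the left.\<close>

lemma indef_integral_derivative:
  fixes f g :: "real \<Rightarrow> 'a::euclidean_space"
  assumes "indef_integral f g"
  obtains N where "negligible N" "\<And>x. 0 < x \<Longrightarrow> x < 1 \<Longrightarrow> x \<notin> N \<Longrightarrow> (f has_vector_derivative g x) (at x)"
proof -
  \<comment> \<open>Extension by zero makes the integrand integrable on every interval, as the
    differentiation theorem expects.\<close>
  define g0 where "g0 x = (if x \<in> {0..1} then g x else 0)" for x
  have "g integrable_on {0..1}" using assms by (simp add: indef_integral_def absolutely_integrable_on_def)
  then have gU: "g0 integrable_on UNIV" unfolding g0_def by (simp only: integrable_restrict_UNIV)
  have g0i: "g0 integrable_on cbox a b" for a b by (rule integrable_on_subcbox[OF gU]) simp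
  have g0f: "integral {a..b} g0 = f b - f a" if "0 \<le> a" "a \<le> b" "b \<le> 1" for a b
  proof -
    have "integral {a..b} g0 = integral {a..b} g" by (rule integral_cong) (use that in \<open>auto simp: g0_def\<close>)
    then show ?thesis using indef_integral_has_integral[OF assms that] by (simp add: integral_unique)
  qed
  obtain N1 where N1: "negligible N1"
    "\<And>x e. x \<notin> N1 \<Longrightarrow> 0 < e \<Longrightarrow> \<exists>d>0. \<forall>h. 0 < h \<and> h < d \<longrightarrow> norm (integral (cbox x (x + h *\<^sub>R One)) g0 /\<^sub>R h ^ DIM(real) - g0 x) < e"
    using integrable_ccontinuous_explicit[OF g0i] by blast
  have g1i: "(\<lambda>x. g0 (- x)) integrable_on cbox a b" for a b :: real
    using g0i[of "-b" "-a"] Henstock_Kurzweil_Integration.integrable_reflect_real[where f=g0 and a="-b" and b="-a"] by simp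
  obtain N2 where N2: "negligible N2"
    "\<And>x e. x \<notin> N2 \<Longrightarrow> 0 < e \<Longrightarrow> \<exists>d>0. \<forall>h. 0 < h \<and> h < d \<longrightarrow> norm (integral (cbox x (x + h *\<^sub>R One)) (\<lambda>x. g0 (- x)) /\<^sub>R h ^ DIM(real) - g0 (- x)) < e"
    using integrable_ccontinuous_explicit[OF g1i] by blast
  show ?thesis
  proof (rule that[of "N1 \<union> uminus ` N2"])
    show "negligible (N1 \<union> uminus ` N2)" using N1(1) N2(1) by (intro negligible_Un negligible_uminus)
    fix x :: real assume x: "0 < x" "x < 1" "x \<notin> N1 \<union> uminus ` N2"
    then have x2: "- x \<notin> N2" by (metis UnCI image_eqI minus_minus)
    have g0x: "g0 x = g x" using x by (simp add: g0_def)
    have key: "norm (v - h *\<^sub>R g x) \<le> e * h" if "norm (v /\<^sub>R h - g x) < e" "0 < h" for v h e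
    proof -
      have "v - h *\<^sub>R g x = h *\<^sub>R (v /\<^sub>R h - g x)" using that by (simp add: scaleR_diff_right)
      then have "norm (v - h *\<^sub>R g x) = h * norm (v /\<^sub>R h - g x)" using that by simp
      also have "\<dots> \<le> h * e" using that by (intro mult_left_mono) auto
      finally show ?thesis by (simp add: mult.commute)
    qed
    show "(f has_vector_derivative g x) (at x)"
      unfolding has_vector_derivative_def has_derivative_at_alt
    proof (intro conjI allI impI)
      fix e :: real assume e: "0 < e"
      obtain d1 where d1: "d1 > 0" "\<And>h. 0 < h \<Longrightarrow> h < d1 \<Longrightarrow> norm (integral {x..x + h} g0 /\<^sub>R h - g x) < e"
        using N1(2)[of x e] x e g0x by auto
      obtain d2 where d2: "d2 > 0" "\<And>h. 0 < h \<Longrightarrow> h < d2 \<Longrightarrow> norm (integral {- x..- x + h} (\<lambda>x. g0 (- x)) /\<^sub>R h - g x) < e"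
        using N2(2)[OF x2 e] g0x by auto
      let ?d = "min (min d1 d2) (min x (1 - x))"
      show "\<exists>d>0. \<forall>y. norm (y - x) < d \<longrightarrow> norm (f y - f x - (y - x) *\<^sub>R g x) \<le> e * norm (y - x)"
      proof (intro exI[of _ ?d] conjI allI impI)
        show "0 < ?d" using d1 d2 x by auto
        fix y assume y: "norm (y - x) < ?d"
        consider "y = x" | "x < y" | "y < x" by linarith
        then show "norm (f y - f x - (y - x) *\<^sub>R g x) \<le> e * norm (y - x)"
        proof cases
          case 2
          then have "norm ((f y - f x) /\<^sub>R (y - x) - g x) < e"
            using d1(2)[of "y - x"] g0f[of x y] x y by auto
          from key[OF this] show ?thesis using 2 by simp
        next
          case 3
          have "integral {- x..- y} (\<lambda>x. g0 (- x)) = f x - f y"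
            using g0f[of y x] 3 x y by (simp add: Henstock_Kurzweil_Integration.integral_reflect_real)
          then have "norm ((f x - f y) /\<^sub>R (x - y) - g x) < e"
            using d2(2)[of "x - y"] 3 x y by auto
          from key[OF this] have "norm (f x - f y - (x - y) *\<^sub>R g x) \<le> e * (x - y)" using 3 by simp
          moreover have "norm (f x - f y - (x - y) *\<^sub>R g x) = norm (f y - f x - (y - x) *\<^sub>R g x)"
            by (subst norm_minus_cancel[symmetric]) (simp add: algebra_simps)
          ultimately show ?thesis using 3 by simp
        qed simp
      qed
    qed (rule bounded_linear_scaleR_left)
  qed
qed

text \<open>The condition defining \<open>AC01\<close>, for an arbitrary target space, because the
  argument passes through real-valued functions such as the variation.\<close>

definition abs_cont :: "(real \<Rightarrow> 'a::real_normed_vector) \<Rightarrow> bool" where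
  "abs_cont f \<longleftrightarrow> (\<forall>\<epsilon>>0. \<exists>\<delta>>0. \<forall>d T. d division_of T \<and> T \<subseteq> {0..1} \<and>
       (\<Sum>k\<in>d. Sup k - Inf k) < \<delta> \<longrightarrow> (\<Sum>k\<in>d. norm (f (Sup k) - f (Inf k))) < \<epsilon>)"

lemma AC01_iff: "f \<in> AC01 \<longleftrightarrow> abs_cont f"
  by (simp add: AC01_def abs_cont_def)

lemma division_interval:
  fixes T :: "real set"
  assumes "d division_of T" "k \<in> d" "T \<subseteq> {0..1}"
  shows "k = {Inf k..Sup k}" "Inf k \<le> Sup k" "0 \<le> Inf k" "Sup k \<le> 1" "measure lebesgue k = Sup k - Inf k"
proof -
  obtain a b where ab: "k = cbox a b" using assms division_ofD(4) by blast
  have "k \<noteq> {}" using assms division_ofD(3) by blast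
  then have le: "a \<le> b" using ab by simp
  then have SI: "Sup k = b" "Inf k = a" using ab by simp_all
  have "k \<subseteq> {0..1}" using assms division_ofD(2) by blast
  then show "k = {Inf k..Sup k}" "Inf k \<le> Sup k" "0 \<le> Inf k" "Sup k \<le> 1" "measure lebesgue k = Sup k - Inf k"
    unfolding SI using ab le by auto
qed

text \<open>Truncating the modulus of \<open>g\<close> at a height \<open>m\<close> leaves a
  remainder of integral below \<open>\<epsilon> / 2\<close>; the truncated part contributes at most
  \<open>m\<close> times the total length.\<close>

lemma indef_integral_abs_cont:
  fixes f g :: "real \<Rightarrow> 'a::euclidean_space"
  assumes fg: "indef_integral f g"
  shows "abs_cont f"
  unfolding abs_cont_def
proof (intro allI impI)
  fix \<epsilon> :: real assume \<epsilon>: "0 < \<epsilon>"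
  let ?I = "{0..1::real}"
  have g: "g absolutely_integrable_on ?I" using fg by (simp add: indef_integral_def)
  then have ng: "(\<lambda>x. norm (g x)) absolutely_integrable_on ?I" by (rule absolutely_integrable_norm[unfolded o_def])
  have mi: "(\<lambda>x. min (norm (g x)) (real m)) absolutely_integrable_on ?I" for m
    by (intro absolutely_integrable_min_1 ng absolutely_integrable_on_const) simp
  have ngi: "(\<lambda>x. norm (g x)) integrable_on ?I" using ng by (simp add: absolutely_integrable_on_def)
  have mii: "(\<lambda>x. min (norm (g x)) (real m)) integrable_on ?I" for m using mi by (simp add: absolutely_integrable_on_def)
  have "(\<lambda>m. integral ?I (\<lambda>x. min (norm (g x)) (real m))) \<longlonglongrightarrow> integral ?I (\<lambda>x. norm (g x))"
  proof (rule dominated_convergence(2)[OF mii ngi])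
    fix x
    obtain m where m: "norm (g x) \<le> real m" using real_arch_simple by blast
    show "(\<lambda>k. min (norm (g x)) (real k)) \<longlonglongrightarrow> norm (g x)"
    proof (rule tendsto_eventually)
      have "min (norm (g x)) (real k) = norm (g x)" if "m \<le> k" for k using m that by simp
      then show "\<forall>\<^sub>F k in sequentially. min (norm (g x)) (real k) = norm (g x)"
        by (auto simp: eventually_sequentially)
    qed
  qed auto
  then have "eventually (\<lambda>m. integral ?I (\<lambda>x. norm (g x)) - \<epsilon> / 2 < integral ?I (\<lambda>x. min (norm (g x)) (real m))) sequentially"
    using \<epsilon> by (intro order_tendstoD) auto
  then obtain m where m: "integral ?I (\<lambda>x. norm (g x)) - \<epsilon> / 2 < integral ?I (\<lambda>x. min (norm (g x)) (real m))"
    by (auto simp: eventually_sequentially)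
  define h where "h x = norm (g x) - min (norm (g x)) (real m)" for x
  have h: "h integrable_on ?I" unfolding h_def by (intro Henstock_Kurzweil_Integration.integrable_diff ngi mii)
  have hI: "integral ?I h < \<epsilon> / 2"
    using m Henstock_Kurzweil_Integration.integral_diff[OF ngi mii, of m] by (simp add: h_def[abs_def])
  have h0: "0 \<le> h x" for x by (simp add: h_def)
  show "\<exists>\<delta>>0. \<forall>d T. d division_of T \<and> T \<subseteq> {0..1} \<and> (\<Sum>k\<in>d. Sup k - Inf k) < \<delta> \<longrightarrow>
      (\<Sum>k\<in>d. norm (f (Sup k) - f (Inf k))) < \<epsilon>"
  \<comment> \<open>\<open>m + 1\<close> in place of \<open>m\<close> avoids a zero
    denominator.\<close>
  proof (intro exI[of _ "\<epsilon> / (2 * (real m + 1))"] conjI allI impI; (elim conjE)?)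
    show "0 < \<epsilon> / (2 * (real m + 1))" using \<epsilon> by simp
    fix d T assume d: "d division_of T" and T: "T \<subseteq> ?I" and s: "(\<Sum>k\<in>d. Sup k - Inf k) < \<epsilon> / (2 * (real m + 1))"
    have hk: "h integrable_on k" "(\<lambda>x. norm (g x)) integrable_on k" if "k \<in> d" for k
    proof -
      have "k \<subseteq> ?I" using division_ofD(2)[OF d that] T by blast
      moreover have "k = {Inf k..Sup k}" using division_interval[OF d that T] by auto
      ultimately show "h integrable_on k" "(\<lambda>x. norm (g x)) integrable_on k"
        using integrable_on_subinterval[OF h] integrable_on_subinterval[OF ngi] by metis+
    qed
    have each: "norm (f (Sup k) - f (Inf k)) \<le> integral k h + (real m + 1) * (Sup k - Inf k)" if k: "k \<in> d" for k
    proof -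
      note D = division_interval[OF d k T]
      have gk: "(g has_integral (f (Sup k) - f (Inf k))) k"
        using indef_integral_has_integral[OF fg D(3,2,4)] D(1) by simp
      have ck: "(\<lambda>x. real m + 1) integrable_on k" by (subst D(1)) auto
      have "norm (f (Sup k) - f (Inf k)) = norm (integral k g)" using gk by (simp add: integral_unique)
      also have "\<dots> \<le> integral k (\<lambda>x. h x + (real m + 1))"
        using gk by (intro integral_norm_bound_integral Henstock_Kurzweil_Integration.integrable_add hk[OF k] ck)
          (auto simp: h_def)
      also have "\<dots> = integral k h + integral k (\<lambda>x. real m + 1)"
        by (intro Henstock_Kurzweil_Integration.integral_add hk[OF k] ck)
      also have "integral k (\<lambda>x. real m + 1) = (real m + 1) * (Sup k - Inf k)"
        by (subst D(1)) (use D(2) in \<open>simp add: mult.commute\<close>)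
      finally show ?thesis .
    qed
    have "(\<Sum>k\<in>d. norm (f (Sup k) - f (Inf k))) \<le> (\<Sum>k\<in>d. integral k h) + (real m + 1) * (\<Sum>k\<in>d. Sup k - Inf k)"
      using sum_mono[of d, OF each] by (simp add: sum.distrib sum_distrib_left)
    also have "(\<Sum>k\<in>d. integral k h) = integral T h"
      using d hk by (intro integral_combine_division_bottomup[symmetric]) auto
    also have "integral T h \<le> integral ?I h"
    proof (rule integral_subset_le[OF T _ h])
      show "h integrable_on T"
        using has_integral_combine_division_topdown[OF h d T] by blast
    qed (use h0 in auto)
    also have "\<dots> + (real m + 1) * (\<Sum>k\<in>d. Sup k - Inf k) < \<epsilon> / 2 + \<epsilon> / 2"
    proof (rule add_strict_mono[OF hI])
      show "(real m + 1) * (\<Sum>k\<in>d. Sup k - Inf k) < \<epsilon> / 2"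
      proof -
        have "(\<Sum>k\<in>d. Sup k - Inf k) * (2 * (real m + 1)) < \<epsilon>" using s by (subst (asm) pos_less_divide_eq) auto
        then show ?thesis by (simp add: algebra_simps)
      qed
    qed
    finally show "(\<Sum>k\<in>d. norm (f (Sup k) - f (Inf k))) < \<epsilon>" by simp
  qed
qed

text \<open>Indexed families are easier to produce than divisions, since repeated and degenerate
  intervals are permitted. The index type is part of the statement, hence its instantiation at each
  use.\<close>

lemma abs_cont_family:
  fixes f :: "real \<Rightarrow> 'a::real_normed_vector"
  assumes "abs_cont f" "0 < \<epsilon>"
  obtains \<delta> where "0 < \<delta>"
    "\<And>(I :: 'i set) a b. finite I \<Longrightarrow> (\<And>i. i \<in> I \<Longrightarrow> 0 \<le> a i \<and> a i \<le> b i \<and> b i \<le> 1) \<Longrightarrow>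
       (\<And>i j. i \<in> I \<Longrightarrow> j \<in> I \<Longrightarrow> i \<noteq> j \<Longrightarrow> {a i<..<b i} \<inter> {a j<..<b j} = {}) \<Longrightarrow>
       (\<Sum>i\<in>I. b i - a i) < \<delta> \<Longrightarrow> (\<Sum>i\<in>I. norm (f (b i) - f (a i))) < \<epsilon>"
proof -
  obtain \<delta> where \<delta>: "0 < \<delta>" "\<And>d T. d division_of T \<and> T \<subseteq> {0..1} \<and>
       (\<Sum>k\<in>d. Sup k - Inf k) < \<delta> \<Longrightarrow> (\<Sum>k\<in>d. norm (f (Sup k) - f (Inf k))) < \<epsilon>"
    using assms unfolding abs_cont_def by blast
  show ?thesis
  proof (rule that[OF \<delta>(1)])
    fix I :: "'i set" and a b
    assume fin: "finite I" and ab: "\<And>i. i \<in> I \<Longrightarrow> 0 \<le> a i \<and> a i \<le> b i \<and> b i \<le> 1"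
      and dis: "\<And>i j. i \<in> I \<Longrightarrow> j \<in> I \<Longrightarrow> i \<noteq> j \<Longrightarrow> {a i<..<b i} \<inter> {a j<..<b j} = {}"
      and s: "(\<Sum>i\<in>I. b i - a i) < \<delta>"
    \<comment> \<open>Degenerate intervals contribute nothing but could be listed twice; without
      them the passage from indices to intervals is injective.\<close>
    define J where "J = {i \<in> I. a i < b i}"
    let ?k = "\<lambda>i. {a i..b i}"
    have J: "finite J" "J \<subseteq> I" using fin by (auto simp: J_def)
    have inj: "inj_on ?k J"
    proof (rule inj_onI, rule ccontr)
      fix i j assume ij: "i \<in> J" "j \<in> J" "?k i = ?k j" "i \<noteq> j"
      then have "a i = a j" "b i = b j" by (auto simp: J_def Icc_eq_Icc)
      moreover have "(a i + b i) / 2 \<in> {a i<..<b i}" using ij by (auto simp: J_def)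
      ultimately show False using dis[of i j] ij by (auto simp: J_def)
    qed
    have div: "(?k ` J) division_of (\<Union>(?k ` J))"
    proof (rule division_ofI)
      fix K1 K2 assume "K1 \<in> ?k ` J" "K2 \<in> ?k ` J" "K1 \<noteq> K2"
      then obtain i j where "K1 = ?k i" "K2 = ?k j" "i \<in> J" "j \<in> J" "i \<noteq> j" by auto
      then show "interior K1 \<inter> interior K2 = {}" using dis[of i j] J by (auto simp: interior_atLeastAtMost_real)
    qed (use J in \<open>auto simp: J_def\<close>)
    have sub: "\<Union>(?k ` J) \<subseteq> {0..1}" using ab J by fastforce
    have re: "(\<Sum>k\<in>?k ` J. F (Sup k) (Inf k)) = (\<Sum>i\<in>I. F (b i) (a i))"
      if F: "\<And>x. F x x = 0" for F :: "real \<Rightarrow> real \<Rightarrow> real"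
    proof -
      have "(\<Sum>k\<in>?k ` J. F (Sup k) (Inf k)) = (\<Sum>i\<in>J. F (b i) (a i))"
        by (subst sum.reindex[OF inj]) (auto simp: J_def intro!: sum.cong)
      also have "\<dots> = (\<Sum>i\<in>I. F (b i) (a i))"
      proof (rule sum.mono_neutral_left[OF fin J(2)], rule ballI)
        fix i assume "i \<in> I - J"
        then have "a i = b i" using ab[of i] by (auto simp: J_def)
        then show "F (b i) (a i) = 0" using F by simp
      qed
      finally show ?thesis .
    qed
    show "(\<Sum>i\<in>I. norm (f (b i) - f (a i))) < \<epsilon>"
      using \<delta>(2)[of "?k ` J" "\<Union>(?k ` J)"] div sub s re[of "\<lambda>x y. x - y"] re[of "\<lambda>x y. norm (f x - f y)"] by simp
  qed
qed

lemma abs_cont_continuous: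
  fixes f :: "real \<Rightarrow> 'a::real_normed_vector"
  assumes "abs_cont f" shows "continuous_on {0..1} f"
  unfolding continuous_on_iff
proof (intro ballI allI impI)
  fix x e :: real assume x: "x \<in> {0..1}" and e: "0 < e"
  show "\<exists>d>0. \<forall>y\<in>{0..1}. dist y x < d \<longrightarrow> dist (f y) (f x) < e"
  proof (rule abs_cont_family[OF assms e, where 'i = nat])
    fix \<delta> :: real
    assume \<delta>: "0 < \<delta>" "\<And>(I :: nat set) a b. finite I \<Longrightarrow> (\<And>i. i \<in> I \<Longrightarrow> 0 \<le> a i \<and> a i \<le> b i \<and> b i \<le> 1) \<Longrightarrow>
       (\<And>i j. i \<in> I \<Longrightarrow> j \<in> I \<Longrightarrow> i \<noteq> j \<Longrightarrow> {a i<..<b i} \<inter> {a j<..<b j} = {}) \<Longrightarrow>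
       (\<Sum>i\<in>I. b i - a i) < \<delta> \<Longrightarrow> (\<Sum>i\<in>I. norm (f (b i) - f (a i))) < e"
    have "dist (f y) (f x) < e" if y: "y \<in> {0..1}" "dist y x < \<delta>" for y
    proof -
      have "norm (f (max x y) - f (min x y)) < e"
        using \<delta>(2)[of "{0}" "\<lambda>_. min x y" "\<lambda>_. max x y"] x y by (auto simp: dist_real_def max_def min_def abs_if split: if_splits)
      then show ?thesis by (cases "x \<le> y") (auto simp: dist_norm norm_minus_commute)
    qed
    then show ?thesis using \<delta>(1) by blast
  qed
qed

text \<open>Outer regularity encloses \<open>K\<close> in an open set of small measure, compactness
  in finitely many intervals inside it. Absolute continuity then makes the total increment of
  \<open>F\<close> over the cover small, so the Stieltjes measure of \<open>F\<close> will not
  charge \<open>K\<close>.\<close>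

lemma abs_cont_compact_cover:
  fixes F :: "real \<Rightarrow> real" and K :: "real set"
  assumes F: "abs_cont F" and K: "compact K" "K \<subseteq> {0..1}" "emeasure lborel K = 0" and \<epsilon>: "0 < \<epsilon>"
  obtains d where "finite d" "K \<subseteq> \<Union>d" "\<And>k. k \<in> d \<Longrightarrow> k = {Inf k..Sup k} \<and> 0 \<le> Inf k \<and> Inf k \<le> Sup k \<and> Sup k \<le> 1"
    "(\<Sum>k\<in>d. \<bar>F (Sup k) - F (Inf k)\<bar>) < \<epsilon>"
proof -
  obtain \<delta> where \<delta>: "0 < \<delta>" "\<And>d T. d division_of T \<and> T \<subseteq> {0..1} \<and>
       (\<Sum>k\<in>d. Sup k - Inf k) < \<delta> \<Longrightarrow> (\<Sum>k\<in>d. norm (F (Sup k) - F (Inf k))) < \<epsilon>"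
    using F \<epsilon> unfolding abs_cont_def by blast
  have Kb: "K \<in> sets borel" using K(1) by (simp add: borel_compact)
  obtain U where U: "open U" "K \<subseteq> U" "emeasure lborel (U - K) < ennreal \<delta>"
    using outer_regular_lborel[OF Kb \<delta>(1)] by blast
  have Ub: "U \<in> sets borel" using U(1) by (rule borel_open)
  have "emeasure lborel U = emeasure lborel K + emeasure lborel (U - K)"
    using Kb Ub U(2) by (subst plus_emeasure) (auto simp: Un_absorb1)
  then have mU: "emeasure lborel U < ennreal \<delta>" using U(3) K(3) by simp
  have "\<exists>r>0. cball x r \<subseteq> U" if "x \<in> K" for x
    using U that open_contains_cball by blast
  then obtain r where r: "\<And>x. x \<in> K \<Longrightarrow> 0 < r x \<and> cball x (r x) \<subseteq> U" by metis
  have K_cover: "K \<subseteq> (\<Union>x\<in>K. ball x (r x))" using r by force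
  obtain C where C: "C \<subseteq> K" "finite C" "K \<subseteq> (\<Union>x\<in>C. ball x (r x))"
    by (rule compactE_image[OF K(1) _ K_cover]) auto
  let ?F = "(\<lambda>x. cbox (max 0 (x - r x)) (min 1 (x + r x))) ` C"
  \<comment> \<open>The intervals of the cover may overlap, so their union is divided anew.\<close>
  have "\<exists>d. d division_of (\<Union>?F)"
  proof (rule elementary_unions_intervals[of ?F])
    show "finite ?F" using C(2) by simp
    show "\<exists>a b. s = cbox a b" if "s \<in> ?F" for s using that by blast
    show ?thesis if "d division_of (\<Union>?F)" for d using that by blast
  qed
  then obtain d where d: "d division_of (\<Union>?F)" ..
  have T01: "\<Union>?F \<subseteq> {0..1}" by auto
  have TU: "\<Union>?F \<subseteq> U"
  proof
    fix y assume "y \<in> \<Union>?F"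
    then obtain x where "x \<in> C" "y \<in> cbox (max 0 (x - r x)) (min 1 (x + r x))" by blast
    moreover from this have "y \<in> cball x (r x)" by (auto simp: dist_real_def)
    ultimately show "y \<in> U" using r C by blast
  qed
  have KT: "K \<subseteq> \<Union>?F"
  proof
    fix y assume y: "y \<in> K"
    then obtain x where "x \<in> C" "y \<in> ball x (r x)" using C by blast
    moreover from this have "y \<in> cbox (max 0 (x - r x)) (min 1 (x + r x))" using y K(2) by (auto simp: dist_real_def abs_less_iff)
    ultimately show "y \<in> \<Union>?F" by blast
  qed
  note D = division_interval[OF d _ T01]
  have "(\<Sum>k\<in>d. Sup k - Inf k) = (\<Sum>k\<in>d. measure lebesgue k)" using D(5) by simp
  also have "\<dots> = measure lebesgue (\<Union>?F)" by (rule content_division[OF d])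
  also have "\<dots> < \<delta>"
  proof -
    have Tb: "\<Union>?F \<in> sets borel" using C by (intro sets.finite_Union) auto
    have "measure lebesgue (\<Union>?F) = measure lborel (\<Union>?F)" using Tb by (simp add: measure_completion)
    moreover have "emeasure lborel (\<Union>?F) < ennreal \<delta>"
      using emeasure_mono[OF TU, of lborel] Ub mU by (simp add: le_less_trans)
    then have "measure lborel (\<Union>?F) < \<delta>"
      by (cases "emeasure lborel (\<Union>?F)") (auto simp: measure_def ennreal_less_iff)
    ultimately show ?thesis by simp
  qed
  finally have "(\<Sum>k\<in>d. norm (F (Sup k) - F (Inf k))) < \<epsilon>" using \<delta>(2)[of d "\<Union>?F"] d T01 by blast
  then show ?thesis
    using that[of d] D(1-4) d KT division_ofD(1,6)[OF d] by auto
qed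

text \<open>The Lebesgue-Stieltjes measure of a nondecreasing absolutely continuous function is absolutely
  continuous, so that the Radon-Nikodym theorem provides the integrand.\<close>

lemma abs_cont_mono_indef_integral:
  fixes F :: "real \<Rightarrow> real"
  assumes F: "abs_cont F" and mono: "\<And>x y. 0 \<le> x \<Longrightarrow> x \<le> y \<Longrightarrow> y \<le> 1 \<Longrightarrow> F x \<le> F y"
  shows "\<exists>g. indef_integral F g"
proof -
  \<comment> \<open>A nondecreasing continuous extension to the whole line, as
    \<open>interval_measure\<close> requires.\<close>
  define G where "G x = F (max 0 (min 1 x))" for x
  have Gm: "G x \<le> G y" if "x \<le> y" for x y unfolding G_def using that by (intro mono) auto
  have Gc: "continuous_on UNIV G" unfolding G_def
    by (rule continuous_on_compose2[OF abs_cont_continuous[OF F]]) (auto intro!: continuous_intros)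
  then have Gr: "continuous (at_right a) G" for a
    by (auto simp: continuous_on_eq_continuous_at intro: continuous_at_imp_continuous_at_within)
  have GF: "G x = F x" if "0 \<le> x" "x \<le> 1" for x using that by (simp add: G_def)
  let ?M = "interval_measure G"
  \<comment> \<open>Restriction to the unit interval makes finiteness evident, which inner
    regularity needs.\<close>
  define M0 where "M0 = density ?M (indicator {0<..1})"
  have sM0 [simp, measurable_cong]: "sets M0 = sets borel" by (simp add: M0_def)
  have eM0: "emeasure M0 A = emeasure ?M (A \<inter> {0<..1})" if "A \<in> sets borel" for A
    unfolding M0_def using that by (subst emeasure_density) (auto simp: indicator_inter_arith[symmetric] mult.commute)
  have Ioc: "emeasure M0 {0<..x} = ennreal (F x - F 0)" if "0 \<le> x" "x \<le> 1" for x
  proof -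
    have "emeasure M0 {0<..x} = emeasure ?M {0<..x}" using that by (subst eM0) (auto intro!: arg_cong[where f="emeasure ?M"])
    also have "\<dots> = ennreal (G x - G 0)" using that Gm Gr by (intro emeasure_interval_measure_Ioc) auto
    finally show ?thesis using that by (simp add: GF)
  qed
  have space: "emeasure M0 (space M0) \<noteq> \<infinity>"
  proof -
    have "emeasure M0 (space M0) = emeasure M0 {0<..1}"
      using eM0[of UNIV] eM0[of "{0<..1}"] by (simp add: M0_def)
    then show ?thesis by (simp add: Ioc)
  qed
  have null: "emeasure M0 K = 0" if K: "compact K" "emeasure lborel K = 0" for K
  proof -
    have Kb: "K \<in> sets borel" using K(1) by (simp add: borel_compact)
    let ?K = "K \<inter> {0..1}"
    have K': "compact ?K" "?K \<subseteq> {0..1}" using K(1) by auto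
    have K0: "emeasure lborel ?K = 0"
      using emeasure_mono[of ?K K lborel] Kb K(2) by simp
    have "emeasure M0 K \<le> ennreal \<epsilon>" if \<epsilon>: "0 < \<epsilon>" for \<epsilon>
    proof (rule abs_cont_compact_cover[OF F K' K0 \<epsilon>])
      fix d
      assume d: "finite d" "?K \<subseteq> \<Union>d"
        and D: "\<And>k. k \<in> d \<Longrightarrow> k = {Inf k..Sup k} \<and> 0 \<le> Inf k \<and> Inf k \<le> Sup k \<and> Sup k \<le> 1"
        and s: "(\<Sum>k\<in>d. \<bar>F (Sup k) - F (Inf k)\<bar>) < \<epsilon>"
      have kb: "k \<in> sets borel" if "k \<in> d" for k using D[OF that] by (metis atLeastAtMost_borel)
      have ek: "emeasure ?M k = ennreal \<bar>F (Sup k) - F (Inf k)\<bar>" if "k \<in> d" for k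
      proof -
        have "emeasure ?M {Inf k..Sup k} = ennreal (G (Sup k) - G (Inf k))"
          using D[OF that] Gm Gc by (intro emeasure_interval_measure_Icc) auto
        moreover have "F (Inf k) \<le> F (Sup k)" using D[OF that] by (intro mono) auto
        ultimately show ?thesis using D[OF that] by (simp add: GF)
      qed
      have "emeasure M0 K \<le> emeasure ?M (\<Union>d)"
        unfolding eM0[OF Kb] using d kb by (intro emeasure_mono) auto
      also have "\<dots> \<le> (\<Sum>k\<in>d. emeasure ?M k)"
        using emeasure_subadditive_finite[of d "\<lambda>k. k" ?M] d kb by auto
      also have "\<dots> = ennreal (\<Sum>k\<in>d. \<bar>F (Sup k) - F (Inf k)\<bar>)" using ek by (simp add: sum_ennreal)
      also have "\<dots> \<le> ennreal \<epsilon>" using s by (intro ennreal_leI) auto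
      finally show ?thesis .
    qed
    then show ?thesis by (metis bot.extremum_uniqueI bot_ennreal ennreal_le_epsilon zero_le add_0)
  qed
  have "absolutely_continuous lborel M0"
    unfolding absolutely_continuous_def
  proof
    fix A :: "real set" assume A: "A \<in> null_sets lborel"
    then have Ab: "A \<in> sets borel" by auto
    \<comment> \<open>A null set need not be compact; inner regularity reduces it to its compact
      subsets, for which finite covers are available.\<close>
    have "emeasure M0 A = (SUP K\<in>{K. K \<subseteq> A \<and> compact K}. emeasure M0 K)"
      using inner_regular[OF sM0 space Ab] by simp
    also have "\<dots> = (SUP K\<in>{K. K \<subseteq> A \<and> compact K}. 0)"
    proof (rule SUP_cong[OF refl])
      fix K assume K: "K \<in> {K. K \<subseteq> A \<and> compact K}"
      then have "emeasure lborel K \<le> emeasure lborel A" using Ab by (intro emeasure_mono) auto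
      then show "emeasure M0 K = 0" using K A by (intro null) auto
    qed
    also have "\<dots> = 0" by (rule SUP_const) auto
    finally show "A \<in> null_sets M0" using Ab by auto
  qed
  from sigma_finite_measure.Radon_Nikodym[OF lborel.sigma_finite_measure_axioms this] obtain f where f [measurable]: "f \<in> borel_measurable lborel" and fM: "density lborel f = M0"
    by auto
  define g where "g x = (if x \<in> {0<..1} then enn2real (f x) else 0)" for x
  have [measurable]: "g \<in> borel_measurable borel" unfolding g_def by measurable
  have eM: "emeasure M0 {0<..x} = (\<integral>\<^sup>+y. f y * indicator {0<..x} y \<partial>lborel)" for x
    unfolding fM[symmetric] by (simp add: emeasure_density)
  have "AE y in lborel. f y * indicator {0<..1} y \<noteq> \<infinity>"
    using Ioc[of 1] unfolding eM by (intro nn_integral_PInf_AE) auto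
  then have fin: "AE y in lborel. y \<in> {0<..1} \<longrightarrow> f y < top"
    by eventually_elim (auto simp: less_top)
  have hi: "(g has_integral (F x - F 0)) {0..x}" if x: "0 \<le> x" "x \<le> 1" for x
  proof -
    let ?g = "\<lambda>y. if y \<in> {0..x} then g y else 0"
    have "(\<integral>\<^sup>+y. ennreal (?g y) \<partial>lborel) = (\<integral>\<^sup>+y. f y * indicator {0<..x} y \<partial>lborel)"
    proof (rule nn_integral_cong_AE)
      show "AE y in lborel. ennreal (?g y) = f y * indicator {0<..x} y"
        using fin by eventually_elim (use x in \<open>auto simp: g_def indicator_def\<close>)
    qed
    also have "\<dots> = ennreal (F x - F 0)" using Ioc[OF x] eM by simp
    finally have "(?g has_integral (F x - F 0)) UNIV"
      using mono[of 0 x] x by (intro nn_integral_has_integral) (auto simp: g_def)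
    then show ?thesis by (simp only: has_integral_restrict_UNIV)
  qed
  have "g absolutely_integrable_on {0..1}"
    using hi[of 1] by (intro nonnegative_absolutely_integrable_1) (auto simp: g_def)
  then have "indef_integral F g" using hi unfolding indef_integral_def by auto
  then show ?thesis by blast
qed

section \<open>Total variation\<close>

definition variation_sum :: "(real \<Rightarrow> 'a::real_normed_vector) \<Rightarrow> (nat \<Rightarrow> real) \<Rightarrow> nat \<Rightarrow> real" where
  "variation_sum f t n = (\<Sum>j<n. norm (f (t (Suc j)) - f (t j)))"

text \<open>Total variation over the interval from \<open>0\<close> to \<open>x\<close>. Partitions
  are monotone sequences in which points may repeat, so clamping a partition with \<open>min\<close>
  or \<open>max\<close> yields a partition again.\<close>

definition variation :: "(real \<Rightarrow> 'a::real_normed_vector) \<Rightarrow> real \<Rightarrow> real" where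
  "variation f x = Sup {variation_sum f t n |t n. mono t \<and> (\<forall>j. 0 \<le> t j \<and> t j \<le> x)}"

lemma mono_intervals_disjoint:
  fixes t :: "nat \<Rightarrow> real"
  assumes "mono t" "i \<noteq> j" shows "{t i<..<t (Suc i)} \<inter> {t j<..<t (Suc j)} = {}"
proof (cases "i < j")
  case True
  then have "t (Suc i) \<le> t j" using assms by (auto intro: monoD)
  then show ?thesis by auto
next
  case False
  then have "t (Suc j) \<le> t i" using assms by (auto intro: monoD)
  then show ?thesis by auto
qed

text \<open>Taking \<open>1\<close> for epsilon, any partition of an interval shorter than the
  corresponding \<open>\<delta>\<close> has variation sum below one. Hence \<open>m\<close> pieces
  of length \<open>1 / m < \<delta>\<close> bound every variation sum by \<open>m\<close>.\<close>

lemma variation_sum_bounded: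
  fixes f :: "real \<Rightarrow> 'a::real_normed_vector"
  assumes f: "abs_cont f"
  obtains C where "\<And>t n. mono t \<Longrightarrow> (\<And>j. 0 \<le> t j \<and> t j \<le> 1) \<Longrightarrow> variation_sum f t n \<le> C"
proof (rule abs_cont_family[OF f zero_less_one, where 'i = nat])
  fix \<delta> :: real
  assume \<delta>: "0 < \<delta>" "\<And>(I :: nat set) a b. finite I \<Longrightarrow> (\<And>i. i \<in> I \<Longrightarrow> 0 \<le> a i \<and> a i \<le> b i \<and> b i \<le> 1) \<Longrightarrow>
       (\<And>i j. i \<in> I \<Longrightarrow> j \<in> I \<Longrightarrow> i \<noteq> j \<Longrightarrow> {a i<..<b i} \<inter> {a j<..<b j} = {}) \<Longrightarrow>
       (\<Sum>i\<in>I. b i - a i) < \<delta> \<Longrightarrow> (\<Sum>i\<in>I. norm (f (b i) - f (a i))) < 1"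
  obtain m :: nat where m: "0 < m" "1 / real m < \<delta>"
    using \<delta>(1) by (metis nat_approx_posE zero_less_Suc)
  have "variation_sum f t n \<le> real m" if t: "mono t" "\<And>j. 0 \<le> t j \<and> t j \<le> 1" for t n
  proof -
    \<comment> \<open>\<open>c l\<close> clamps a point to the piece number \<open>l\<close>, and
      \<open>b l\<close> cuts it off at the left end of that piece. Moving from \<open>b l\<close>
      to \<open>b (Suc l)\<close> changes \<open>f\<close> by the increment within the piece, so
      summing over \<open>l\<close> telescopes.\<close>
    define c where "c l s = max (real l / real m) (min (real (Suc l) / real m) s)" for l s
    define b where "b l s = min s (real l / real m)" for l s
    have lm: "real l / real m \<le> real (Suc l) / real m" for l by (simp add: divide_right_mono)
    have bc: "f (b (Suc l) s) - f (b l s) = f (c l s) - f (real l / real m)" for l s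
      using lm[of l] by (auto simp: b_def c_def min_def max_def)
    have tel: "f s - f 0 = (\<Sum>l<m. f (c l s) - f (real l / real m))" if "0 \<le> s" "s \<le> 1" for s
    proof -
      have "(\<Sum>l<m. f (b (Suc l) s) - f (b l s)) = f (b m s) - f (b 0 s)"
        by (rule sum_lessThan_telescope)
      then show ?thesis using that m unfolding bc by (simp add: b_def min_def)
    qed
    have inner: "(\<Sum>j<n. norm (f (c l (t (Suc j))) - f (c l (t j)))) < 1" if "l < m" for l
    proof (rule \<delta>(2))
      have cm: "mono (\<lambda>j. c l (t j))" unfolding c_def by (intro monoI max.mono min.mono order_refl monoD[OF t(1)])
      show "0 \<le> c l (t j) \<and> c l (t j) \<le> c l (t (Suc j)) \<and> c l (t (Suc j)) \<le> 1" for j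
      proof (intro conjI)
        show "0 \<le> c l (t j)" by (simp add: c_def le_max_iff_disj)
        show "c l (t j) \<le> c l (t (Suc j))" using cm by (auto intro: monoD)
        have "real (Suc l) / real m \<le> 1" "real l / real m \<le> 1" using that m by (auto simp: divide_le_eq)
        then show "c l (t (Suc j)) \<le> 1" by (simp add: c_def min_le_iff_disj)
      qed
      show "{c l (t i)<..<c l (t (Suc i))} \<inter> {c l (t j)<..<c l (t (Suc j))} = {}" if "i \<noteq> j" for i j
        by (rule mono_intervals_disjoint[OF cm that])
      have "(\<Sum>j<n. c l (t (Suc j)) - c l (t j)) = c l (t n) - c l (t 0)"
        by (rule sum_lessThan_telescope)
      also have "\<dots> \<le> real (Suc l) / real m - real l / real m"
        using lm[of l] by (auto simp: c_def max_def min_def)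
      also have "\<dots> = 1 / real m" by (simp add: diff_divide_distrib[symmetric])
      finally show "(\<Sum>j<n. c l (t (Suc j)) - c l (t j)) < \<delta>" using m by linarith
    qed auto
    have "norm (f (t (Suc j)) - f (t j)) \<le> (\<Sum>l<m. norm (f (c l (t (Suc j))) - f (c l (t j))))" for j
    proof -
      have "f (t (Suc j)) - f (t j) = (f (t (Suc j)) - f 0) - (f (t j) - f 0)" by simp
      also have "\<dots> = (\<Sum>l<m. f (c l (t (Suc j))) - f (c l (t j)))"
        using t(2) by (simp add: tel flip: sum_subtractf)
      finally show ?thesis by (simp add: norm_sum)
    qed
    then have "variation_sum f t n \<le> (\<Sum>j<n. \<Sum>l<m. norm (f (c l (t (Suc j))) - f (c l (t j))))"
      unfolding variation_sum_def by (intro sum_mono)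
    also have "\<dots> = (\<Sum>l<m. \<Sum>j<n. norm (f (c l (t (Suc j))) - f (c l (t j))))" by (rule sum.swap)
    also have "\<dots> \<le> (\<Sum>l<m. 1)" using inner by (intro sum_mono) (auto intro: less_imp_le)
    finally show ?thesis by simp
  qed
  then show ?thesis by (rule that)
qed

text \<open>From below: a partition up to \<open>x\<close> is extended by the points
  \<open>x\<close> and \<open>y\<close>. From above: a nearly optimal partition up to
  \<open>y\<close> is clamped at \<open>x\<close> from both sides. The second inequality exhibits a
  partition of the interval from \<open>x\<close> to \<open>y\<close>, since such partitions are
  later collected over many intervals.\<close>

lemma
  fixes f :: "real \<Rightarrow> 'a::real_normed_vector"
  assumes f: "abs_cont f" and xy: "0 \<le> x" "x \<le> y" "y \<le> 1"
  shows variation_increment_ge: "norm (f y - f x) \<le> variation f y - variation f x"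
    and variation_increment_le: "\<And>\<eta>. 0 < \<eta> \<Longrightarrow>
      \<exists>t n. mono t \<and> (\<forall>j. x \<le> t j \<and> t j \<le> y) \<and> variation f y - variation f x \<le> variation_sum f t n + \<eta>"
proof -
  obtain C where C: "\<And>t n. mono t \<Longrightarrow> (\<And>j. 0 \<le> t j \<and> t j \<le> 1) \<Longrightarrow> variation_sum f t n \<le> C"
    using variation_sum_bounded[OF f] by blast
  let ?S = "\<lambda>x. {variation_sum f t n |t n. mono t \<and> (\<forall>j. 0 \<le> t j \<and> t j \<le> x)}"
  have bdd: "bdd_above (?S z)" if "z \<le> 1" for z
  proof (rule bdd_aboveI[of _ C])
    fix v assume "v \<in> ?S z"
    then show "v \<le> C" using that by (auto intro!: C intro: order_trans)
  qed
  have ne: "?S z \<noteq> {}" if "0 \<le> z" for z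
    using that by (auto intro!: exI[of _ "\<lambda>_. 0"] simp: mono_def)
  have upper: "variation_sum f t n \<le> variation f z" if "mono t" "\<And>j. 0 \<le> t j \<and> t j \<le> z" "z \<le> 1" for t n z
    unfolding variation_def using that by (intro cSup_upper bdd) auto
  have "variation f x \<le> variation f y - norm (f y - f x)"
    unfolding variation_def[of f x]
  proof (rule cSup_least[OF ne[OF xy(1)]])
    fix v assume "v \<in> ?S x"
    then obtain t n where v: "v = variation_sum f t n" and t: "mono t" "\<And>j. 0 \<le> t j \<and> t j \<le> x" by auto
    \<comment> \<open>Index \<open>Suc n\<close> holds \<open>x\<close> and all later ones hold
      \<open>y\<close>, so two further increments appear; the one from \<open>t n\<close> to
      \<open>x\<close> is discarded.\<close>
    define t' where "t' j = (if j \<le> n then t j else if j = Suc n then x else y)" for j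
    have "mono t'" using t xy unfolding t'_def
      by (intro monoI) (auto intro: monoD order_trans)
    moreover have "0 \<le> t' j \<and> t' j \<le> y" for j using t(2)[of j] xy by (auto simp: t'_def)
    ultimately have "variation_sum f t' (Suc (Suc n)) \<le> variation f y" using xy by (intro upper) auto
    moreover have "variation_sum f t' (Suc (Suc n)) = v + norm (f x - f (t n)) + norm (f y - f x)"
      unfolding v variation_sum_def by (simp add: t'_def)
    ultimately show "v \<le> variation f y - norm (f y - f x)" by (smt (verit) norm_ge_zero)
  qed
  then show "norm (f y - f x) \<le> variation f y - variation f x" by simp
  fix \<eta> :: real assume \<eta>: "0 < \<eta>"
  have "variation f y - \<eta> < Sup (?S y)" using \<eta> by (simp add: variation_def)
  then obtain v where "v \<in> ?S y" "variation f y - \<eta> < v"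
    using less_cSup_iff[OF ne bdd, of y] xy by auto
  then obtain t n where t: "mono t" "\<And>j. 0 \<le> t j \<and> t j \<le> y" and v: "variation f y - \<eta> < variation_sum f t n" by auto
  \<comment> \<open>This identity splits an increment that may cross \<open>x\<close> into its parts
    on the two sides.\<close>
  have split: "f s = f (min x s) + f (max x s) - f x" for s by (auto simp: min_def max_def)
  have "norm (f (t (Suc j)) - f (t j)) \<le> norm (f (min x (t (Suc j))) - f (min x (t j))) + norm (f (max x (t (Suc j))) - f (max x (t j)))" for j
  proof -
    have "f (t (Suc j)) - f (t j) = (f (min x (t (Suc j))) - f (min x (t j))) + (f (max x (t (Suc j))) - f (max x (t j)))"
      by (subst (1 2) split) simp
    then show ?thesis by (metis norm_triangle_ineq)
  qed
  then have "variation_sum f t n \<le> variation_sum f (\<lambda>j. min x (t j)) n + variation_sum f (\<lambda>j. max x (t j)) n"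
    unfolding variation_sum_def sum.distrib[symmetric] by (intro sum_mono)
  moreover have "variation_sum f (\<lambda>j. min x (t j)) n \<le> variation f x"
  proof (rule upper)
    show "mono (\<lambda>j. min x (t j))" by (intro monoI min.mono order_refl monoD[OF t(1)])
  qed (use t xy in \<open>auto simp: min_le_iff_disj\<close>)
  ultimately have "variation f y - variation f x \<le> variation_sum f (\<lambda>j. max x (t j)) n + \<eta>"
    using v by linarith
  moreover have "mono (\<lambda>j. max x (t j))" by (intro monoI max.mono order_refl monoD[OF t(1)])
  moreover have "\<forall>j. x \<le> max x (t j) \<and> max x (t j) \<le> y" using t xy by auto
  ultimately show "\<exists>t n. mono t \<and> (\<forall>j. x \<le> t j \<and> t j \<le> y) \<and> variation f y - variation f x \<le> variation_sum f t n + \<eta>"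
    by blast
qed

text \<open>Nearly optimal partitions inside the intervals of a division form together one finite
  nonoverlapping family of no larger total length, to which absolute continuity of \<open>f\<close>
  applies.\<close>

lemma abs_cont_variation:
  fixes f :: "real \<Rightarrow> 'a::real_normed_vector"
  assumes f: "abs_cont f" shows "abs_cont (variation f)"
  unfolding abs_cont_def
proof (intro allI impI)
  fix \<epsilon> :: real assume \<epsilon>: "0 < \<epsilon>"
  show "\<exists>\<delta>>0. \<forall>d T. d division_of T \<and> T \<subseteq> {0..1} \<and> (\<Sum>k\<in>d. Sup k - Inf k) < \<delta> \<longrightarrow>
       (\<Sum>k\<in>d. norm (variation f (Sup k) - variation f (Inf k))) < \<epsilon>"
  proof (rule abs_cont_family[OF f half_gt_zero[OF \<epsilon>], where 'i = "real set \<times> nat"])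
    fix \<delta> :: real
    assume \<delta>: "0 < \<delta>" "\<And>(I :: (real set \<times> nat) set) a b. finite I \<Longrightarrow> (\<And>i. i \<in> I \<Longrightarrow> 0 \<le> a i \<and> a i \<le> b i \<and> b i \<le> 1) \<Longrightarrow>
       (\<And>i j. i \<in> I \<Longrightarrow> j \<in> I \<Longrightarrow> i \<noteq> j \<Longrightarrow> {a i<..<b i} \<inter> {a j<..<b j} = {}) \<Longrightarrow>
       (\<Sum>i\<in>I. b i - a i) < \<delta> \<Longrightarrow> (\<Sum>i\<in>I. norm (f (b i) - f (a i))) < \<epsilon> / 2"
    have "(\<Sum>k\<in>d. norm (variation f (Sup k) - variation f (Inf k))) < \<epsilon>"
      if d: "d division_of T" and T: "T \<subseteq> {0..1}" and s: "(\<Sum>k\<in>d. Sup k - Inf k) < \<delta>" for d T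
    proof -
      note D = division_interval[OF d _ T]
      have fin: "finite d" using d by (rule division_ofD(1))
      \<comment> \<open>The error allowed per interval, adding up to at most
        \<open>\<epsilon> / 2\<close>; the added one covers the empty division.\<close>
      define \<eta> where "\<eta> = \<epsilon> / (2 * (real (card d) + 1))"
      have \<eta>: "0 < \<eta>" using \<epsilon> by (simp add: \<eta>_def)
      have "\<exists>t n. mono t \<and> (\<forall>j. Inf k \<le> t j \<and> t j \<le> Sup k) \<and> variation f (Sup k) - variation f (Inf k) \<le> variation_sum f t n + \<eta>"
        if "k \<in> d" for k
        by (rule variation_increment_le[OF f D(3,2,4)[OF that] \<eta>])
      then obtain t n where t: "\<And>k. k \<in> d \<Longrightarrow> mono (t k)" "\<And>k j. k \<in> d \<Longrightarrow> Inf k \<le> t k j \<and> t k j \<le> Sup k"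
        "\<And>k. k \<in> d \<Longrightarrow> variation f (Sup k) - variation f (Inf k) \<le> variation_sum f (t k) (n k) + \<eta>"
        by metis
      let ?I = "SIGMA k:d. {..<n k}"
      have "(\<Sum>i\<in>?I. norm (f ((\<lambda>(k, j). t k (Suc j)) i) - f ((\<lambda>(k, j). t k j) i))) < \<epsilon> / 2"
      proof (rule \<delta>(2))
        fix i assume "i \<in> ?I"
        then obtain k j where i: "i = (k, j)" "k \<in> d" by auto
        show "0 \<le> (\<lambda>(k, j). t k j) i \<and> (\<lambda>(k, j). t k j) i \<le> (\<lambda>(k, j). t k (Suc j)) i \<and> (\<lambda>(k, j). t k (Suc j)) i \<le> 1"
          using t(2)[OF i(2), of j] t(2)[OF i(2), of "Suc j"] D(3,4)[OF i(2)] monoD[OF t(1)[OF i(2)], of j "Suc j"] i(1) by auto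
      next
        fix i i' assume ii: "i \<in> ?I" "i' \<in> ?I" "i \<noteq> i'"
        then obtain k j k' j' where i: "i = (k, j)" "i' = (k', j')" "k \<in> d" "k' \<in> d" by auto
        show "{(\<lambda>(k, j). t k j) i<..<(\<lambda>(k, j). t k (Suc j)) i} \<inter> {(\<lambda>(k, j). t k j) i'<..<(\<lambda>(k, j). t k (Suc j)) i'} = {}"
        proof (cases "k = k'")
          case True
          then show ?thesis using ii i mono_intervals_disjoint[OF t(1)[OF i(3)], of j j'] by auto
        next
          case False
          then have "interior k \<inter> interior k' = {}" using division_ofD(5)[OF d] i by blast
          then have "{Inf k<..<Sup k} \<inter> {Inf k'<..<Sup k'} = {}"
            using D(1)[OF i(3)] D(1)[OF i(4)] by (metis interior_atLeastAtMost_real)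
          moreover have "{t k j<..<t k (Suc j)} \<subseteq> {Inf k<..<Sup k}"
            using t(2)[OF i(3), of j] t(2)[OF i(3), of "Suc j"] by auto
          moreover have "{t k' j'<..<t k' (Suc j')} \<subseteq> {Inf k'<..<Sup k'}"
            using t(2)[OF i(4), of j'] t(2)[OF i(4), of "Suc j'"] by auto
          ultimately have "{t k j<..<t k (Suc j)} \<inter> {t k' j'<..<t k' (Suc j')} = {}" by blast
          then show ?thesis unfolding i by simp
        qed
      next
        have "(\<Sum>i\<in>?I. (\<lambda>(k, j). t k (Suc j)) i - (\<lambda>(k, j). t k j) i) = (\<Sum>k\<in>d. \<Sum>j<n k. t k (Suc j) - t k j)"
          using fin by (subst sum.Sigma) (auto intro!: sum.cong)
        also have "\<dots> = (\<Sum>k\<in>d. t k (n k) - t k 0)" by (simp add: sum_lessThan_telescope)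
        also have "\<dots> \<le> (\<Sum>k\<in>d. Sup k - Inf k)" using t(2) by (intro sum_mono diff_mono) auto
        finally show "(\<Sum>i\<in>?I. (\<lambda>(k, j). t k (Suc j)) i - (\<lambda>(k, j). t k j) i) < \<delta>" using s by linarith
      qed (use fin in auto)
      moreover have "(\<Sum>i\<in>?I. norm (f ((\<lambda>(k, j). t k (Suc j)) i) - f ((\<lambda>(k, j). t k j) i))) = (\<Sum>k\<in>d. variation_sum f (t k) (n k))"
        unfolding variation_sum_def using fin by (subst sum.Sigma) (auto intro!: sum.cong)
      ultimately have V: "(\<Sum>k\<in>d. variation_sum f (t k) (n k)) < \<epsilon> / 2" by simp
      have "norm (variation f (Sup k) - variation f (Inf k)) \<le> variation_sum f (t k) (n k) + \<eta>" if "k \<in> d" for k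
        using variation_increment_ge[OF f D(3,2,4)[OF that]] t(3)[OF that] norm_ge_zero[of "f (Sup k) - f (Inf k)"]
        unfolding real_norm_def by linarith
      then have "(\<Sum>k\<in>d. norm (variation f (Sup k) - variation f (Inf k))) \<le> (\<Sum>k\<in>d. variation_sum f (t k) (n k) + \<eta>)"
        by (rule sum_mono)
      also have "\<dots> = (\<Sum>k\<in>d. variation_sum f (t k) (n k)) + real (card d) * \<eta>" by (simp add: sum.distrib)
      also have "real (card d) * \<eta> \<le> \<epsilon> / 2" using \<epsilon> by (simp add: \<eta>_def field_simps)
      finally show ?thesis using V by linarith
    qed
    then show ?thesis using \<delta>(1) by blast
  qed
qed

lemma abs_cont_diff:
  fixes f g :: "real \<Rightarrow> 'a::real_normed_vector"
  assumes "abs_cont f" "abs_cont g" shows "abs_cont (\<lambda>x. f x - g x)"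
  unfolding abs_cont_def
proof (intro allI impI)
  fix \<epsilon> :: real assume "0 < \<epsilon>"
  note half = half_gt_zero[OF this]
  obtain \<delta>1 where \<delta>1: "0 < \<delta>1" and
    1: "\<And>d T. d division_of T \<and> T \<subseteq> {0..1} \<and> (\<Sum>k\<in>d. Sup k - Inf k) < \<delta>1 \<Longrightarrow> (\<Sum>k\<in>d. norm (f (Sup k) - f (Inf k))) < \<epsilon> / 2"
    using assms(1) half unfolding abs_cont_def by blast
  obtain \<delta>2 where \<delta>2: "0 < \<delta>2" and
    2: "\<And>d T. d division_of T \<and> T \<subseteq> {0..1} \<and> (\<Sum>k\<in>d. Sup k - Inf k) < \<delta>2 \<Longrightarrow> (\<Sum>k\<in>d. norm (g (Sup k) - g (Inf k))) < \<epsilon> / 2"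
    using assms(2) half unfolding abs_cont_def by blast
  show "\<exists>\<delta>>0. \<forall>d T. d division_of T \<and> T \<subseteq> {0..1} \<and> (\<Sum>k\<in>d. Sup k - Inf k) < \<delta> \<longrightarrow>
      (\<Sum>k\<in>d. norm (f (Sup k) - g (Sup k) - (f (Inf k) - g (Inf k)))) < \<epsilon>"
  proof (intro exI[of _ "min \<delta>1 \<delta>2"] conjI allI impI)
    fix d :: "real set set" and T assume d: "d division_of T \<and> T \<subseteq> {0..1} \<and> (\<Sum>k\<in>d. Sup k - Inf k) < min \<delta>1 \<delta>2"
    have "(\<Sum>k\<in>d. norm (f (Sup k) - g (Sup k) - (f (Inf k) - g (Inf k)))) \<le> (\<Sum>k\<in>d. norm (f (Sup k) - f (Inf k)) + norm (g (Sup k) - g (Inf k)))"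
    proof (rule sum_mono)
      fix k
      have "f (Sup k) - g (Sup k) - (f (Inf k) - g (Inf k)) = (f (Sup k) - f (Inf k)) - (g (Sup k) - g (Inf k))" by simp
      then show "norm (f (Sup k) - g (Sup k) - (f (Inf k) - g (Inf k))) \<le> norm (f (Sup k) - f (Inf k)) + norm (g (Sup k) - g (Inf k))"
        by (metis norm_triangle_ineq4)
    qed
    then show "(\<Sum>k\<in>d. norm (f (Sup k) - g (Sup k) - (f (Inf k) - g (Inf k)))) < \<epsilon>"
      using 1[of d T] 2[of d T] d by (simp add: sum.distrib)
  qed (use \<delta>1 \<delta>2 in auto)
qed

text \<open>Domination of increments is the way in which real components, exponentials and products
  inherit absolute continuity.\<close>

lemma abs_cont_compose_le:
  fixes f :: "real \<Rightarrow> 'a::real_normed_vector" and g :: "real \<Rightarrow> 'b::real_normed_vector"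
  assumes "abs_cont f" and K: "0 < K" and g: "\<And>x y. 0 \<le> x \<Longrightarrow> x \<le> y \<Longrightarrow> y \<le> 1 \<Longrightarrow> norm (g y - g x) \<le> K * norm (f y - f x)"
  shows "abs_cont g"
  unfolding abs_cont_def
proof (intro allI impI)
  fix \<epsilon> :: real assume \<epsilon>: "0 < \<epsilon>"
  note pos = divide_pos_pos[OF this K]
  obtain \<delta> where \<delta>: "0 < \<delta>" and
    1: "\<And>d T. d division_of T \<and> T \<subseteq> {0..1} \<and> (\<Sum>k\<in>d. Sup k - Inf k) < \<delta> \<Longrightarrow> (\<Sum>k\<in>d. norm (f (Sup k) - f (Inf k))) < \<epsilon> / K"
    using assms(1) pos unfolding abs_cont_def by blast
  have "(\<Sum>k\<in>d. norm (g (Sup k) - g (Inf k))) < \<epsilon>"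
    if d: "d division_of T" "T \<subseteq> {0..1}" "(\<Sum>k\<in>d. Sup k - Inf k) < \<delta>" for d T
  proof -
    have "(\<Sum>k\<in>d. norm (g (Sup k) - g (Inf k))) \<le> (\<Sum>k\<in>d. K * norm (f (Sup k) - f (Inf k)))"
      using division_interval[OF d(1) _ d(2)] by (intro sum_mono g) auto
    also have "\<dots> < K * (\<epsilon> / K)"
      using 1[of d T] d K unfolding sum_distrib_left[symmetric] by (intro mult_strict_left_mono) auto
    finally show ?thesis using K by simp
  qed
  then show "\<exists>\<delta>>0. \<forall>d T. d division_of T \<and> T \<subseteq> {0..1} \<and> (\<Sum>k\<in>d. Sup k - Inf k) < \<delta> \<longrightarrow>
      (\<Sum>k\<in>d. norm (g (Sup k) - g (Inf k))) < \<epsilon>" using \<delta> by blast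
qed

lemma indef_integral_linear:
  fixes f g :: "real \<Rightarrow> 'a::euclidean_space" and h :: "'a \<Rightarrow> 'b::euclidean_space"
  assumes "indef_integral f g" "bounded_linear h"
  shows "indef_integral (\<lambda>x. h (f x)) (\<lambda>x. h (g x))"
proof -
  interpret bounded_linear h by fact
  show ?thesis
    unfolding indef_integral_def
  proof (intro conjI ballI)
    show "(\<lambda>x. h (g x)) absolutely_integrable_on {0..1}"
      using absolutely_integrable_linear[where f=g and s="{0..1}", OF _ assms(2)] assms(1) by (simp add: indef_integral_def o_def)
    fix x :: real assume "x \<in> {0..1}"
    then have "(g has_integral (f x - f 0)) {0..x}" using assms(1) by (simp add: indef_integral_def)
    from has_integral_linear[OF this assms(2)]
    show "((\<lambda>x. h (g x)) has_integral (h (f x) - h (f 0))) {0..x}" by (simp add: o_def diff)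
  qed
qed

lemma indef_integral_add:
  assumes "indef_integral f f'" "indef_integral g g'"
  shows "indef_integral (\<lambda>x. f x + g x) (\<lambda>x. f' x + g' x)"
  unfolding indef_integral_def
proof (intro conjI ballI)
  show "(\<lambda>x. f' x + g' x) absolutely_integrable_on {0..1}"
    using assms by (auto simp: indef_integral_def intro: set_integral_add)
  fix x :: real assume "x \<in> {0..1}"
  then have "((\<lambda>x. f' x + g' x) has_integral ((f x - f 0) + (g x - g 0))) {0..x}"
    using assms by (intro has_integral_add) (auto simp: indef_integral_def)
  then show "((\<lambda>x. f' x + g' x) has_integral (f x + g x - (f 0 + g 0))) {0..x}" by (simp add: algebra_simps)
qed

text \<open>The Jordan decomposition: a real component is the difference of the variation of
  \<open>f\<close> and of that variation minus the component. Both are nondecreasing and absolutely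
  continuous, so the monotone case provides integrands.\<close>

theorem abs_cont_indef_integral:
  fixes f :: "real \<Rightarrow> complex"
  assumes f: "abs_cont f" shows "\<exists>g. indef_integral f g"
proof -
  let ?V = "variation f"
  have V: "abs_cont ?V" by (rule abs_cont_variation[OF f])
  have part: "\<exists>g. indef_integral (\<lambda>x. L (f x)) g" if L: "\<And>z w. \<bar>L z - L w\<bar> \<le> norm (z - w)" for L :: "complex \<Rightarrow> real"
  proof -
    have L': "abs_cont (\<lambda>x. L (f x))"
      using L by (intro abs_cont_compose_le[OF f zero_less_one]) auto
    have "?V x \<le> ?V y" "?V x - L (f x) \<le> ?V y - L (f y)" if "0 \<le> x" "x \<le> y" "y \<le> 1" for x y
      using variation_increment_ge[OF f that] L[of "f y" "f x"] norm_ge_zero[of "f y - f x"] by linarith+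
    then obtain g1 g2 where g: "indef_integral ?V g1" "indef_integral (\<lambda>x. ?V x - L (f x)) g2"
      using abs_cont_mono_indef_integral[OF V] abs_cont_mono_indef_integral[OF abs_cont_diff[OF V L']] by blast
    from indef_integral_add[OF g(1) indef_integral_linear[OF g(2) bounded_linear_minus[OF bounded_linear_ident]]]
    show ?thesis by auto
  qed
  obtain g1 where g1: "indef_integral (\<lambda>x. Re (f x)) g1" using part[of Re] abs_Re_le_cmod by (metis minus_complex.simps(1))
  obtain g2 where g2: "indef_integral (\<lambda>x. Im (f x)) g2" using part[of Im] abs_Im_le_cmod by (metis minus_complex.simps(2))
  have bl: "bounded_linear (\<lambda>x. \<i> * of_real x)" by (intro bounded_linear_const_mult bounded_linear_of_real)
  have "indef_integral (\<lambda>x. of_real (Re (f x)) + \<i> * of_real (Im (f x))) (\<lambda>x. of_real (g1 x) + \<i> * of_real (g2 x))"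
    by (intro indef_integral_add indef_integral_linear[OF g1 bounded_linear_of_real] indef_integral_linear[OF g2 bl])
  then show ?thesis by (auto simp flip: complex_eq)
qed

lemma indef_integral_cong_negligible:
  assumes f: "indef_integral f g" and N: "negligible N" and eq: "\<And>x. 0 < x \<Longrightarrow> x < 1 \<Longrightarrow> x \<notin> N \<Longrightarrow> g' x = g x"
  shows "indef_integral f g'"
proof -
  have N': "negligible (N \<union> {0, 1})" using N by (intro negligible_Un) auto
  have eq': "g' x = g x" if "x \<in> {0..1} - (N \<union> {0, 1})" for x using that eq[of x] by auto
  have "g absolutely_integrable_on {0..1}" using f by (simp add: indef_integral_def)
  from absolutely_integrable_spike[OF this N' eq'] have "g' absolutely_integrable_on {0..1}" .
  moreover have "(g' has_integral (f x - f 0)) {0..x}" if x: "x \<in> {0..1}" for x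
  proof (rule has_integral_spike[OF N'])
    show "(g has_integral (f x - f 0)) {0..x}" using f x by (simp add: indef_integral_def)
    show "g' y = g y" if "y \<in> {0..x} - (N \<union> {0, 1})" for y using that x by (intro eq') auto
  qed
  ultimately show ?thesis by (simp add: indef_integral_def)
qed

text \<open>Integrands are unique up to null sets because each is the derivative almost everywhere.
  Product and chain rule thereby reduce to their pointwise forms.\<close>

lemma abs_cont_derivative_indef_integral:
  fixes f :: "real \<Rightarrow> complex"
  assumes f: "abs_cont f" and N: "negligible N"
    and d: "\<And>x. 0 < x \<Longrightarrow> x < 1 \<Longrightarrow> x \<notin> N \<Longrightarrow> (f has_vector_derivative g x) (at x)"
  shows "indef_integral f g"
proof -
  obtain g' where g': "indef_integral f g'" using abs_cont_indef_integral[OF f] by blast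
  obtain N' where N': "negligible N'" "\<And>x. 0 < x \<Longrightarrow> x < 1 \<Longrightarrow> x \<notin> N' \<Longrightarrow> (f has_vector_derivative g' x) (at x)"
    using indef_integral_derivative[OF g'] by blast
  show ?thesis
  proof (rule indef_integral_cong_negligible[OF g' negligible_Un[OF N N'(1)]])
    fix x :: real assume "0 < x" "x < 1" "x \<notin> N \<union> N'"
    then show "g x = g' x" using d[of x] N'(2)[of x] vector_derivative_unique_at by auto
  qed
qed

section \<open>Product rule, exponentials and Gronwall's inequality\<close>

lemma indef_integral_continuous: "indef_integral f g \<Longrightarrow> continuous_on {0..1} f"
  by (intro abs_cont_continuous indef_integral_abs_cont)

lemma abs_cont_mult:
  fixes f g :: "real \<Rightarrow> complex"
  assumes f: "abs_cont f" and g: "abs_cont g" shows "abs_cont (\<lambda>x. f x * g x)"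
proof -
  have bdd: "\<exists>M>0. \<forall>x\<in>{0..1}. norm (h x) \<le> M" if "abs_cont h" for h :: "real \<Rightarrow> complex"
    using compact_imp_bounded[OF compact_continuous_image[OF abs_cont_continuous[OF that] compact_Icc]]
    unfolding bounded_pos by blast
  obtain M where M: "0 < M" "\<And>x. x \<in> {0..1} \<Longrightarrow> norm (f x) \<le> M" using bdd[OF f] by blast
  obtain L where L: "0 < L" "\<And>x. x \<in> {0..1} \<Longrightarrow> norm (g x) \<le> L" using bdd[OF g] by blast
  \<comment> \<open>The sum of the two variations, whose increments dominate those of
    \<open>f\<close> and \<open>g\<close> jointly; written as a difference so that
    \<open>abs_cont_diff\<close> applies.\<close>
  let ?V = "\<lambda>x. variation f x - (- variation g x)"
  have "abs_cont (\<lambda>x. - variation g x)"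
    by (rule abs_cont_compose_le[OF abs_cont_variation[OF g] zero_less_one]) auto
  then have V: "abs_cont ?V" by (intro abs_cont_diff abs_cont_variation f)
  show ?thesis
  proof (rule abs_cont_compose_le[OF V])
    show "0 < M + L" using M L by simp
    fix x y :: real assume xy: "0 \<le> x" "x \<le> y" "y \<le> 1"
    have "f y * g y - f x * g x = f y * (g y - g x) + (f y - f x) * g x" by (simp add: algebra_simps)
    also have "norm \<dots> \<le> norm (f y) * norm (g y - g x) + norm (f y - f x) * norm (g x)"
      by (metis norm_mult norm_triangle_ineq)
    also have "\<dots> \<le> (M + L) * norm (g y - g x) + norm (f y - f x) * (M + L)"
      using M(2)[of y] L(2)[of x] M(1) L(1) xy by (intro add_mono mult_mono) auto
    also have "\<dots> = (M + L) * (norm (g y - g x) + norm (f y - f x))" by (simp add: algebra_simps)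
    also have "\<dots> \<le> (M + L) * norm (?V y - ?V x)"
      using variation_increment_ge[OF f xy] variation_increment_ge[OF g xy] M L
      by (intro mult_left_mono) auto
    finally show "norm (f y * g y - f x * g x) \<le> (M + L) * norm (?V y - ?V x)" .
  qed
qed

lemma indef_integral_mult:
  fixes f g :: "real \<Rightarrow> complex"
  assumes f: "indef_integral f f'" and g: "indef_integral g g'"
  shows "indef_integral (\<lambda>x. f x * g x) (\<lambda>x. f' x * g x + f x * g' x)"
proof -
  obtain N where N: "negligible N" "\<And>x. 0 < x \<Longrightarrow> x < 1 \<Longrightarrow> x \<notin> N \<Longrightarrow> (f has_vector_derivative f' x) (at x)"
    using indef_integral_derivative[OF f] by blast
  obtain N' where N': "negligible N'" "\<And>x. 0 < x \<Longrightarrow> x < 1 \<Longrightarrow> x \<notin> N' \<Longrightarrow> (g has_vector_derivative g' x) (at x)"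
    using indef_integral_derivative[OF g] by blast
  show ?thesis
  proof (rule abs_cont_derivative_indef_integral[OF _ negligible_Un[OF N(1) N'(1)]])
    show "abs_cont (\<lambda>x. f x * g x)" using f g by (intro abs_cont_mult indef_integral_abs_cont)
    fix x :: real assume "0 < x" "x < 1" "x \<notin> N \<union> N'"
    then show "((\<lambda>x. f x * g x) has_vector_derivative f' x * g x + f x * g' x) (at x)"
      using N(2)[of x] N'(2)[of x] by (auto intro!: derivative_eq_intros)
  qed
qed

lemma indef_integral_exp:
  fixes f :: "real \<Rightarrow> complex"
  assumes f: "indef_integral f f'"
  shows "indef_integral (\<lambda>x. exp (f x)) (\<lambda>x. f' x * exp (f x))"
proof -
  obtain N where N: "negligible N" "\<And>x. 0 < x \<Longrightarrow> x < 1 \<Longrightarrow> x \<notin> N \<Longrightarrow> (f has_vector_derivative f' x) (at x)"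
    using indef_integral_derivative[OF f] by blast
  have fa: "abs_cont f" using f by (rule indef_integral_abs_cont)
  obtain M where M: "\<And>x. x \<in> {0..1} \<Longrightarrow> norm (f x) \<le> M"
    using compact_imp_bounded[OF compact_continuous_image[OF abs_cont_continuous[OF fa] compact_Icc]]
    unfolding bounded_pos by blast
  show ?thesis
  proof (rule abs_cont_derivative_indef_integral[OF _ N(1)])
    \<comment> \<open>On the disc of radius \<open>M\<close>, which contains the values of
      \<open>f\<close>, the exponential has Lipschitz constant \<open>exp M\<close>.\<close>
    show "abs_cont (\<lambda>x. exp (f x))"
    proof (rule abs_cont_compose_le[OF fa])
      show "0 < exp M" by simp
      fix x y :: real assume xy: "0 \<le> x" "x \<le> y" "y \<le> 1"
      show "norm (exp (f y) - exp (f x)) \<le> exp M * norm (f y - f x)"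
      proof (rule field_differentiable_bound[of "cball 0 M" exp exp])
        show "(exp has_field_derivative exp z) (at z within cball 0 M)" for z :: complex
          by (rule DERIV_subset[OF DERIV_exp]) simp
        show "norm (exp z) \<le> exp M" if "z \<in> cball 0 M" for z :: complex
        proof -
          have "norm (exp z) \<le> exp (norm z)" by (rule norm_exp)
          also have "\<dots> \<le> exp M" using that by simp
          finally show ?thesis .
        qed
      qed (use M xy in auto)
    qed
    fix x :: real assume x: "0 < x" "x < 1" "x \<notin> N"
    have "(exp has_field_derivative exp (f x)) (at (f x))" by (rule DERIV_exp)
    from field_vector_diff_chain_at[OF N(2)[OF x] this]
    show "((\<lambda>x. exp (f x)) has_vector_derivative f' x * exp (f x)) (at x)" by (simp add: o_def)
  qed
qed

lemma indef_integral_mult_real: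
  fixes f g :: "real \<Rightarrow> real"
  assumes f: "indef_integral f f'" and g: "indef_integral g g'"
  shows "indef_integral (\<lambda>x. f x * g x) (\<lambda>x. f' x * g x + f x * g' x)"
  using indef_integral_linear[OF indef_integral_mult[OF indef_integral_linear[OF f bounded_linear_of_real]
        indef_integral_linear[OF g bounded_linear_of_real]] bounded_linear_Re] by simp

lemma indef_integral_exp_real:
  fixes f :: "real \<Rightarrow> real"
  assumes f: "indef_integral f f'"
  shows "indef_integral (\<lambda>x. exp (f x)) (\<lambda>x. f' x * exp (f x))"
  using indef_integral_linear[OF indef_integral_exp[OF indef_integral_linear[OF f bounded_linear_of_real]] bounded_linear_Re]
  by (simp add: exp_of_real)

lemma indef_integral_mono:
  fixes f g :: "real \<Rightarrow> real"
  assumes f: "indef_integral f g" and "\<And>x. 0 \<le> x \<Longrightarrow> x \<le> 1 \<Longrightarrow> 0 \<le> g x" "0 \<le> a" "a \<le> b" "b \<le> 1"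
  shows "f a \<le> f b"
  using has_integral_nonneg[OF indef_integral_has_integral[OF f assms(3-5)]] assms by auto

text \<open>The product \<open>N x * exp (K x)\<close> is nondecreasing because its integrand
  \<open>(n + k N) exp K\<close> is nonnegative. Read forwards this keeps a positive
  \<open>N\<close> from vanishing; read backwards from \<open>1\<close> it makes a vanishing
  \<open>N\<close> vanish everywhere.\<close>

lemma Gronwall:
  fixes N n K k :: "real \<Rightarrow> real"
  assumes N: "indef_integral N n" and K: "indef_integral K k"
    and nk: "\<And>x. 0 \<le> x \<Longrightarrow> x \<le> 1 \<Longrightarrow> \<bar>n x\<bar> \<le> k x * N x" and xy: "0 \<le> x" "x \<le> y" "y \<le> 1"
  shows "N x * exp (K x) \<le> N y * exp (K y)"
proof -
  have "0 \<le> n x * exp (K x) + N x * (k x * exp (K x))" if "0 \<le> x" "x \<le> 1" for x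
  proof -
    have "0 \<le> (n x + k x * N x) * exp (K x)" using nk[OF that] by (intro mult_nonneg_nonneg) auto
    then show ?thesis by (simp add: algebra_simps)
  qed
  then show ?thesis
    using indef_integral_mono[OF indef_integral_mult_real[OF N indef_integral_exp_real[OF K]] _ xy] by blast
qed

section \<open>The transformation kernel\<close>

lemma borel_measurable_cnj [measurable (raw)]:
  "f \<in> borel_measurable M \<Longrightarrow> (\<lambda>x. cnj (f x)) \<in> borel_measurable M"
  by (rule measurable_compose[OF _ borel_measurable_continuous_onI]) (auto intro!: continuous_intros)

lemma unit_integral_has_integral:
  fixes g :: "real \<Rightarrow> 'a::euclidean_space"
  assumes [measurable]: "g \<in> borel_measurable borel" and g: "integrable unit_lborel g"
  shows "g absolutely_integrable_on {0..1}"
    and "\<And>x. 0 \<le> x \<Longrightarrow> x \<le> 1 \<Longrightarrow> (g has_integral (\<integral>s. (if s < x then g s else 0) \<partial>unit_lborel)) {0..x}"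
proof -
  have gi: "set_integrable lborel {0<..<1} g"
    using g by (simp add: integral_unit_lborel set_integrable_def)
  then have "set_integrable lebesgue {0<..<1} g"
    unfolding set_integrable_def by (subst integrable_completion) auto
  then have "g absolutely_integrable_on {0<..<1}" by simp
  then show "g absolutely_integrable_on {0..1}"
    by (rule absolutely_integrable_spike_set) (rule negligible_subset[of "{0, 1}"]; auto)+
  fix x :: real assume x: "0 \<le> x" "x \<le> 1"
  have "set_integrable lborel {0<..<x} g" by (rule set_integrable_subset[OF gi]) (use x in auto)
  from set_borel_integral_eq_integral[OF this]
  have "(g has_integral (LINT s:{0<..<x}|lborel. g s)) {0<..<x}" by (simp add: has_integral_integral)
  moreover have "(\<integral>s. (if s < x then g s else 0) \<partial>unit_lborel) = (LINT s:{0<..<x}|lborel. g s)"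
    unfolding set_lebesgue_integral_def
    by (subst integral_unit_lborel) (use x in \<open>auto simp: indicator_def intro!: Bochner_Integration.integral_cong\<close>)
  ultimately show "(g has_integral (\<integral>s. (if s < x then g s else 0) \<partial>unit_lborel)) {0..x}"
    using has_integral_Icc_iff_Ioo[of g _ 0 x] by simp
qed

lemma unit_indef_integral:
  fixes g :: "real \<Rightarrow> 'a::euclidean_space"
  assumes [measurable]: "g \<in> borel_measurable borel" and g: "integrable unit_lborel g"
  shows "indef_integral (\<lambda>x. c + (\<integral>s. (if s < x then g s else 0) \<partial>unit_lborel)) g"
proof -
  have "AE s in unit_lborel. \<not> s < 0" by (simp add: AE_unit_lborel)
  then have "(\<integral>s. (if s < 0 then g s else 0) \<partial>unit_lborel) = 0" by (intro integral_eq_zero_AE) auto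
  then show ?thesis using unit_integral_has_integral[OF assms] by (simp add: indef_integral_def)
qed

lemma indef_integral_power:
  fixes f :: "real \<Rightarrow> real"
  assumes "indef_integral f g"
  shows "indef_integral (\<lambda>x. f x ^ Suc m) (\<lambda>x. real (Suc m) * f x ^ m * g x)"
proof (induction m)
  case (Suc m)
  from indef_integral_mult_real[OF Suc assms]
  show ?case by (simp add: algebra_simps)
qed (use assms in simp)

lemma unit_lborel_reflect_below:
  fixes h :: "real \<Rightarrow> ennreal"
  assumes [measurable]: "h \<in> borel_measurable borel" and s: "0 < s" "s < 1"
  shows "(\<integral>\<^sup>+r. (if r < s then h (s - r) else 0) \<partial>unit_lborel) = (\<integral>\<^sup>+t. (if t < s then h t else 0) \<partial>unit_lborel)"
proof -
  have "(\<integral>\<^sup>+r. (if r < s then h (s - r) else 0) \<partial>unit_lborel) = (\<integral>\<^sup>+r. (if r < s then h (s - r) else 0) * indicator {0<..<1} r \<partial>lborel)"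
    by (intro nn_integral_unit_lborel) measurable
  also have "\<dots> = (\<integral>\<^sup>+t. (if t < s then h t else 0) * indicator {0<..<1} t \<partial>lborel)"
    by (subst nn_integral_real_affine[of _ "-1" s]) (use s in \<open>auto simp: indicator_def intro!: nn_integral_cong\<close>)
  also have "\<dots> = (\<integral>\<^sup>+t. (if t < s then h t else 0) \<partial>unit_lborel)"
    by (intro nn_integral_unit_lborel[symmetric]) measurable
  finally show ?thesis .
qed

lemma unit_lborel_reflect_below_integral:
  fixes h :: "real \<Rightarrow> complex"
  assumes [measurable]: "h \<in> borel_measurable borel" and s: "0 < s" "s < 1"
  shows "(\<integral>r. (if r < s then h (s - r) else 0) \<partial>unit_lborel) = (\<integral>t. (if t < s then h t else 0) \<partial>unit_lborel)"
proof -
  have "(\<integral>r. (if r < s then h (s - r) else 0) \<partial>unit_lborel) = (\<integral>r. indicator {0<..<1} r *\<^sub>R (if r < s then h (s - r) else 0) \<partial>lborel)"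
    by (intro integral_unit_lborel) measurable
  also have "\<dots> = (\<integral>t. indicator {0<..<1} t *\<^sub>R (if t < s then h t else 0) \<partial>lborel)"
    by (subst lborel_integral_real_affine[of "-1" _ s]) (use s in \<open>auto simp: indicator_def intro!: Bochner_Integration.integral_cong\<close>)
  also have "\<dots> = (\<integral>t. (if t < s then h t else 0) \<partial>unit_lborel)"
    by (intro integral_unit_lborel[symmetric]) measurable
  finally show ?thesis .
qed

definition wave :: "real \<Rightarrow> real \<Rightarrow> complex" where
  "wave l x = exp (\<i> * of_real (- 2 * l * x))"

lemma wave_measurable [measurable]: "wave l \<in> borel_measurable borel"
  unfolding wave_def by measurable

lemma norm_wave [simp]: "norm (wave l x) = 1"
  by (simp add: wave_def)

lemma wave_diff: "wave l (x - y) = wave l x * cnj (wave l y)"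
  by (simp add: wave_def exp_cnj algebra_simps flip: exp_add)

text \<open>The equation \<open>z' = - \<i> q(x) exp (- 2 \<i> l x) cnj z\<close> with \<open>z(0) = 1\<close> is solved by successive
  approximation. The \<open>m\<close>-th term of the resulting series is the Fourier transform of a kernel which
  does not depend on \<open>l\<close>.\<close>

locale dirac_kernel =
  fixes p P :: real and q :: "real \<Rightarrow> complex"
  assumes p: "1 \<le> p" and q: "Lp_le p P q"
begin

lemma q_measurable [measurable]: "q \<in> borel_measurable borel"
  using q by (rule Lp_le_measurable)

lemma P_pos: "0 < P" using q by (rule Lp_le_pos)

lemma q_integrable: "integrable unit_lborel q"
  using Lp_le_L1[OF p q] by simp

section \<open>Kernels of the iterated integrals and their norms\<close>

definition mass :: "real \<Rightarrow> real" where
  "mass x = (\<integral>s. (if s < x then norm (q s) else 0) \<partial>unit_lborel)"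

lemma q_below_integrable: "integrable unit_lborel (\<lambda>s. if s < x then norm (q s) else 0)"
  by (rule Bochner_Integration.integrable_bound[OF q_integrable]) auto

lemma mass_nonneg: "0 \<le> mass x"
  unfolding mass_def by (intro integral_nonneg_AE) auto

lemma mass_le: "mass x \<le> mass 1"
proof -
  have "(\<integral>s. (if s < x then norm (q s) else 0) \<partial>unit_lborel) \<le> (\<integral>s. (if s < 1 then norm (q s) else 0) \<partial>unit_lborel)"
  proof (rule integral_mono_AE)
    show "AE s in unit_lborel. (if s < x then norm (q s) else 0) \<le> (if s < 1 then norm (q s) else 0)"
      by (simp add: AE_unit_lborel)
  qed (rule q_below_integrable)+
  then show ?thesis by (simp add: mass_def)
qed

lemma mass_indef_integral: "indef_integral mass (\<lambda>s. norm (q s))"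
  using unit_indef_integral[of "\<lambda>s. norm (q s)" 0] q_integrable unfolding mass_def[abs_def] by simp

lemma mass_measurable [measurable]: "mass \<in> borel_measurable borel"
  unfolding mass_def by measurable

text \<open>As \<open>norm (q s)\<close> is the derivative of \<open>mass\<close>, the integrand has
  the primitive \<open>mass s ^ Suc m / real (Suc m)\<close>. Iterating this produces the
  factorials.\<close>

lemma nn_integral_mass_power:
  assumes x: "0 \<le> x" "x \<le> 1"
  shows "(\<integral>\<^sup>+s. ennreal (if s < x then norm (q s) * mass s ^ m else 0) \<partial>unit_lborel) = ennreal (mass x ^ Suc m / real (Suc m))"
proof -
  let ?g = "\<lambda>s. norm (q s) * mass s ^ m"
  have ig: "integrable unit_lborel ?g"
  proof (rule Bochner_Integration.integrable_bound)
    show "integrable unit_lborel (\<lambda>s. norm (q s) * mass 1 ^ m)" using q_integrable by simp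
    show "AE s in unit_lborel. norm (?g s) \<le> norm (norm (q s) * mass 1 ^ m)"
      using mass_nonneg mass_le by (auto simp: abs_mult power_abs intro!: mult_left_mono power_mono)
  qed measurable
  then have ib: "integrable unit_lborel (\<lambda>s. if s < x then ?g s else 0)"
    by (rule Bochner_Integration.integrable_bound) auto
  have "(?g has_integral (\<integral>s. (if s < x then ?g s else 0) \<partial>unit_lborel)) {0..x}"
    using ig x by (intro unit_integral_has_integral) auto
  moreover have "((\<lambda>s. real (Suc m) * mass s ^ m * norm (q s)) has_integral (mass x ^ Suc m - mass 0 ^ Suc m)) {0..x}"
    using indef_integral_power[OF mass_indef_integral, of m] x by (auto simp: indef_integral_def)
  then have "((\<lambda>s. (1 / real (Suc m)) * (real (Suc m) * mass s ^ m * norm (q s))) has_integral ((1 / real (Suc m)) * (mass x ^ Suc m - mass 0 ^ Suc m))) {0..x}"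
    by (rule has_integral_mult_right)
  moreover have "mass 0 = 0"
  proof -
    have "AE s in unit_lborel. (if s < 0 then norm (q s) else 0) = 0" by (simp add: AE_unit_lborel)
    then show ?thesis unfolding mass_def by (rule integral_eq_zero_AE)
  qed
  ultimately have "(\<integral>s. (if s < x then ?g s else 0) \<partial>unit_lborel) = mass x ^ Suc m / real (Suc m)"
    by (auto simp: mult_ac simp del: of_nat_Suc dest: has_integral_unique)
  then show ?thesis
    using ib mass_nonneg by (subst nn_integral_eq_integral) auto
qed

text \<open>If \<open>cnj\<close> of the transform of \<open>kernel m s\<close> is multiplied by
  \<open>wave l s\<close>, the phases combine to \<open>wave l (s - t)\<close>. The substitution
  \<open>r = s - t\<close> restores a transform in \<open>r\<close>; this explains the argument
  \<open>s - r\<close>, the conjugate and the condition \<open>r < s\<close>.\<close>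

fun kernel :: "nat \<Rightarrow> real \<Rightarrow> real \<Rightarrow> complex" where
  "kernel 0 x r = (if r < x then - \<i> * q r else 0)"
| "kernel (Suc m) x r = - \<i> * (\<integral>s. (if r < s \<and> s < x then q s * cnj (kernel m s (s - r)) else 0) \<partial>unit_lborel)"

lemma kernel_measurable: "(\<lambda>(x, r). kernel m x r) \<in> borel_measurable (borel \<Otimes>\<^sub>M borel)"
proof (induction m)
  case 0
  show ?case by simp
next
  case (Suc m)
  have [measurable (raw)]: "(\<lambda>w. kernel m (f w) (g w)) \<in> borel_measurable M"
    if "f \<in> borel_measurable M" "g \<in> borel_measurable M" for M :: "((real \<times> real) \<times> real) measure" and f g
    using measurable_compose[OF measurable_Pair[OF that] Suc] by simp
  show ?case unfolding kernel.simps by measurable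
qed

lemma kernel_measurable' [measurable (raw)]:
  assumes "f \<in> borel_measurable M" "g \<in> borel_measurable M"
  shows "(\<lambda>w. kernel m (f w) (g w)) \<in> borel_measurable M"
  using measurable_compose[OF measurable_Pair[OF assms] kernel_measurable] by simp

lemma kernel_eq_0: "x \<le> r \<Longrightarrow> kernel m x r = 0"
proof (cases m)
  case (Suc k)
  assume "x \<le> r"
  then have "(r < s \<and> s < x) = False" for s by auto
  then show ?thesis unfolding Suc kernel.simps by (simp only: if_False) simp
qed simp

text \<open>Jensen with weight \<open>norm (q s)\<close> below \<open>x\<close>, Tonelli, the
  reflection of \<open>r\<close> to \<open>s - r\<close> and the induction hypothesis leave the
  integral of \<open>nn_integral_mass_power\<close>. The factorial appears under the p-th power, so
  norms decay like its p-th root.\<close>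

lemma kernel_powr_bound:
  assumes "0 \<le> x" "x \<le> 1"
  shows "(\<integral>\<^sup>+r. ennreal (norm (kernel m x r) powr p) \<partial>unit_lborel)
    \<le> ennreal (P powr p * (mass 1 powr (p - 1)) ^ m * (mass x ^ m / fact m))"
  using assms
proof (induction m arbitrary: x)
  case 0
  have "(\<integral>\<^sup>+r. ennreal (norm (kernel 0 x r) powr p) \<partial>unit_lborel) \<le> (\<integral>\<^sup>+r. ennreal (norm (q r) powr p) \<partial>unit_lborel)"
    by (intro nn_integral_mono) (auto simp: norm_mult)
  also have "\<dots> \<le> ennreal (P powr p)" using q by (simp add: Lp_le_def)
  finally show ?case by simp
next
  case (Suc m)
  let ?c = "P powr p * (mass 1 powr (p - 1)) ^ m"
  let ?w = "\<lambda>s. if s < x then norm (q s) else 0"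
  have "(\<integral>\<^sup>+r. ennreal (norm (kernel (Suc m) x r) powr p) \<partial>unit_lborel)
    \<le> (\<integral>\<^sup>+r. ennreal (mass 1 powr (p - 1)) * (\<integral>\<^sup>+s. ennreal (?w s * (if r < s then norm (kernel m s (s - r)) else 0) powr p) \<partial>unit_lborel) \<partial>unit_lborel)"
  proof (rule nn_integral_mono)
    fix r
    have "ennreal (norm (kernel (Suc m) x r) powr p) = ennreal (norm (\<integral>s. (if r < s \<and> s < x then q s * cnj (kernel m s (s - r)) else 0) \<partial>unit_lborel) powr p)"
      by (simp add: norm_mult)
    also have "\<dots> \<le> ennreal ((\<integral>s. ?w s \<partial>unit_lborel) powr (p - 1)) * (\<integral>\<^sup>+s. ennreal (?w s * (if r < s then norm (kernel m s (s - r)) else 0) powr p) \<partial>unit_lborel)"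
      by (rule norm_integral_powr_le[OF p _ _ q_below_integrable]) (auto simp: norm_mult)
    also have "\<dots> \<le> ennreal (mass 1 powr (p - 1)) * (\<integral>\<^sup>+s. ennreal (?w s * (if r < s then norm (kernel m s (s - r)) else 0) powr p) \<partial>unit_lborel)"
      unfolding mass_def[symmetric] using mass_nonneg mass_le p by (intro mult_right_mono ennreal_leI powr_mono2) auto
    finally show "ennreal (norm (kernel (Suc m) x r) powr p) \<le> \<dots>" .
  qed
  also have "\<dots> = ennreal (mass 1 powr (p - 1)) * (\<integral>\<^sup>+r. (\<integral>\<^sup>+s. ennreal (?w s * (if r < s then norm (kernel m s (s - r)) else 0) powr p) \<partial>unit_lborel) \<partial>unit_lborel)"
    by (intro nn_integral_cmult) measurable
  also have "(\<integral>\<^sup>+r. (\<integral>\<^sup>+s. ennreal (?w s * (if r < s then norm (kernel m s (s - r)) else 0) powr p) \<partial>unit_lborel) \<partial>unit_lborel)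
    = (\<integral>\<^sup>+s. (\<integral>\<^sup>+r. ennreal (?w s * (if r < s then norm (kernel m s (s - r)) else 0) powr p) \<partial>unit_lborel) \<partial>unit_lborel)"
    by (intro unit_lborel2.Fubini') measurable
  also have "\<dots> \<le> (\<integral>\<^sup>+s. ennreal ?c / ennreal (fact m) * ennreal (if s < x then norm (q s) * mass s ^ m else 0) \<partial>unit_lborel)"
  proof (rule nn_integral_mono_AE)
    have "(\<integral>\<^sup>+r. ennreal (?w s * (if r < s then norm (kernel m s (s - r)) else 0) powr p) \<partial>unit_lborel)
       \<le> ennreal ?c / ennreal (fact m) * ennreal (if s < x then norm (q s) * mass s ^ m else 0)" if s: "0 < s" "s < 1" for s
    proof -
      have "(\<integral>\<^sup>+r. ennreal (?w s * (if r < s then norm (kernel m s (s - r)) else 0) powr p) \<partial>unit_lborel)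
        = (\<integral>\<^sup>+r. ennreal (?w s) * (if r < s then ennreal (norm (kernel m s (s - r)) powr p) else 0) \<partial>unit_lborel)"
        using p by (intro nn_integral_cong) (auto simp: ennreal_mult')
      also have "\<dots> = ennreal (?w s) * (\<integral>\<^sup>+r. (if r < s then ennreal (norm (kernel m s (s - r)) powr p) else 0) \<partial>unit_lborel)"
        by (intro nn_integral_cmult) measurable
      also have "(\<integral>\<^sup>+r. (if r < s then ennreal (norm (kernel m s (s - r)) powr p) else 0) \<partial>unit_lborel)
        = (\<integral>\<^sup>+t. (if t < s then ennreal (norm (kernel m s t) powr p) else 0) \<partial>unit_lborel)"
        using s by (intro unit_lborel_reflect_below) auto
      also have "\<dots> = (\<integral>\<^sup>+t. ennreal (norm (kernel m s t) powr p) \<partial>unit_lborel)"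
        using p by (intro nn_integral_cong) (auto simp: kernel_eq_0)
      also have "\<dots> \<le> ennreal (?c * (mass s ^ m / fact m))" using s by (intro Suc.IH) auto
      finally have "(\<integral>\<^sup>+r. ennreal (?w s * (if r < s then norm (kernel m s (s - r)) else 0) powr p) \<partial>unit_lborel)
        \<le> ennreal (?w s) * ennreal (?c * (mass s ^ m / fact m))" by (simp add: mult_left_mono)
      also have "\<dots> = ennreal ?c / ennreal (fact m) * ennreal (if s < x then norm (q s) * mass s ^ m else 0)"
        using mass_nonneg by (auto simp: divide_ennreal field_simps simp flip: ennreal_mult')
      finally show ?thesis .
    qed
    then show "AE s in unit_lborel. (\<integral>\<^sup>+r. ennreal (?w s * (if r < s then norm (kernel m s (s - r)) else 0) powr p) \<partial>unit_lborel)
       \<le> ennreal ?c / ennreal (fact m) * ennreal (if s < x then norm (q s) * mass s ^ m else 0)"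
      by (simp add: AE_unit_lborel)
  qed
  also have "\<dots> = ennreal ?c / ennreal (fact m) * ennreal (mass x ^ Suc m / real (Suc m))"
    unfolding nn_integral_mass_power[OF Suc.prems, symmetric] by (intro nn_integral_cmult) measurable
  also have "ennreal (mass 1 powr (p - 1)) * \<dots> = ennreal (P powr p * (mass 1 powr (p - 1)) ^ Suc m * (mass x ^ Suc m / fact (Suc m)))"
    using mass_nonneg by (simp add: divide_ennreal field_simps flip: ennreal_mult')
  finally show ?case by (simp add: mult_left_mono)
qed

text \<open>A p-th root of the bound just proved, slightly enlarged: \<open>mass 1 + 1\<close>
  instead of \<open>mass 1\<close> keeps the base at least one, so the bound stays positive even for
  vanishing \<open>q\<close>.\<close>

definition kernel_bound :: "nat \<Rightarrow> real" where
  "kernel_bound m = P * (mass 1 + 1) ^ m * (1 / fact m) powr (1 / p)"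

lemma kernel_bound_pos: "0 < kernel_bound m"
  using P_pos mass_nonneg[of 1] by (simp add: kernel_bound_def)

lemma Lp_le_kernel:
  assumes "0 \<le> x" "x \<le> 1" shows "Lp_le p (kernel_bound m) (kernel m x)"
  unfolding Lp_le_def
proof (intro conjI kernel_bound_pos)
  let ?D = "mass 1 + 1"
  have D: "1 \<le> ?D" using mass_nonneg[of 1] by simp
  have "P powr p * (mass 1 powr (p - 1)) ^ m * (mass x ^ m / fact m)
     \<le> P powr p * (?D powr (p - 1)) ^ m * (?D ^ m / fact m)"
    using mass_nonneg mass_le[of x] p P_pos
    by (intro mult_mono divide_right_mono power_mono powr_mono2) (auto intro: add_nonneg_nonneg order_trans)
  also have "\<dots> = P powr p * (?D powr p) ^ m * (1 / fact m)"
  proof -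
    have "?D powr p = ?D powr (p - 1) * ?D" using D by (simp add: powr_diff)
    then show ?thesis by (simp add: power_mult_distrib)
  qed
  also have "\<dots> = kernel_bound m powr p"
  proof -
    have "(?D ^ m) powr p = (?D powr p) ^ m" using D by (simp add: powr_realpow[symmetric] powr_powr mult.commute)
    then show ?thesis using p by (simp add: kernel_bound_def powr_mult powr_powr)
  qed
  finally show "(\<integral>\<^sup>+r. ennreal (norm (kernel m x r) powr p) \<partial>unit_lborel) \<le> ennreal (kernel_bound m powr p)"
    using kernel_powr_bound[OF assms, of m] ennreal_leI order_trans by blast
qed measurable

lemma summable_kernel_bound: "summable kernel_bound"
proof -
  let ?D = "mass 1 + 1"
  have D: "1 \<le> ?D" using mass_nonneg[of 1] by simp
  \<comment> \<open>Consecutive bounds have the quotient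
    \<open>?D / real (Suc m) powr (1 / p)\<close>, which is at most \<open>1 / 2\<close> from here
    on.\<close>
  obtain N :: nat where N: "(2 * ?D) powr p \<le> real N" using real_arch_simple by blast
  show ?thesis
  proof (rule summable_ratio_test[of "1/2" N])
    fix m assume m: "N \<le> m"
    have "(2 * ?D) powr p \<le> real (Suc m)" using N m by linarith
    then have "((2 * ?D) powr p) powr (1 / p) \<le> real (Suc m) powr (1 / p)" using p by (intro powr_mono2) auto
    then have le: "2 * ?D \<le> real (Suc m) powr (1 / p)" using p D by (simp add: powr_powr)
    have "kernel_bound (Suc m) = kernel_bound m * (?D / real (Suc m) powr (1 / p))"
      unfolding kernel_bound_def fact_Suc of_nat_mult powr_divide powr_mult by (simp add: mult_ac del: of_nat_Suc)
    also have "\<dots> \<le> kernel_bound m * (1 / 2)"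
      using le D kernel_bound_pos[of m] by (intro mult_left_mono) (auto simp: divide_le_eq simp del: of_nat_Suc)
    finally show "norm (kernel_bound (Suc m)) \<le> 1 / 2 * norm (kernel_bound m)" using kernel_bound_pos[of m] kernel_bound_pos[of "Suc m"] by simp
  qed simp
qed

text \<open>The terms of the series of successive approximations, not its partial sums. The constant
  first term is not represented by a kernel, so indices are shifted by one against
  \<open>kernel\<close>.\<close>

fun approx :: "real \<Rightarrow> nat \<Rightarrow> real \<Rightarrow> complex" where
  "approx l 0 x = 1"
| "approx l (Suc m) x = (\<integral>r. wave l r * kernel m x r \<partial>unit_lborel)"

lemma approx_measurable [measurable]: "approx l m \<in> borel_measurable borel"
proof (cases m)
  case 0
  then have "approx l m = (\<lambda>x. 1)" by (simp add: fun_eq_iff)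
  then show ?thesis by simp
next
  case (Suc k)
  then have "approx l m = (\<lambda>x. \<integral>r. wave l r * kernel k x r \<partial>unit_lborel)" by (simp add: fun_eq_iff)
  then show ?thesis by simp
qed

lemma norm_approx_Suc_le:
  assumes "0 \<le> x" "x \<le> 1" shows "norm (approx l (Suc m) x) \<le> kernel_bound m"
proof -
  have "norm (approx l (Suc m) x) \<le> (\<integral>r. norm (wave l r * kernel m x r) \<partial>unit_lborel)"
    unfolding approx.simps by (rule integral_norm_bound)
  also have "\<dots> \<le> kernel_bound m" using Lp_le_L1(2)[OF p Lp_le_kernel[OF assms]] by (simp add: norm_mult)
  finally show ?thesis .
qed

text \<open>Fubini in the variables \<open>s\<close> and \<open>r\<close>, followed by the
  reflection of \<open>r\<close> to \<open>s - r\<close>, undoes the construction of the kernels and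
  recovers the recursion of successive approximation.\<close>

lemma approx_Suc:
  assumes x: "0 \<le> x" "x \<le> 1"
  shows "approx l (Suc m) x = (\<integral>s. (if s < x then - \<i> * q s * wave l s * cnj (approx l m s) else 0) \<partial>unit_lborel)"
proof (cases m)
  case 0
  then show ?thesis by (auto intro!: Bochner_Integration.integral_cong)
next
  case (Suc k)
  let ?F = "\<lambda>s r. wave l r * (- \<i> * (if r < s \<and> s < x then q s * cnj (kernel k s (s - r)) else 0))"
  \<comment> \<open>The bound is uniform in \<open>s\<close>, so integrability of \<open>q\<close>
    yields the joint integrability that Fubini needs.\<close>
  have refl: "(\<integral>\<^sup>+r. ennreal (norm (if r < s then kernel k s (s - r) else 0)) \<partial>unit_lborel) \<le> ennreal (kernel_bound k)" if s: "0 < s" "s < 1" for s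
  proof -
    have "(\<integral>\<^sup>+r. ennreal (norm (if r < s then kernel k s (s - r) else 0)) \<partial>unit_lborel) = (\<integral>\<^sup>+r. (if r < s then ennreal (norm (kernel k s (s - r))) else 0) \<partial>unit_lborel)"
      by (intro nn_integral_cong) auto
    also have "\<dots> = (\<integral>\<^sup>+t. (if t < s then ennreal (norm (kernel k s t)) else 0) \<partial>unit_lborel)"
      using s by (intro unit_lborel_reflect_below) auto
    also have "\<dots> = (\<integral>\<^sup>+t. ennreal (norm (kernel k s t)) \<partial>unit_lborel)"
      by (intro nn_integral_cong) (auto simp: kernel_eq_0)
    also have "\<dots> = ennreal (\<integral>t. norm (kernel k s t) \<partial>unit_lborel)"
      using Lp_le_L1(1)[OF p Lp_le_kernel[of s k]] s by (intro nn_integral_eq_integral) auto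
    also have "\<dots> \<le> ennreal (kernel_bound k)" using Lp_le_L1(2)[OF p Lp_le_kernel[of s k]] s by (intro ennreal_leI) auto
    finally show ?thesis .
  qed
  have I: "integrable (unit_lborel \<Otimes>\<^sub>M unit_lborel) (\<lambda>(s, r). ?F s r)"
  proof (rule integrableI_bounded)
    have "(\<integral>\<^sup>+w. ennreal (norm (case w of (s, r) \<Rightarrow> ?F s r)) \<partial>(unit_lborel \<Otimes>\<^sub>M unit_lborel))
      = (\<integral>\<^sup>+s. (\<integral>\<^sup>+r. ennreal (norm (?F s r)) \<partial>unit_lborel) \<partial>unit_lborel)"
      by (subst unit_lborel.nn_integral_fst[symmetric]) auto
    also have "\<dots> \<le> (\<integral>\<^sup>+s. ennreal (norm (q s)) * ennreal (kernel_bound k) \<partial>unit_lborel)"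
    proof (rule nn_integral_mono_AE)
      have "(\<integral>\<^sup>+r. ennreal (norm (?F s r)) \<partial>unit_lborel) \<le> ennreal (norm (q s)) * ennreal (kernel_bound k)" if s: "0 < s" "s < 1" for s
      proof -
        have "(\<integral>\<^sup>+r. ennreal (norm (?F s r)) \<partial>unit_lborel) \<le> (\<integral>\<^sup>+r. ennreal (norm (q s)) * ennreal (norm (if r < s then kernel k s (s - r) else 0)) \<partial>unit_lborel)"
          by (intro nn_integral_mono) (auto simp: norm_mult simp flip: ennreal_mult')
        also have "\<dots> = ennreal (norm (q s)) * (\<integral>\<^sup>+r. ennreal (norm (if r < s then kernel k s (s - r) else 0)) \<partial>unit_lborel)"
          by (intro nn_integral_cmult) measurable
        also have "\<dots> \<le> ennreal (norm (q s)) * ennreal (kernel_bound k)" using s by (intro mult_left_mono refl) auto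
        finally show ?thesis .
      qed
      then show "AE s in unit_lborel. (\<integral>\<^sup>+r. ennreal (norm (?F s r)) \<partial>unit_lborel) \<le> ennreal (norm (q s)) * ennreal (kernel_bound k)"
        by (simp add: AE_unit_lborel)
    qed
    also have "\<dots> = (\<integral>\<^sup>+s. ennreal (norm (q s)) \<partial>unit_lborel) * ennreal (kernel_bound k)"
      by (intro nn_integral_multc) measurable
    also have "(\<integral>\<^sup>+s. ennreal (norm (q s)) \<partial>unit_lborel) = ennreal (\<integral>s. norm (q s) \<partial>unit_lborel)"
      using q_integrable by (intro nn_integral_eq_integral) auto
    also have "\<dots> * ennreal (kernel_bound k) < \<infinity>" by (simp add: ennreal_mult_less_top)
    finally show "(\<integral>\<^sup>+w. ennreal (norm (case w of (s, r) \<Rightarrow> ?F s r)) \<partial>(unit_lborel \<Otimes>\<^sub>M unit_lborel)) < \<infinity>" .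
  qed measurable
  have "approx l (Suc m) x = (\<integral>r. (\<integral>s. ?F s r \<partial>unit_lborel) \<partial>unit_lborel)"
    unfolding Suc approx.simps kernel.simps integral_mult_right_zero by simp
  also have "\<dots> = (\<integral>s. (\<integral>r. ?F s r \<partial>unit_lborel) \<partial>unit_lborel)"
    by (rule unit_lborel2.Fubini_integral[OF I])
  also have "\<dots> = (\<integral>s. (if s < x then - \<i> * q s * wave l s * cnj (approx l m s) else 0) \<partial>unit_lborel)"
  proof (rule integral_cong_AE)
    have "(\<integral>r. ?F s r \<partial>unit_lborel) = (if s < x then - \<i> * q s * wave l s * cnj (approx l m s) else 0)" if s: "0 < s" "s < 1" for s
    proof (cases "s < x")
      case True
      let ?h = "\<lambda>t. wave l (s - t) * cnj (kernel k s t)"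
      have "(\<integral>r. ?F s r \<partial>unit_lborel) = (\<integral>r. (- \<i> * q s) * (if r < s then ?h (s - r) else 0) \<partial>unit_lborel)"
        using True by (intro Bochner_Integration.integral_cong) auto
      also have "\<dots> = (- \<i> * q s) * (\<integral>r. (if r < s then ?h (s - r) else 0) \<partial>unit_lborel)"
        by (rule integral_mult_right_zero)
      also have "(\<integral>r. (if r < s then ?h (s - r) else 0) \<partial>unit_lborel) = (\<integral>t. (if t < s then ?h t else 0) \<partial>unit_lborel)"
        using s by (intro unit_lborel_reflect_below_integral) auto
      also have "\<dots> = (\<integral>t. wave l s * cnj (wave l t * kernel k s t) \<partial>unit_lborel)"
        by (intro Bochner_Integration.integral_cong) (auto simp: kernel_eq_0 wave_diff)
      also have "\<dots> = wave l s * (\<integral>t. cnj (wave l t * kernel k s t) \<partial>unit_lborel)"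
        by (rule integral_mult_right_zero)
      also have "(\<integral>t. cnj (wave l t * kernel k s t) \<partial>unit_lborel) = cnj (approx l m s)"
        unfolding Suc approx.simps by (rule Bochner_Integration.integral_cnj)
      finally show ?thesis using True by simp
    qed auto
    then show "AE s in unit_lborel. (\<integral>r. ?F s r \<partial>unit_lborel) = (if s < x then - \<i> * q s * wave l s * cnj (approx l m s) else 0)"
      by (simp add: AE_unit_lborel)
  qed measurable
  finally show ?thesis .
qed

section \<open>The solution as the sum of the series\<close>

definition sol :: "real \<Rightarrow> real \<Rightarrow> complex" where
  "sol l x = (\<Sum>m. approx l m x)"

lemma approx_bound: "0 \<le> x \<Longrightarrow> x \<le> 1 \<Longrightarrow> norm (approx l m x) \<le> (case m of 0 \<Rightarrow> 1 | Suc k \<Rightarrow> kernel_bound k)"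
  using norm_approx_Suc_le by (cases m) auto

lemma summable_bound: "summable (\<lambda>m. case m of 0 \<Rightarrow> 1 | Suc k \<Rightarrow> kernel_bound k)"
  using summable_kernel_bound by (subst summable_Suc_iff[symmetric]) simp

text \<open>\<open>G\<close> depends on \<open>x\<close> but not on \<open>l\<close>. At
  \<open>x = 1\<close> this makes values at all eigenvalues integrals of one and the same
  function.\<close>

lemma sol_transform:
  assumes x: "0 \<le> x" "x \<le> 1"
  obtains D G where "Lp_le p D G" "\<And>l. sol l x = 1 + (\<integral>r. wave l r * G r \<partial>unit_lborel)"
proof (rule Lp_le_suminf[OF p Lp_le_kernel[OF x] summable_kernel_bound])
  fix G
  assume G: "Lp_le p (suminf kernel_bound) G" and sums: "\<And>\<phi> B. \<phi> \<in> borel_measurable borel \<Longrightarrow> (\<And>x. norm (\<phi> x) \<le> B) \<Longrightarrow>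
       (\<lambda>k. \<integral>r. \<phi> r * kernel k x r \<partial>unit_lborel) sums (\<integral>r. \<phi> r * G r \<partial>unit_lborel)"
  have "sol l x = 1 + (\<integral>r. wave l r * G r \<partial>unit_lborel)" for l
  proof -
    have "(\<lambda>k. approx l (Suc k) x) sums (\<integral>r. wave l r * G r \<partial>unit_lborel)"
      unfolding approx.simps by (rule sums[where B=1]) auto
    then have "(\<lambda>k. approx l k x) sums ((\<integral>r. wave l r * G r \<partial>unit_lborel) + approx l 0 x)" using sums_Suc_iff[of "\<lambda>k. approx l k x"] by blast
    then show ?thesis by (simp add: sol_def sums_iff add.commute)
  qed
  then show ?thesis using that G by blast
qed

text \<open>\<open>approx_Suc\<close> is summed over all terms; the summable bounds times
  \<open>norm (q s)\<close> justify exchanging sum and integral.\<close>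

lemma sol_indef_integral:
  shows "indef_integral (sol l) (\<lambda>s. - \<i> * q s * wave l s * cnj (sol l s))" and "sol l 0 = 1"
proof -
  let ?b = "\<lambda>m. case m of 0 \<Rightarrow> 1 | Suc k \<Rightarrow> kernel_bound k"
  let ?g = "\<lambda>s. - \<i> * q s * wave l s * cnj (sol l s)"
  have [measurable]: "sol l \<in> borel_measurable borel" unfolding sol_def by measurable
  have zsum: "summable (\<lambda>m. norm (approx l m x))" if "0 \<le> x" "x \<le> 1" for x
    using approx_bound[OF that] by (intro summable_comparison_test'[OF summable_bound, of 0]) auto
  have ZI: "(\<lambda>m. approx l (Suc m) x) sums (\<integral>s. (if s < x then ?g s else 0) \<partial>unit_lborel)" if x: "0 \<le> x" "x \<le> 1" for x
  proof -
    let ?f = "\<lambda>m s. if s < x then - \<i> * q s * wave l s * cnj (approx l m s) else 0"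
    have ae: "AE s in unit_lborel. 0 < s \<and> s < 1" by (simp add: AE_unit_lborel)
    have b0: "0 \<le> ?b m" for m using kernel_bound_pos by (auto split: nat.split intro: less_imp_le)
    have fb: "AE s in unit_lborel. norm (?f m s) \<le> norm (q s) * ?b m" for m
      using ae
    proof eventually_elim
      case (elim s)
      then show ?case using approx_bound[of s l m] b0[of m] by (simp add: norm_mult mult_left_mono)
    qed
    have fi: "integrable unit_lborel (?f m)" for m
    proof (rule Bochner_Integration.integrable_bound)
      show "integrable unit_lborel (\<lambda>s. norm (q s) * ?b m)" using q_integrable by (intro integrable_mult_left integrable_norm)
      show "AE s in unit_lborel. norm (?f m s) \<le> norm (norm (q s) * ?b m)" using fb[of m] b0[of m] by (auto simp: abs_mult)
    qed measurable
    have "(\<lambda>m. \<integral>s. ?f m s \<partial>unit_lborel) sums (\<integral>s. (\<Sum>m. ?f m s) \<partial>unit_lborel)"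
    proof (rule sums_integral[OF fi])
      show "AE s in unit_lborel. summable (\<lambda>m. norm (?f m s))"
        using ae
      proof eventually_elim
        case (elim s)
        then have "summable (\<lambda>m. norm (q s) * norm (approx l m s))" by (intro summable_mult zsum) auto
        then show ?case by (cases "s < x") (auto simp: norm_mult)
      qed
      show "summable (\<lambda>m. \<integral>s. norm (?f m s) \<partial>unit_lborel)"
      proof (rule summable_comparison_test'[OF summable_mult[OF summable_bound], of 0])
        fix m
        have "(\<integral>s. norm (?f m s) \<partial>unit_lborel) \<le> (\<integral>s. norm (q s) * ?b m \<partial>unit_lborel)"
          using fb q_integrable by (intro integral_mono_AE integrable_norm fi integrable_mult_left) auto
        also have "\<dots> = (\<integral>s. norm (q s) \<partial>unit_lborel) * ?b m" by (rule integral_mult_left_zero)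
        finally show "norm (\<integral>s. norm (?f m s) \<partial>unit_lborel) \<le> (\<integral>s. norm (q s) \<partial>unit_lborel) * ?b m" by simp
      qed
    qed
    also have "(\<lambda>m. \<integral>s. ?f m s \<partial>unit_lborel) = (\<lambda>m. approx l (Suc m) x)" using approx_Suc[OF x] by simp
    also have "(\<integral>s. (\<Sum>m. ?f m s) \<partial>unit_lborel) = (\<integral>s. (if s < x then ?g s else 0) \<partial>unit_lborel)"
    proof (rule integral_cong_AE)
      show "AE s in unit_lborel. (\<Sum>m. ?f m s) = (if s < x then ?g s else 0)"
        using ae
      proof eventually_elim
        case (elim s)
        then have "(\<lambda>m. approx l m s) sums sol l s" unfolding sol_def by (intro summable_sums summable_norm_cancel[OF zsum]) auto
        then have "(\<lambda>m. - \<i> * q s * wave l s * cnj (approx l m s)) sums ?g s" by (intro sums_mult) (simp add: sums_cnj)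
        then show ?case by (auto simp: sums_iff)
      qed
    qed measurable
    finally show ?thesis .
  qed
  have Zx: "sol l x = 1 + (\<integral>s. (if s < x then ?g s else 0) \<partial>unit_lborel)" if "0 \<le> x" "x \<le> 1" for x
  proof -
    have "(\<lambda>m. approx l m x) sums ((\<integral>s. (if s < x then ?g s else 0) \<partial>unit_lborel) + approx l 0 x)"
      using ZI[OF that] sums_Suc_iff[of "\<lambda>m. approx l m x"] by blast
    then show ?thesis by (simp add: sol_def sums_iff add.commute)
  qed
  have gi: "integrable unit_lborel ?g"
  proof (rule Bochner_Integration.integrable_bound)
    show "integrable unit_lborel (\<lambda>s. norm (q s) * suminf ?b)" using q_integrable by (intro integrable_mult_left integrable_norm)
    have "AE s in unit_lborel. 0 < s \<and> s < 1" by (simp add: AE_unit_lborel)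
    then show "AE s in unit_lborel. norm (?g s) \<le> norm (norm (q s) * suminf ?b)"
    proof eventually_elim
      case (elim s)
      then have "norm (sol l s) \<le> suminf ?b"
        unfolding sol_def by (intro norm_suminf_le approx_bound summable_bound) auto
      then have "norm (?g s) \<le> norm (q s) * suminf ?b" by (simp add: norm_mult mult_left_mono)
      then show ?case by (metis abs_ge_self order_trans real_norm_def)
    qed
  qed measurable
  have I: "indef_integral (\<lambda>x. 1 + (\<integral>s. (if s < x then ?g s else 0) \<partial>unit_lborel)) ?g"
    by (rule unit_indef_integral[OF _ gi]) measurable
  then show "indef_integral (sol l) ?g" unfolding indef_integral_def using Zx by auto
  have "AE s in unit_lborel. \<not> s < 0" by (simp add: AE_unit_lborel)
  then have "(\<integral>s. (if s < 0 then ?g s else 0) \<partial>unit_lborel) = 0" by (intro integral_eq_zero_AE) auto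
  then show "sol l 0 = 1" using Zx[of 0] by simp
qed

end

section \<open>The Pruefer angle\<close>

context dirac_kernel
begin

lemma sol_measurable [measurable]: "sol l \<in> borel_measurable borel"
  unfolding sol_def by measurable

lemma twice_mass_indef_integral: "indef_integral (\<lambda>x. 2 * mass x) (\<lambda>s. 2 * norm (q s))"
  using indef_integral_linear[OF mass_indef_integral bounded_linear_mult_right[of 2]] .

text \<open>The squared modulus starts at one, and its derivative is at most
  \<open>2 * norm (q s)\<close> times itself, so Gronwall's inequality bounds it away from
  zero.\<close>

lemma sol_nonzero:
  assumes x: "0 \<le> x" "x \<le> 1" shows "sol l x \<noteq> 0"
proof -
  let ?g = "\<lambda>s. - \<i> * q s * wave l s * cnj (sol l s)"
  have I: "indef_integral (\<lambda>x. Re (sol l x * cnj (sol l x))) (\<lambda>s. Re (?g s * cnj (sol l s) + sol l s * cnj (?g s)))"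
    by (intro indef_integral_linear[OF _ bounded_linear_Re] indef_integral_mult sol_indef_integral(1)
        indef_integral_linear[OF _ bounded_linear_cnj])
  have N: "Re (sol l s * cnj (sol l s)) = norm (sol l s) ^ 2" for s by (simp add: complex_norm_square[symmetric])
  have "\<bar>Re (?g s * cnj (sol l s) + sol l s * cnj (?g s))\<bar> \<le> 2 * norm (q s) * Re (sol l s * cnj (sol l s))" for s
  proof -
    have "\<bar>Re (?g s * cnj (sol l s) + sol l s * cnj (?g s))\<bar> \<le> norm (?g s * cnj (sol l s) + sol l s * cnj (?g s))"
      by (rule abs_Re_le_cmod)
    also have "\<dots> \<le> norm (?g s * cnj (sol l s)) + norm (sol l s * cnj (?g s))" by (rule norm_triangle_ineq)
    also have "\<dots> = 2 * norm (q s) * norm (sol l s) ^ 2"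
      unfolding norm_mult complex_mod_cnj by (simp add: power2_eq_square)
    finally show ?thesis unfolding N .
  qed
  from Gronwall[OF I twice_mass_indef_integral this order_refl x]
  have "exp (2 * mass 0) \<le> norm (sol l x) ^ 2 * exp (2 * mass x)" unfolding N by (simp add: sol_indef_integral(2))
  then show ?thesis by (metis exp_gt_zero mult_zero_left norm_zero not_le zero_power2)
qed

text \<open>Division by zero gives zero, hence the bound by \<open>norm (q s)\<close> holds on the
  whole line, also where \<open>sol\<close> is not known to be nonzero.\<close>

definition log_deriv :: "real \<Rightarrow> real \<Rightarrow> complex" where
  "log_deriv l s = - \<i> * q s * wave l s * cnj (sol l s) / sol l s"

text \<open>A continuous logarithm of \<open>sol\<close>, obtained by integration so that no branch
  has to be chosen.\<close>

definition log_sol :: "real \<Rightarrow> real \<Rightarrow> complex" where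
  "log_sol l x = (\<integral>s. (if s < x then log_deriv l s else 0) \<partial>unit_lborel)"

lemma log_deriv_measurable [measurable]: "log_deriv l \<in> borel_measurable borel"
  unfolding log_deriv_def by measurable

lemma log_sol_measurable [measurable]: "log_sol l \<in> borel_measurable borel"
  unfolding log_sol_def by measurable

lemma norm_log_deriv_le: "norm (log_deriv l s) \<le> norm (q s)"
  unfolding log_deriv_def by (cases "sol l s = 0") (simp_all add: norm_mult norm_divide)

lemma log_deriv_integrable: "integrable unit_lborel (log_deriv l)"
  by (rule Bochner_Integration.integrable_bound[OF q_integrable]) (use norm_log_deriv_le in auto)

lemma log_sol_indef_integral: "indef_integral (log_sol l) (log_deriv l)"
  using unit_indef_integral[OF log_deriv_measurable log_deriv_integrable, of 0] by (simp add: log_sol_def[abs_def])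

lemma norm_log_sol_le: "norm (log_sol l x) \<le> mass 1"
proof -
  have "norm (log_sol l x) \<le> (\<integral>s. norm (if s < x then log_deriv l s else 0) \<partial>unit_lborel)"
    unfolding log_sol_def by (rule integral_norm_bound)
  also have "\<dots> \<le> (\<integral>s. (if s < x then norm (q s) else 0) \<partial>unit_lborel)"
    by (intro integral_mono q_below_integrable Bochner_Integration.integrable_bound[OF q_integrable])
      (use norm_log_deriv_le in \<open>auto intro: order_trans[OF norm_log_deriv_le]\<close>)
  also have "\<dots> \<le> mass 1" using mass_le by (simp add: mass_def)
  finally show ?thesis .
qed

lemma log_sol_0: "log_sol l 0 = 0"
proof -
  have "AE s in unit_lborel. \<not> s < 0" by (simp add: AE_unit_lborel)
  then show ?thesis unfolding log_sol_def by (intro integral_eq_zero_AE) auto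
qed

text \<open>The product of \<open>sol\<close> with the exponential of minus \<open>log_sol\<close>
  has integrand zero and starts at one.\<close>

lemma sol_eq_exp:
  assumes x: "0 \<le> x" "x \<le> 1" shows "sol l x = exp (log_sol l x)"
proof -
  let ?g = "\<lambda>s. - \<i> * q s * wave l s * cnj (sol l s)"
  have "indef_integral (\<lambda>x. exp (- log_sol l x)) (\<lambda>s. - log_deriv l s * exp (- log_sol l s))"
    by (intro indef_integral_exp indef_integral_linear[OF log_sol_indef_integral bounded_linear_minus[OF bounded_linear_ident]])
  from indef_integral_mult[OF sol_indef_integral(1) this]
  have "((\<lambda>s. ?g s * exp (- log_sol l s) + sol l s * (- log_deriv l s * exp (- log_sol l s))) has_integral
      (sol l x * exp (- log_sol l x) - sol l 0 * exp (- log_sol l 0))) {0..x}"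
    using x unfolding indef_integral_def by auto
  moreover have "?g s * exp (- log_sol l s) + sol l s * (- log_deriv l s * exp (- log_sol l s)) = 0" if "s \<in> {0..x}" for s
    using sol_nonzero[of s l] that x by (simp add: log_deriv_def)
  then have "((\<lambda>s. ?g s * exp (- log_sol l s) + sol l s * (- log_deriv l s * exp (- log_sol l s))) has_integral 0) {0..x}"
    by (intro has_integral_is_0) auto
  ultimately have "sol l x * exp (- log_sol l x) - sol l 0 * exp (- log_sol l 0) = 0" by (rule has_integral_unique)
  then show ?thesis by (simp add: sol_indef_integral(2) log_sol_0 exp_minus field_simps)
qed

definition theta :: "real \<Rightarrow> real \<Rightarrow> real" where
  "theta l x = l * x + Im (log_sol l x)"

abbreviation Theta :: "real \<Rightarrow> real" where
  "Theta l \<equiv> theta l 1"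

lemma theta_measurable [measurable]: "theta l \<in> borel_measurable borel"
  unfolding theta_def by measurable

text \<open>Since \<open>theta' = l + Im log_deriv\<close>, this is the Pruefer equation.\<close>

lemma Im_log_deriv:
  assumes "0 \<le> s" "s \<le> 1"
  shows "Im (log_deriv l s) = - Re (q s * exp (- 2 * \<i> * of_real (theta l s)))"
proof -
  have "cnj (exp (log_sol l s)) / exp (log_sol l s) = exp (- 2 * \<i> * of_real (Im (log_sol l s)))"
  proof -
    have "cnj (log_sol l s) - log_sol l s = - 2 * \<i> * of_real (Im (log_sol l s))" by (simp add: complex_eq_iff)
    then show ?thesis by (simp add: exp_cnj flip: exp_diff)
  qed
  then have "wave l s * (cnj (sol l s) / sol l s) = exp (- 2 * \<i> * of_real (theta l s))"
    unfolding sol_eq_exp[OF assms] by (simp add: wave_def theta_def algebra_simps flip: exp_add)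
  then have "log_deriv l s = - \<i> * (q s * exp (- 2 * \<i> * of_real (theta l s)))"
    unfolding log_deriv_def by (metis (no_types) mult.assoc times_divide_eq_right)
  then show ?thesis by simp
qed

lemma theta_indef_integral: "indef_integral (theta l) (\<lambda>s. l + Im (log_deriv l s))"
proof -
  have "indef_integral (\<lambda>x. l * x) (\<lambda>s. l)"
    unfolding indef_integral_def
  proof (intro conjI ballI)
    fix x :: real assume "x \<in> {0..1}"
    then show "((\<lambda>s. l) has_integral (l * x - l * 0)) {0..x}" using has_integral_const_real[of l 0 x] by (simp add: mult.commute)
  qed (rule absolutely_integrable_on_const, simp)
  from indef_integral_add[OF this indef_integral_linear[OF log_sol_indef_integral bounded_linear_Im]]
  show ?thesis by (simp add: theta_def[abs_def])
qed

lemma norm_exp_diff_le: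
  fixes a b :: real
  shows "norm (exp (- 2 * \<i> * of_real a) - exp (- 2 * \<i> * of_real b)) \<le> 2 * \<bar>a - b\<bar>"
proof -
  have "exp (- 2 * \<i> * of_real a) - exp (- 2 * \<i> * of_real b) = exp (- 2 * \<i> * of_real b) * (exp (\<i> * of_real (2 * (b - a))) - 1)"
    by (simp add: algebra_simps flip: exp_add)
  also have "norm \<dots> = 2 * \<bar>sin (2 * (b - a) / 2)\<bar>" unfolding norm_mult dist_exp_i_1 by simp
  also have "\<dots> \<le> 2 * \<bar>2 * (b - a) / 2\<bar>" by (intro mult_left_mono abs_sin_x_le_abs_x) simp
  also have "2 * (b - a) / 2 = b - a" by simp
  finally show ?thesis by (simp only: abs_minus_commute)
qed

text \<open>The difference \<open>\<eta>\<close> of two angles solves the linear equation with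
  forcing \<open>l' - l\<close> and coefficient \<open>A\<close> bounded by
  \<open>2 * norm (q s)\<close>. The integrating factor costs \<open>2 * mass 1\<close> in the
  exponent under the integral and again at the endpoint, hence the \<open>4\<close>. The lower bound
  yields monotonicity, the upper one continuity.\<close>

lemma Theta_increment:
  assumes l: "l < l'"
  shows "(l' - l) * exp (- 4 * mass 1) \<le> Theta l' - Theta l"
    and "Theta l' - Theta l \<le> (l' - l) * exp (4 * mass 1)"
proof -
  define \<eta> where "\<eta> x = theta l' x - theta l x" for x
  define b where "b s = Im (log_deriv l' s) - Im (log_deriv l s)" for s
  \<comment> \<open>Where \<open>\<eta>\<close> vanishes the quotient is zero by convention;
    \<open>b\<close> vanishes there too, so \<open>b s = \<eta> s * A s\<close> holds
    throughout.\<close>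
  define A where "A s = (if 0 \<le> s \<and> s \<le> 1 then b s / \<eta> s else 0)" for s
  define I where "I x = (\<integral>s. (if s < x then A s else 0) \<partial>unit_lborel)" for x
  have [measurable]: "\<eta> \<in> borel_measurable borel" "b \<in> borel_measurable borel" unfolding \<eta>_def b_def by measurable
  then have [measurable]: "A \<in> borel_measurable borel" unfolding A_def by measurable
  have \<eta>: "indef_integral \<eta> (\<lambda>s. (l' - l) + b s)"
    using indef_integral_add[OF theta_indef_integral[of l'] indef_integral_linear[OF theta_indef_integral[of l] bounded_linear_minus[OF bounded_linear_ident]]]
    by (simp add: \<eta>_def[abs_def] b_def[abs_def] algebra_simps)
  have b_le: "\<bar>b s\<bar> \<le> 2 * norm (q s) * \<bar>\<eta> s\<bar>" if "0 \<le> s" "s \<le> 1" for s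
  proof -
    have "b s = Re (q s * (exp (- 2 * \<i> * of_real (theta l s)) - exp (- 2 * \<i> * of_real (theta l' s))))"
      unfolding b_def Im_log_deriv[OF that] by (simp add: algebra_simps)
    then have "\<bar>b s\<bar> \<le> norm (q s) * norm (exp (- 2 * \<i> * of_real (theta l s)) - exp (- 2 * \<i> * of_real (theta l' s)))"
      by (metis abs_Re_le_cmod norm_mult)
    also have "\<dots> \<le> norm (q s) * (2 * \<bar>theta l s - theta l' s\<bar>)"
      by (intro mult_left_mono norm_exp_diff_le) auto
    finally show ?thesis by (simp add: \<eta>_def abs_minus_commute mult_ac)
  qed
  have A_le: "\<bar>A s\<bar> \<le> 2 * norm (q s)" for s
    using b_le[of s] by (cases "\<eta> s = 0") (auto simp: A_def abs_div divide_le_eq)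
  have bA: "b s = \<eta> s * A s" if "0 \<le> s" "s \<le> 1" for s
    using b_le[OF that] that by (cases "\<eta> s = 0") (auto simp: A_def)
  have Ai: "integrable unit_lborel A"
  proof (rule Bochner_Integration.integrable_bound)
    show "integrable unit_lborel (\<lambda>s. 2 * norm (q s))" using q_integrable by simp
  qed (use A_le in auto)
  have I: "indef_integral I A" using unit_indef_integral[OF _ Ai, of 0] by (simp add: I_def[abs_def])
  have I_le: "\<bar>I x\<bar> \<le> 2 * mass 1" for x
  proof -
    have i: "integrable unit_lborel (\<lambda>s. if s < x then A s else 0)"
      by (rule Bochner_Integration.integrable_bound[OF Ai]) auto
    have "\<bar>I x\<bar> \<le> (\<integral>s. \<bar>if s < x then A s else 0\<bar> \<partial>unit_lborel)" unfolding I_def by (rule integral_abs_bound)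
    also have "\<dots> \<le> (\<integral>s. 2 * (if s < x then norm (q s) else 0) \<partial>unit_lborel)"
      using A_le i by (intro integral_mono integrable_mult_right q_below_integrable integrable_abs) auto
    also have "\<dots> = 2 * mass x" unfolding mass_def by (rule integral_mult_right_zero)
    finally show ?thesis using mass_le[of x] by simp
  qed
  have "indef_integral (\<lambda>x. exp (- I x)) (\<lambda>s. - A s * exp (- I s))"
    by (intro indef_integral_exp_real indef_integral_linear[OF I bounded_linear_minus[OF bounded_linear_ident]])
  from indef_integral_mult_real[OF \<eta> this]
  have "((\<lambda>s. ((l' - l) + b s) * exp (- I s) + \<eta> s * (- A s * exp (- I s))) has_integral (\<eta> 1 * exp (- I 1) - \<eta> 0 * exp (- I 0))) {0..1}"
    unfolding indef_integral_def by auto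
  moreover have "\<eta> 0 = 0" by (simp add: \<eta>_def theta_def log_sol_0)
  moreover have "((l' - l) + b s) * exp (- I s) + \<eta> s * (- A s * exp (- I s)) = (l' - l) * exp (- I s)" if "s \<in> {0..1}" for s
    using bA[of s] that by (simp add: algebra_simps)
  ultimately have hi: "((\<lambda>s. (l' - l) * exp (- I s)) has_integral (\<eta> 1 * exp (- I 1))) {0..1}"
    by (subst (asm) has_integral_cong[where g="\<lambda>s. (l' - l) * exp (- I s)"]) auto
  have c: "((\<lambda>s. r) has_integral r) {0..1::real}" for r :: real using has_integral_const_real[of r 0 1] by simp
  have e: "(l' - l) * exp (- (2 * mass 1)) \<le> (l' - l) * exp (- I s)" "(l' - l) * exp (- I s) \<le> (l' - l) * exp (2 * mass 1)" for s
    using I_le[of s] l by (auto intro!: mult_left_mono)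
  have lo: "(l' - l) * exp (- (2 * mass 1)) \<le> \<eta> 1 * exp (- I 1)" and up: "\<eta> 1 * exp (- I 1) \<le> (l' - l) * exp (2 * mass 1)"
    by (rule has_integral_le[OF c hi e(1)] has_integral_le[OF hi c e(2)])+
  have \<eta>1: "\<eta> 1 * exp (- I 1) * exp (I 1) = Theta l' - Theta l" by (simp add: exp_minus \<eta>_def)
  have ei: "exp (- (2 * mass 1)) \<le> exp (I 1)" "exp (I 1) \<le> exp (2 * mass 1)" using I_le[of 1] by auto
  have pos: "0 \<le> (l' - l) * exp (- (2 * mass 1))" "0 \<le> (l' - l) * exp (2 * mass 1)" using l by auto
  have "(l' - l) * exp (- (2 * mass 1)) * exp (- (2 * mass 1)) \<le> \<eta> 1 * exp (- I 1) * exp (I 1)"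
    using pos lo by (intro mult_mono lo ei) auto
  also have "(l' - l) * exp (- (2 * mass 1)) * exp (- (2 * mass 1)) = (l' - l) * exp (- 4 * mass 1)"
    by (simp add: mult.assoc flip: exp_add)
  finally show "(l' - l) * exp (- 4 * mass 1) \<le> Theta l' - Theta l" unfolding \<eta>1 .
  have "\<eta> 1 * exp (- I 1) * exp (I 1) \<le> (l' - l) * exp (2 * mass 1) * exp (2 * mass 1)"
    using pos by (intro mult_mono up ei) auto
  also have "\<dots> = (l' - l) * exp (4 * mass 1)" by (simp add: mult.assoc flip: exp_add)
  finally show "Theta l' - Theta l \<le> (l' - l) * exp (4 * mass 1)" unfolding \<eta>1 .
qed

lemma Theta_strict_mono: "l < l' \<Longrightarrow> Theta l < Theta l'"
proof -
  assume "l < l'"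
  then have "0 < (l' - l) * exp (- 4 * mass 1)" by simp
  then show ?thesis using Theta_increment(1)[OF \<open>l < l'\<close>] by linarith
qed

lemma abs_Theta_diff_le: "\<bar>Theta l - l\<bar> \<le> mass 1"
  using abs_Im_le_cmod[of "log_sol l 1"] norm_log_sol_le[of l 1] by (simp add: theta_def)

lemma Theta_continuous: "continuous_on A Theta"
proof (rule continuous_on_subset[OF _ subset_UNIV], unfold continuous_on_iff, intro ballI allI impI)
  fix l e :: real assume e: "0 < e"
  let ?C = "exp (4 * mass 1)"
  have le: "\<bar>Theta l' - Theta l\<bar> \<le> \<bar>l' - l\<bar> * ?C" for l'
    using Theta_increment(2)[of l l'] Theta_increment(2)[of l' l] Theta_strict_mono[of l l'] Theta_strict_mono[of l' l]
    by (cases l l' rule: linorder_cases) auto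
  show "\<exists>d>0. \<forall>l'\<in>UNIV. dist l' l < d \<longrightarrow> dist (Theta l') (Theta l) < e"
  proof (intro exI[of _ "e / ?C"] conjI ballI impI)
    fix l' assume "dist l' l < e / ?C"
    then have "\<bar>l' - l\<bar> * ?C < e" by (simp add: dist_real_def pos_less_divide_eq)
    then show "dist (Theta l') (Theta l) < e" using le[of l'] by (simp add: dist_real_def)
  qed (use e in simp)
qed

lemma Theta_surj: "\<exists>l. Theta l = c"
proof -
  let ?M = "mass 1"
  have "Theta (c - ?M) \<le> c" "c \<le> Theta (c + ?M)"
    using abs_Theta_diff_le[of "c - ?M"] abs_Theta_diff_le[of "c + ?M"] by linarith+
  moreover have "c - ?M \<le> c + ?M" using mass_nonneg[of 1] by simp
  ultimately show ?thesis using IVT'[OF _ _ _ Theta_continuous, of "c - ?M" c "c + ?M"] by blast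
qed

text \<open>Riemann-Lebesgue for the transform gives \<open>sol \<rightarrow> 1\<close> pointwise.
  Replacing \<open>cnj (sol l s) / sol l s\<close> by one in \<open>log_deriv\<close> thus costs a
  vanishing error by dominated convergence, and what is left is the transform of \<open>q\<close>,
  which vanishes by Riemann-Lebesgue again.\<close>

lemma Theta_limit:
  assumes "0 < \<epsilon>"
  shows "\<exists>M. \<forall>l. M \<le> \<bar>l\<bar> \<longrightarrow> \<bar>Theta l - l\<bar> < \<epsilon>"
proof (rule ccontr)
  assume "\<not> ?thesis"
  \<comment> \<open>Dominated convergence speaks of sequences, so a sequence of counterexamples is
    chosen.\<close>
  then have "\<forall>k::nat. \<exists>l. real k \<le> \<bar>l\<bar> \<and> \<epsilon> \<le> \<bar>Theta l - l\<bar>" by (metis not_le)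
  then obtain l where l: "\<And>k. real k \<le> \<bar>l k\<bar>" "\<And>k. \<epsilon> \<le> \<bar>Theta (l k) - l k\<bar>" by metis
  have RL: "(\<lambda>k. \<integral>s. wave (l k) s * g s \<partial>unit_lborel) \<longlonglongrightarrow> 0"
    if g: "integrable unit_lborel g" "g \<in> borel_measurable borel" for g :: "real \<Rightarrow> complex"
    unfolding tendsto_iff eventually_sequentially
  proof (intro allI impI)
    fix e :: real assume e: "0 < e"
    show "\<exists>N. \<forall>n\<ge>N. dist (\<integral>s. wave (l n) s * g s \<partial>unit_lborel) 0 < e"
    proof (rule Riemann_Lebesgue[OF g e])
      fix M assume M: "\<And>t. M \<le> \<bar>t\<bar> \<Longrightarrow> norm (\<integral>x. exp (\<i> * of_real (t * x)) * g x \<partial>unit_lborel) < e"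
      obtain N where N: "M \<le> real N" using real_arch_simple by blast
      have "dist (\<integral>s. wave (l n) s * g s \<partial>unit_lborel) 0 < e" if "N \<le> n" for n
      proof -
        have "M \<le> \<bar>- 2 * l n\<bar>" using N l(1)[of n] that by (simp add: abs_mult)
        from M[OF this] show ?thesis by (simp add: wave_def)
      qed
      then show ?thesis by blast
    qed
  qed
  have Z1: "(\<lambda>k. sol (l k) s) \<longlonglongrightarrow> 1" if s: "0 \<le> s" "s \<le> 1" for s
  proof (rule sol_transform[OF s])
    fix D G assume G: "Lp_le p D G" "\<And>l. sol l s = 1 + (\<integral>r. wave l r * G r \<partial>unit_lborel)"
    have "(\<lambda>k. 1 + (\<integral>r. wave (l k) r * G r \<partial>unit_lborel)) \<longlonglongrightarrow> 1 + 0"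
      by (intro tendsto_add tendsto_const RL Lp_le_L1(1)[OF p G(1)] Lp_le_measurable[OF G(1)])
    then show ?thesis by (simp add: G(2))
  qed
  let ?r = "\<lambda>k s. log_deriv (l k) s + \<i> * (wave (l k) s * q s)"
  have "(\<lambda>k. \<integral>s. ?r k s \<partial>unit_lborel) \<longlonglongrightarrow> (\<integral>s. 0 \<partial>unit_lborel)"
  proof (rule integral_dominated_convergence)
    show "integrable unit_lborel (\<lambda>s. 2 * norm (q s))" using q_integrable by simp
    have "AE s in unit_lborel. 0 < s \<and> s < 1" by (simp add: AE_unit_lborel)
    then show "AE s in unit_lborel. (\<lambda>k. ?r k s) \<longlonglongrightarrow> 0"
    proof eventually_elim
      case (elim s)
      have Zs: "(\<lambda>k. sol (l k) s) \<longlonglongrightarrow> 1" using elim by (intro Z1) auto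
      have "(\<lambda>k. cnj (sol (l k) s) / sol (l k) s) \<longlonglongrightarrow> cnj 1 / 1"
        by (intro tendsto_divide tendsto_cnj Zs) simp
      then have "(\<lambda>k. norm (q s) * norm (cnj (sol (l k) s) / sol (l k) s - 1)) \<longlonglongrightarrow> norm (q s) * norm (cnj 1 / 1 - 1 :: complex)"
        by (intro tendsto_mult tendsto_norm tendsto_diff tendsto_const)
      moreover have "norm (?r k s) = norm (q s) * norm (cnj (sol (l k) s) / sol (l k) s - 1)" for k
      proof -
        have "?r k s = - \<i> * q s * wave (l k) s * (cnj (sol (l k) s) / sol (l k) s - 1)"
          unfolding log_deriv_def by (simp add: algebra_simps)
        then show ?thesis by (simp add: norm_mult)
      qed
      ultimately have "(\<lambda>k. norm (?r k s)) \<longlonglongrightarrow> 0" by simp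
      then show ?case by (rule tendsto_norm_zero_cancel)
    qed
    show "AE s in unit_lborel. norm (?r k s) \<le> 2 * norm (q s)" for k
    proof (intro always_eventually allI)
      fix s
      have "norm (?r k s) \<le> norm (log_deriv (l k) s) + norm (\<i> * (wave (l k) s * q s))" by (rule norm_triangle_ineq)
      then show "norm (?r k s) \<le> 2 * norm (q s)" using norm_log_deriv_le[of "l k" s] by (simp add: norm_mult)
    qed
  qed measurable
  moreover have "(\<lambda>k. \<i> * (\<integral>s. wave (l k) s * q s \<partial>unit_lborel)) \<longlonglongrightarrow> \<i> * 0"
    by (intro tendsto_mult tendsto_const RL q_integrable q_measurable)
  ultimately have "(\<lambda>k. (\<integral>s. ?r k s \<partial>unit_lborel) - \<i> * (\<integral>s. wave (l k) s * q s \<partial>unit_lborel)) \<longlonglongrightarrow> 0 - \<i> * 0"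
    by (intro tendsto_diff) simp_all
  moreover have "(\<integral>s. ?r k s \<partial>unit_lborel) - \<i> * (\<integral>s. wave (l k) s * q s \<partial>unit_lborel) = log_sol (l k) 1" for k
  proof -
    have wi: "integrable unit_lborel (\<lambda>s. wave (l k) s * q s)"
      by (rule Bochner_Integration.integrable_bound[OF q_integrable]) (auto simp: norm_mult)
    have "(\<integral>s. ?r k s \<partial>unit_lborel) = (\<integral>s. log_deriv (l k) s \<partial>unit_lborel) + (\<integral>s. \<i> * (wave (l k) s * q s) \<partial>unit_lborel)"
      by (intro Bochner_Integration.integral_add log_deriv_integrable integrable_mult_right wi)
    also have "(\<integral>s. \<i> * (wave (l k) s * q s) \<partial>unit_lborel) = \<i> * (\<integral>s. wave (l k) s * q s \<partial>unit_lborel)"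
      by (rule integral_mult_right_zero)
    also have "(\<integral>s. log_deriv (l k) s \<partial>unit_lborel) = log_sol (l k) 1"
      unfolding log_sol_def by (intro integral_cong_AE) (auto simp: AE_unit_lborel)
    finally show ?thesis by simp
  qed
  ultimately have "(\<lambda>k. log_sol (l k) 1) \<longlonglongrightarrow> 0" by simp
  then have "(\<lambda>k. Im (log_sol (l k) 1)) \<longlonglongrightarrow> Im 0" by (rule tendsto_Im)
  then have "eventually (\<lambda>k. \<bar>Im (log_sol (l k) 1)\<bar> < \<epsilon>) sequentially"
    using assms by (auto simp: tendsto_iff dist_real_def)
  then obtain k where "\<bar>Im (log_sol (l k) 1)\<bar> < \<epsilon>" by (auto simp: eventually_sequentially)
  then show False using l(2)[of k] by (simp add: theta_def)
qed

end

section \<open>Eigenvalues\<close>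

lemma indef_integral_cong:
  assumes "indef_integral f g" "\<And>x. 0 \<le> x \<Longrightarrow> x \<le> 1 \<Longrightarrow> f' x = f x" "\<And>x. 0 < x \<Longrightarrow> x < 1 \<Longrightarrow> g' x = g x"
  shows "indef_integral f' g'"
proof -
  have "indef_integral f g'" by (rule indef_integral_cong_negligible[OF assms(1) negligible_empty assms(3)])
  then show ?thesis using assms(2) by (simp add: indef_integral_def)
qed

lemma AE_unit_meas:
  "(AE x in unit_meas. P x) \<longleftrightarrow> (\<exists>N. negligible N \<and> (\<forall>x. 0 < x \<longrightarrow> x < 1 \<longrightarrow> x \<notin> N \<longrightarrow> P x))"
proof -
  have "(AE x in unit_meas. P x) \<longleftrightarrow> (AE x in lebesgue. x \<in> {0<..<1} \<longrightarrow> P x)"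
    by (subst AE_restrict_space_iff) auto
  also have "\<dots> \<longleftrightarrow> (\<exists>N. negligible N \<and> {x. \<not> (x \<in> {0<..<1} \<longrightarrow> P x)} \<subseteq> N)"
    by (rule eventually_ae_filter_negligible)
  also have "\<dots> \<longleftrightarrow> (\<exists>N. negligible N \<and> (\<forall>x. 0 < x \<longrightarrow> x < 1 \<longrightarrow> x \<notin> N \<longrightarrow> P x))" by auto
  finally show ?thesis .
qed

lemma continuous_AE_eq_0:
  fixes f :: "real \<Rightarrow> complex"
  assumes f: "continuous_on {0..1} f" and ae: "AE x in unit_meas. f x = 0" and x: "x \<in> {0..1}"
  shows "f x = 0"
proof -
  let ?C = "{x \<in> {0..1}. f x = 0}"
  have C: "closed ?C" using continuous_closed_preimage_constant[OF f] by simp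
  have "AE x in lebesgue. x \<in> {0<..<1} \<longrightarrow> f x = 0"
    using ae by (subst (asm) AE_restrict_space_iff) auto
  then have "AE x\<in>{0<..<1} in lebesgue. x \<in> ?C" by eventually_elim auto
  then have "{0<..<1} \<subseteq> ?C"
    using mem_closed_if_AE_lebesgue_open[OF open_greaterThanLessThan C] by blast
  then have "closure {0<..<1} \<subseteq> ?C" by (intro closure_minimal C)
  then show ?thesis using x by (auto simp: closure_greaterThanLessThan)
qed

lemma vector2_eq_axis:
  fixes a b :: complex
  shows "vector [a, b] = axis 1 a + axis (2 :: 2) b"
  by (auto simp: vec_eq_iff forall_2 axis_def)

lemma has_vector_derivative_vector2:
  fixes u :: "real \<Rightarrow> complex^2"
  assumes "((\<lambda>x. u x $ 1) has_vector_derivative a) (at x)" "((\<lambda>x. u x $ 2) has_vector_derivative b) (at x)"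
  shows "(u has_vector_derivative vector [a, b]) (at x)"
proof -
  have bl: "bounded_linear (axis i :: complex \<Rightarrow> complex^2)" for i
    by (rule linear_conv_bounded_linear[THEN iffD1]) (auto intro!: linearI simp: vec_eq_iff axis_def)
  have "((\<lambda>x. axis 1 (u x $ 1) + axis (2 :: 2) (u x $ 2)) has_vector_derivative (axis 1 a + axis (2 :: 2) b)) (at x)"
    by (intro has_vector_derivative_add bounded_linear.has_vector_derivative[OF bl] assms)
  moreover have "(\<lambda>x. axis 1 (u x $ 1) + axis (2 :: 2) (u x $ 2)) = u"
    by (auto simp: fun_eq_iff vec_eq_iff forall_2 axis_def)
  ultimately show ?thesis unfolding vector2_eq_axis by simp
qed

lemma B_mat_mult: "B_mat *v vector [a, b] = vector [b, - a]"
  by (simp add: B_mat_def matrix_vector_mult_def vec_eq_iff forall_2 sum_2)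

text \<open>\<open>dirac_expr\<close> is meaningful almost everywhere only; its membership in
  \<open>HH\<close> is derived from a continuous function to which it is almost everywhere
  equal.\<close>

lemma continuous_AE_Lp:
  fixes f g :: "real \<Rightarrow> complex"
  assumes g: "continuous_on {0..1} g" and ae: "AE x in unit_meas. f x = g x" and r: "0 \<le> r"
  shows "f \<in> Lp r"
proof -
  have gm: "g \<in> borel_measurable unit_meas"
    by (intro continuous_imp_measurable_on_sets_lebesgue continuous_on_subset[OF g]) auto
  have g0: "(\<lambda>x. if x \<in> {0<..<1} then g x else 0) \<in> borel_measurable lebesgue"
    by (rule borel_measurable_if_I[OF gm]) auto
  have "AE x in lebesgue. x \<in> {0<..<1} \<longrightarrow> f x = g x"
    using ae by (subst (asm) AE_restrict_space_iff) auto
  then have "AE x in lebesgue. (if x \<in> {0<..<1} then g x else 0) = (if x \<in> {0<..<1} then f x else 0)"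
    by eventually_elim auto
  from borel_measurable_AE[OF g0 this] have fm: "f \<in> borel_measurable unit_meas"
    by (rule borel_measurable_if_D)
  obtain M where M: "\<And>x. x \<in> {0..1} \<Longrightarrow> norm (g x) \<le> M"
    using compact_imp_bounded[OF compact_continuous_image[OF g compact_Icc]] unfolding bounded_pos by blast
  have "emeasure unit_meas (space unit_meas) = 1" by (simp add: emeasure_restrict_space space_restrict_space)
  then interpret finite_measure unit_meas by (intro finite_measureI) simp
  have "integrable unit_meas (\<lambda>x. norm (f x) powr r)"
  proof (rule integrable_const_bound)
    have "AE x in unit_meas. 0 < x \<and> x < 1" by (subst AE_restrict_space_iff) auto
    with ae show "AE x in unit_meas. norm (norm (f x) powr r) \<le> M powr r"
    proof eventually_elim
      case (elim x)
      then show ?case using M[of x] r by (auto intro!: powr_mono2)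
    qed
  qed (use fm in measurable)
  then show ?thesis using fm by (simp add: Lp_wrt_def)
qed

section \<open>The first-order system in integrated form\<close>

context dirac_kernel
begin

text \<open>The eigenvalue equation solved for the derivatives, with the entries of the matrix read
  off as \<open>Re (q s)\<close> and \<open>Im (q s)\<close>. The parameter is complex because
  eigenvalues have yet to be proved real.\<close>

definition dirac_system :: "complex \<Rightarrow> (real \<Rightarrow> complex) \<Rightarrow> (real \<Rightarrow> complex) \<Rightarrow> bool" where
  "dirac_system \<zeta> u1 u2 \<longleftrightarrow>
     indef_integral u1 (\<lambda>s. - \<zeta> * u2 s + of_real (Im (q s)) * u1 s - of_real (Re (q s)) * u2 s) \<and>
     indef_integral u2 (\<lambda>s. \<zeta> * u1 s - of_real (Re (q s)) * u1 s - of_real (Im (q s)) * u2 s)"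

definition dirac_sol :: "real \<Rightarrow> real \<Rightarrow> complex" where
  "dirac_sol l x = exp (\<i> * of_real (l * x)) * sol l x"

lemma dirac_sol_indef_integral: "indef_integral (dirac_sol l) (\<lambda>s. \<i> * of_real l * dirac_sol l s - \<i> * q s * cnj (dirac_sol l s))"
proof -
  have "indef_integral (\<lambda>x. of_real l * of_real x :: complex) (\<lambda>s. of_real l)"
    unfolding indef_integral_def
  proof (intro conjI ballI)
    fix x :: real assume "x \<in> {0..1}"
    then show "((\<lambda>s. of_real l :: complex) has_integral (of_real l * of_real x - of_real l * of_real 0)) {0..x}"
      using has_integral_const_real[of "of_real l :: complex" 0 x] by (simp add: scaleR_conv_of_real mult.commute)
  qed (rule absolutely_integrable_on_const, simp)
  from indef_integral_linear[OF this bounded_linear_mult_right[of \<i>]]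
  have "indef_integral (\<lambda>x. \<i> * of_real (l * x)) (\<lambda>s. \<i> * of_real l)" by simp
  from indef_integral_mult[OF indef_integral_exp[OF this] sol_indef_integral(1)[of l]]
  show ?thesis
  proof (rule indef_integral_cong)
    fix s :: real
    have "exp (\<i> * of_real (l * s)) * wave l s = cnj (exp (\<i> * of_real (l * s)))"
      by (simp add: wave_def exp_cnj algebra_simps flip: exp_add)
    then have e: "exp (\<i> * of_real (l * s)) * (- \<i> * q s * wave l s * cnj (sol l s)) = - \<i> * q s * cnj (dirac_sol l s)"
      unfolding dirac_sol_def by (simp add: mult_ac)
    show "\<i> * of_real l * dirac_sol l s - \<i> * q s * cnj (dirac_sol l s)
      = \<i> * of_real l * exp (\<i> * of_real (l * s)) * sol l s + exp (\<i> * of_real (l * s)) * (- \<i> * q s * wave l s * cnj (sol l s))"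
      unfolding e by (simp add: dirac_sol_def)
  qed (simp add: dirac_sol_def)
qed

lemma dirac_sol_0: "dirac_sol l 0 = 1"
  by (simp add: dirac_sol_def sol_indef_integral(2))

lemma dirac_sol_1: "dirac_sol l 1 = of_real (exp (Re (log_sol l 1))) * exp (\<i> * of_real (Theta l))"
proof -
  have "dirac_sol l 1 = exp (\<i> * of_real l + log_sol l 1)" by (simp add: dirac_sol_def sol_eq_exp exp_add)
  also have "\<i> * of_real l + log_sol l 1 = of_real (Re (log_sol l 1)) + \<i> * of_real (Theta l)"
    by (simp add: theta_def complex_eq_iff)
  finally show ?thesis by (simp add: exp_add exp_of_real)
qed

lemma dirac_sol_dirac_system: "dirac_system (of_real l) (\<lambda>x. of_real (Re (dirac_sol l x))) (\<lambda>x. of_real (Im (dirac_sol l x)))"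
  unfolding dirac_system_def
proof
  have bl: "bounded_linear (\<lambda>z. of_real (Re z) :: complex)" "bounded_linear (\<lambda>z. of_real (Im z) :: complex)"
    by (intro bounded_linear_compose[OF bounded_linear_of_real] bounded_linear_Re bounded_linear_Im)+
  show "indef_integral (\<lambda>x. of_real (Re (dirac_sol l x)) :: complex) (\<lambda>s. - of_real l * of_real (Im (dirac_sol l s)) + of_real (Im (q s)) * of_real (Re (dirac_sol l s)) - of_real (Re (q s)) * of_real (Im (dirac_sol l s)))"
    by (rule indef_integral_cong[OF indef_integral_linear[OF dirac_sol_indef_integral bl(1)]]) (simp_all add: algebra_simps)
  show "indef_integral (\<lambda>x. of_real (Im (dirac_sol l x)) :: complex) (\<lambda>s. of_real l * of_real (Re (dirac_sol l s)) - of_real (Re (q s)) * of_real (Re (dirac_sol l s)) - of_real (Im (q s)) * of_real (Im (dirac_sol l s)))"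
    by (rule indef_integral_cong[OF indef_integral_linear[OF dirac_sol_indef_integral bl(2)]]) (simp_all add: algebra_simps)
qed

text \<open>Lagrange's identity: since the potential matrix is real and symmetric,
  \<open>Im (u1 x * cnj (u2 x))\<close> has derivative \<open>- Im \<zeta>\<close> times the squared
  length of the solution, and the boundary conditions annihilate it at both ends.\<close>

lemma dirac_system_real:
  assumes sys: "dirac_system \<zeta> u1 u2" and bc: "u2 0 = 0" "u1 1 = 0 \<or> u2 1 = 0"
    and nz: "x0 \<in> {0..1}" "u1 x0 \<noteq> 0 \<or> u2 x0 \<noteq> 0"
  shows "Im \<zeta> = 0"
proof (rule ccontr)
  assume \<zeta>: "Im \<zeta> \<noteq> 0"
  let ?N = "\<lambda>s. norm (u1 s) ^ 2 + norm (u2 s) ^ 2"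
  note u = sys[unfolded dirac_system_def]
  have "indef_integral (\<lambda>x. Im (u1 x * cnj (u2 x))) (\<lambda>s. - Im \<zeta> * ?N s)"
  proof (rule indef_integral_cong)
    show "indef_integral (\<lambda>x. Im (u1 x * cnj (u2 x)))
       (\<lambda>s. Im ((- \<zeta> * u2 s + of_real (Im (q s)) * u1 s - of_real (Re (q s)) * u2 s) * cnj (u2 s)
           + u1 s * cnj (\<zeta> * u1 s - of_real (Re (q s)) * u1 s - of_real (Im (q s)) * u2 s)))"
      using u by (intro indef_integral_linear[OF _ bounded_linear_Im] indef_integral_mult indef_integral_linear[OF _ bounded_linear_cnj]) auto
    show "- Im \<zeta> * ?N s = Im ((- \<zeta> * u2 s + of_real (Im (q s)) * u1 s - of_real (Re (q s)) * u2 s) * cnj (u2 s)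
           + u1 s * cnj (\<zeta> * u1 s - of_real (Re (q s)) * u1 s - of_real (Im (q s)) * u2 s))" for s
      unfolding cmod_power2 by (simp add: algebra_simps power2_eq_square)
  qed simp
  then have "((\<lambda>s. - Im \<zeta> * ?N s) has_integral (Im (u1 1 * cnj (u2 1)) - Im (u1 0 * cnj (u2 0)))) {0..1}"
    unfolding indef_integral_def by auto
  then have "((\<lambda>s. - Im \<zeta> * ?N s) has_integral 0) {0..1}" using bc by auto
  then have "((\<lambda>s. (- 1 / Im \<zeta>) * (- Im \<zeta> * ?N s)) has_integral (- 1 / Im \<zeta>) * 0) {0..1}" by (rule has_integral_mult_right)
  then have I: "(?N has_integral 0) (cbox 0 1)" using \<zeta> by (simp add: add.commute)
  have "continuous_on (cbox 0 1) ?N"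
    using u by (auto intro!: continuous_intros dest!: indef_integral_continuous)
  from has_integral_0_cbox_imp_0[OF this _ I] nz(1) have "?N x0 = 0" by auto
  then show False using nz(2) by (auto simp: add_nonneg_eq_0_iff)
qed

text \<open>For real \<open>l\<close> the spectral parameter cancels from the derivative of the
  squared length, leaving a bound by \<open>4 * norm (q s)\<close> times the squared length.
  Gronwall's inequality carries the zero at \<open>1\<close> back to \<open>x\<close>.\<close>

lemma dirac_system_zero:
  assumes sys: "dirac_system (of_real l) u1 u2" and 1: "u1 1 = 0" "u2 1 = 0" and x: "0 \<le> x" "x \<le> 1"
  shows "u1 x = 0 \<and> u2 x = 0"
proof -
  let ?N = "\<lambda>s. Re (u1 s * cnj (u1 s) + u2 s * cnj (u2 s))"
  let ?g1 = "\<lambda>s. - of_real l * u2 s + of_real (Im (q s)) * u1 s - of_real (Re (q s)) * u2 s"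
  let ?g2 = "\<lambda>s. of_real l * u1 s - of_real (Re (q s)) * u1 s - of_real (Im (q s)) * u2 s"
  let ?n = "\<lambda>s. 2 * (Im (q s) * (norm (u1 s) ^ 2 - norm (u2 s) ^ 2) - 2 * Re (q s) * Re (u1 s * cnj (u2 s)))"
  have N: "?N s = norm (u1 s) ^ 2 + norm (u2 s) ^ 2" for s by (simp add: complex_norm_square[symmetric])
  note u = sys[unfolded dirac_system_def]
  have I: "indef_integral ?N ?n"
  proof (rule indef_integral_cong)
    show "indef_integral ?N (\<lambda>s. Re ((?g1 s * cnj (u1 s) + u1 s * cnj (?g1 s)) + (?g2 s * cnj (u2 s) + u2 s * cnj (?g2 s))))"
      using u by (intro indef_integral_linear[OF _ bounded_linear_Re] indef_integral_add indef_integral_mult indef_integral_linear[OF _ bounded_linear_cnj]) auto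
    show "?n s = Re ((?g1 s * cnj (u1 s) + u1 s * cnj (?g1 s)) + (?g2 s * cnj (u2 s) + u2 s * cnj (?g2 s)))" for s
      unfolding cmod_power2 by (simp add: algebra_simps power2_eq_square)
  qed simp
  have K: "indef_integral (\<lambda>x. 4 * mass x) (\<lambda>s. 4 * norm (q s))"
    using indef_integral_linear[OF mass_indef_integral bounded_linear_mult_right[of 4]] .
  have le: "\<bar>2 * (A - B)\<bar> \<le> 4 * C" if "\<bar>A\<bar> \<le> C" "\<bar>B\<bar> \<le> C" for A B C :: real
    using that by (auto simp: abs_le_iff)
  have "\<bar>?n s\<bar> \<le> 4 * norm (q s) * ?N s" for s
  proof -
    let ?a = "norm (u1 s)" and ?b = "norm (u2 s)"
    have "\<bar>Im (q s) * (?a ^ 2 - ?b ^ 2)\<bar> \<le> norm (q s) * (?a ^ 2 + ?b ^ 2)"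
      unfolding abs_mult by (intro mult_mono abs_Im_le_cmod) (auto simp: abs_le_iff)
    moreover have "\<bar>2 * Re (q s) * Re (u1 s * cnj (u2 s))\<bar> \<le> norm (q s) * (?a ^ 2 + ?b ^ 2)"
    proof -
      have "\<bar>2 * Re (q s) * Re (u1 s * cnj (u2 s))\<bar> = \<bar>Re (q s)\<bar> * (2 * \<bar>Re (u1 s * cnj (u2 s))\<bar>)" by (simp add: abs_mult)
      also have "\<dots> \<le> norm (q s) * (2 * (?a * ?b))"
        using abs_Re_le_cmod[of "u1 s * cnj (u2 s)"] by (intro mult_mono abs_Re_le_cmod) (auto simp: norm_mult)
      also have "\<dots> \<le> norm (q s) * (?a ^ 2 + ?b ^ 2)"
        using sum_squares_bound[of ?a ?b] by (intro mult_left_mono) auto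
      finally show ?thesis .
    qed
    ultimately have "\<bar>?n s\<bar> \<le> 4 * (norm (q s) * (?a ^ 2 + ?b ^ 2))"
      by (rule le)
    then show ?thesis unfolding N by (simp only: mult.assoc)
  qed
  from Gronwall[OF I K this x order_refl] have "?N x * exp (4 * mass x) \<le> 0" using 1 by simp
  then have "?N x \<le> 0" by (simp add: mult_le_0_iff)
  then show ?thesis unfolding N using sum_power2_le_zero_iff[of "norm (u1 x)" "norm (u2 x)"] by simp
qed

text \<open>The Wronskian with \<open>dirac_sol\<close> has zero derivative and vanishes at
  \<open>0\<close>, where both second components do. At \<open>1\<close> the two solutions are
  therefore parallel.\<close>

lemma dirac_system_Wronskian:
  assumes sys: "dirac_system (of_real l) u1 u2" and bc: "u2 0 = 0"
  shows "u1 1 * of_real (Im (dirac_sol l 1)) = u2 1 * of_real (Re (dirac_sol l 1))"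
proof -
  let ?v1 = "\<lambda>x. of_real (Re (dirac_sol l x)) :: complex" and ?v2 = "\<lambda>x. of_real (Im (dirac_sol l x)) :: complex"
  let ?W = "\<lambda>x. u1 x * ?v2 x + (- (u2 x * ?v1 x))"
  let ?q1 = "\<lambda>s. of_real (Re (q s)) :: complex" and ?q2 = "\<lambda>s. of_real (Im (q s)) :: complex" and ?l = "of_real l :: complex"
  note u = sys[unfolded dirac_system_def] and v = dirac_sol_dirac_system[of l, unfolded dirac_system_def]
  have "indef_integral ?W (\<lambda>s. 0)"
  proof (rule indef_integral_cong)
    show "indef_integral ?W (\<lambda>s. ((- ?l * u2 s + ?q2 s * u1 s - ?q1 s * u2 s) * ?v2 s + u1 s * (?l * ?v1 s - ?q1 s * ?v1 s - ?q2 s * ?v2 s))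
       + (- ((?l * u1 s - ?q1 s * u1 s - ?q2 s * u2 s) * ?v1 s + u2 s * (- ?l * ?v2 s + ?q2 s * ?v1 s - ?q1 s * ?v2 s))))"
      using u v by (intro indef_integral_add indef_integral_mult indef_integral_linear[OF _ bounded_linear_minus[OF bounded_linear_ident]]) auto
  qed (simp_all add: algebra_simps)
  from indef_integral_has_integral[OF this order_refl zero_le_one order_refl]
  have "((\<lambda>s. 0) has_integral (?W 1 - ?W 0)) {0..1::real}" .
  then have "?W 1 - ?W 0 = 0" by simp
  then show ?thesis using bc by (simp add: dirac_sol_0)
qed

text \<open>At \<open>1\<close> the special solution is a positive multiple of
  \<open>exp (\<i> * of_real (Theta l))\<close>, so its components vanish exactly with
  \<open>cos\<close> and \<open>sin\<close> of the angle.\<close>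

lemma dirac_system_eigenvalue_iff:
  "(\<exists>u1 u2. dirac_system \<zeta> u1 u2 \<and> u2 0 = 0 \<and> (if j = 1 then u1 1 = 0 else u2 1 = 0) \<and> (\<exists>x\<in>{0..1}. u1 x \<noteq> 0 \<or> u2 x \<noteq> 0))
   \<longleftrightarrow> (\<exists>l. \<zeta> = of_real l \<and> (if j = (1 :: 2) then cos (Theta l) = 0 else sin (Theta l) = 0))"
proof -
  have yT: "Re (dirac_sol l 1) = 0 \<longleftrightarrow> cos (Theta l) = 0" "Im (dirac_sol l 1) = 0 \<longleftrightarrow> sin (Theta l) = 0" for l
    unfolding dirac_sol_1 by (simp_all add: Re_exp Im_exp)
  show ?thesis
  proof
    assume "\<exists>u1 u2. dirac_system \<zeta> u1 u2 \<and> u2 0 = 0 \<and> (if j = 1 then u1 1 = 0 else u2 1 = 0) \<and> (\<exists>x\<in>{0..1}. u1 x \<noteq> 0 \<or> u2 x \<noteq> 0)"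
    then obtain u1 u2 x0 where u: "dirac_system \<zeta> u1 u2" "u2 0 = 0" "if j = 1 then u1 1 = 0 else u2 1 = 0"
      and x0: "x0 \<in> {0..1}" "u1 x0 \<noteq> 0 \<or> u2 x0 \<noteq> 0" by blast
    have "Im \<zeta> = 0" using dirac_system_real[OF u(1,2) _ x0] u(3) by (auto split: if_splits)
    then have \<zeta>: "\<zeta> = of_real (Re \<zeta>)" by (simp add: complex_eq_iff)
    have sys: "dirac_system (of_real (Re \<zeta>)) u1 u2" using u(1) \<zeta> by simp
    \<comment> \<open>With one component zero at \<open>1\<close>, the other one must be nonzero, so
      the Wronskian identity passes the boundary condition on to \<open>dirac_sol\<close>.\<close>
    have "u1 1 \<noteq> 0 \<or> u2 1 \<noteq> 0" using dirac_system_zero[OF sys _ _, of x0] x0 by auto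
    then have "if j = 1 then cos (Theta (Re \<zeta>)) = 0 else sin (Theta (Re \<zeta>)) = 0"
      using dirac_system_Wronskian[OF sys u(2)] u(3) yT[of "Re \<zeta>"] by (auto split: if_splits)
    then show "\<exists>l. \<zeta> = of_real l \<and> (if j = 1 then cos (Theta l) = 0 else sin (Theta l) = 0)" using \<zeta> by blast
  next
    assume "\<exists>l. \<zeta> = of_real l \<and> (if j = 1 then cos (Theta l) = 0 else sin (Theta l) = 0)"
    then obtain l where "\<zeta> = of_real l" and l: "if j = 1 then cos (Theta l) = 0 else sin (Theta l) = 0" by blast
    then show "\<exists>u1 u2. dirac_system \<zeta> u1 u2 \<and> u2 0 = 0 \<and> (if j = 1 then u1 1 = 0 else u2 1 = 0) \<and> (\<exists>x\<in>{0..1}. u1 x \<noteq> 0 \<or> u2 x \<noteq> 0)"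
      using dirac_sol_dirac_system[of l] yT[of l]
      by (intro exI[of _ "\<lambda>x. of_real (Re (dirac_sol l x))"] exI[of _ "\<lambda>x. of_real (Im (dirac_sol l x))"])
        (auto simp: dirac_sol_0 split: if_splits intro!: bexI[of _ 0])
  qed
qed

text \<open>The bridge between the operator, with derivatives of vector functions taken almost
  everywhere, and the integrated system.\<close>

lemma dirac_eigenvalues_eq:
  fixes Q :: "real \<Rightarrow> complex^2^2"
  assumes Q: "AE x in unit_meas. Q x =
      vector [vector [complex_of_real (Re (q x)), complex_of_real (Im (q x))],
              vector [complex_of_real (Im (q x)), - complex_of_real (Re (q x))]]"
  shows "dirac_eigenvalues j Q = of_real ` {l. if j = 1 then cos (Theta l) = 0 else sin (Theta l) = 0}"
proof -
  let ?q1 = "\<lambda>s. of_real (Re (q s)) :: complex" and ?q2 = "\<lambda>s. of_real (Im (q s)) :: complex"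
  obtain NQ where NQ: "negligible NQ" "\<And>x. 0 < x \<Longrightarrow> x < 1 \<Longrightarrow> x \<notin> NQ \<Longrightarrow> Q x = vector [vector [?q1 x, ?q2 x], vector [?q2 x, - ?q1 x]]"
  proof -
    from Q[unfolded AE_unit_meas] obtain N where N: "negligible N"
      "\<forall>x. 0 < x \<longrightarrow> x < 1 \<longrightarrow> x \<notin> N \<longrightarrow> Q x = vector [vector [?q1 x, ?q2 x], vector [?q2 x, - ?q1 x]]" by (elim exE conjE)
    show thesis by (rule that[OF N(1)]) (use N(2) in simp)
  qed
  have Qv: "Q x *v w = vector [?q1 x * w $ 1 + ?q2 x * w $ 2, ?q2 x * w $ 1 - ?q1 x * w $ 2]"
    if "0 < x" "x < 1" "x \<notin> NQ" for x w
    unfolding NQ(2)[OF that] by (simp add: matrix_vector_mult_def vec_eq_iff forall_2 sum_2)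
  have j: "j = 1 \<or> j = 2" by (rule exhaust_2)
  have ev: "\<zeta> \<in> dirac_eigenvalues j Q \<longleftrightarrow>
     (\<exists>u1 u2. dirac_system \<zeta> u1 u2 \<and> u2 0 = 0 \<and> (if j = 1 then u1 1 = 0 else u2 1 = 0) \<and> (\<exists>x\<in>{0..1}. u1 x \<noteq> 0 \<or> u2 x \<noteq> 0))" for \<zeta>
  proof
    assume "\<zeta> \<in> dirac_eigenvalues j Q"
    then obtain u where u: "u \<in> dirac_dom j Q" and nz: "\<not> (AE x in unit_meas. u x = 0)"
      and eq: "AE x in unit_meas. dirac_expr Q u x = \<zeta> *s u x"
      unfolding dirac_eigenvalues_def by blast
    obtain NE where NE: "negligible NE" "\<And>x. 0 < x \<Longrightarrow> x < 1 \<Longrightarrow> x \<notin> NE \<Longrightarrow> dirac_expr Q u x = \<zeta> *s u x"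
    proof -
      from eq[unfolded AE_unit_meas] obtain N where N: "negligible N"
        "\<forall>x. 0 < x \<longrightarrow> x < 1 \<longrightarrow> x \<notin> N \<longrightarrow> dirac_expr Q u x = \<zeta> *s u x" by (elim exE conjE)
      show thesis by (rule that[OF N(1)]) (use N(2) in simp)
    qed
    let ?u1 = "\<lambda>x. u x $ 1" and ?u2 = "\<lambda>x. u x $ 2"
    have "abs_cont ?u1" "abs_cont ?u2" using u by (auto simp: dirac_dom_def AC01_iff)
    then obtain g1 g2 where g: "indef_integral ?u1 g1" "indef_integral ?u2 g2" using abs_cont_indef_integral by metis
    obtain N1 where N1: "negligible N1" "\<And>x. 0 < x \<Longrightarrow> x < 1 \<Longrightarrow> x \<notin> N1 \<Longrightarrow> (?u1 has_vector_derivative g1 x) (at x)"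
      using indef_integral_derivative[OF g(1)] by blast
    obtain N2 where N2: "negligible N2" "\<And>x. 0 < x \<Longrightarrow> x < 1 \<Longrightarrow> x \<notin> N2 \<Longrightarrow> (?u2 has_vector_derivative g2 x) (at x)"
      using indef_integral_derivative[OF g(2)] by blast
    \<comment> \<open>Off this null set the matrix is explicit, the eigenvalue equation holds and
      both components are differentiable.\<close>
    let ?N = "NQ \<union> NE \<union> N1 \<union> N2"
    have N: "negligible ?N" using NQ NE N1 N2 by (intro negligible_Un)
    have pt: "g2 x + (?q1 x * u x $ 1 + ?q2 x * u x $ 2) = \<zeta> * u x $ 1 \<and> - g1 x + (?q2 x * u x $ 1 - ?q1 x * u x $ 2) = \<zeta> * u x $ 2"
      if x: "0 < x" "x < 1" "x \<notin> ?N" for x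
    proof -
      have "(u has_vector_derivative vector [g1 x, g2 x]) (at x)"
        using x by (intro has_vector_derivative_vector2 N1 N2) auto
      then have "vector_derivative u (at x) = vector [g1 x, g2 x]" by (rule vector_derivative_at)
      then have "vector [g2 x, - g1 x] + vector [?q1 x * u x $ 1 + ?q2 x * u x $ 2, ?q2 x * u x $ 1 - ?q1 x * u x $ 2] = \<zeta> *s u x"
        using NE(2)[of x] Qv[of x "u x"] x by (auto simp: dirac_expr_def B_mat_mult)
      then show ?thesis by (simp add: vec_eq_iff forall_2)
    qed
    have "dirac_system \<zeta> ?u1 ?u2"
      unfolding dirac_system_def
    proof
      show "indef_integral ?u1 (\<lambda>s. - \<zeta> * u s $ 2 + ?q2 s * u s $ 1 - ?q1 s * u s $ 2)"
      proof (rule indef_integral_cong_negligible[OF g(1) N])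
        fix x :: real assume "0 < x" "x < 1" "x \<notin> ?N"
        from conjunct2[OF pt[OF this]] show "- \<zeta> * u x $ 2 + ?q2 x * u x $ 1 - ?q1 x * u x $ 2 = g1 x"
          by (simp add: algebra_simps)
      qed
      show "indef_integral ?u2 (\<lambda>s. \<zeta> * u s $ 1 - ?q1 s * u s $ 1 - ?q2 s * u s $ 2)"
      proof (rule indef_integral_cong_negligible[OF g(2) N])
        fix x :: real assume "0 < x" "x < 1" "x \<notin> ?N"
        from conjunct1[OF pt[OF this]] show "\<zeta> * u x $ 1 - ?q1 x * u x $ 1 - ?q2 x * u x $ 2 = g2 x"
          by (simp add: algebra_simps)
      qed
    qed
    moreover have "\<exists>x\<in>{0..1}. u x $ 1 \<noteq> 0 \<or> u x $ 2 \<noteq> 0"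
    proof (rule ccontr)
      assume "\<not> ?thesis"
      then have "u x = 0" if "0 < x" "x < 1" for x using that by (auto simp: vec_eq_iff forall_2)
      then have "AE x in unit_meas. u x = 0" unfolding AE_unit_meas by (intro exI[of _ "{}"]) auto
      then show False using nz by blast
    qed
    moreover have "u 0 $ 2 = 0" "if j = 1 then u 1 $ 1 = 0 else u 1 $ 2 = 0" using u j by (auto simp: dirac_dom_def)
    ultimately show "\<exists>u1 u2. dirac_system \<zeta> u1 u2 \<and> u2 0 = 0 \<and> (if j = 1 then u1 1 = 0 else u2 1 = 0) \<and> (\<exists>x\<in>{0..1}. u1 x \<noteq> 0 \<or> u2 x \<noteq> 0)"
      by blast
  next
    assume "\<exists>u1 u2. dirac_system \<zeta> u1 u2 \<and> u2 0 = 0 \<and> (if j = 1 then u1 1 = 0 else u2 1 = 0) \<and> (\<exists>x\<in>{0..1}. u1 x \<noteq> 0 \<or> u2 x \<noteq> 0)"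
    then obtain u1 u2 where sys: "dirac_system \<zeta> u1 u2" and bc: "u2 0 = 0" "if j = 1 then u1 1 = 0 else u2 1 = 0"
      and nz: "\<exists>x\<in>{0..1}. u1 x \<noteq> 0 \<or> u2 x \<noteq> 0" by blast
    note S = sys[unfolded dirac_system_def]
    have c: "continuous_on {0..1} u1" "continuous_on {0..1} u2" using S by (auto dest: indef_integral_continuous)
    define u :: "real \<Rightarrow> complex^2" where "u x = vector [u1 x, u2 x]" for x
    have u_nth: "u x $ 1 = u1 x" "u x $ 2 = u2 x" for x by (simp_all add: u_def)
    obtain N1 where N1: "negligible N1" "\<And>x. 0 < x \<Longrightarrow> x < 1 \<Longrightarrow> x \<notin> N1 \<Longrightarrow> (u1 has_vector_derivative (- \<zeta> * u2 x + ?q2 x * u1 x - ?q1 x * u2 x)) (at x)"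
      using indef_integral_derivative[OF conjunct1[OF S]] by blast
    obtain N2 where N2: "negligible N2" "\<And>x. 0 < x \<Longrightarrow> x < 1 \<Longrightarrow> x \<notin> N2 \<Longrightarrow> (u2 has_vector_derivative (\<zeta> * u1 x - ?q1 x * u1 x - ?q2 x * u2 x)) (at x)"
      using indef_integral_derivative[OF conjunct2[OF S]] by blast
    have eq: "AE x in unit_meas. dirac_expr Q u x = \<zeta> *s u x"
      unfolding AE_unit_meas
    proof (intro exI[of _ "NQ \<union> N1 \<union> N2"] conjI allI impI)
      show "negligible (NQ \<union> N1 \<union> N2)" using NQ N1 N2 by (intro negligible_Un)
      fix x :: real assume x: "0 < x" "x < 1" "x \<notin> NQ \<union> N1 \<union> N2"
      have "(u has_vector_derivative vector [- \<zeta> * u2 x + ?q2 x * u1 x - ?q1 x * u2 x, \<zeta> * u1 x - ?q1 x * u1 x - ?q2 x * u2 x]) (at x)"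
        using N1(2)[of x] N2(2)[of x] x by (intro has_vector_derivative_vector2; unfold u_nth) blast+
      then have vd: "vector_derivative u (at x) = vector [- \<zeta> * u2 x + ?q2 x * u1 x - ?q1 x * u2 x, \<zeta> * u1 x - ?q1 x * u1 x - ?q2 x * u2 x]"
        by (rule vector_derivative_at)
      have Qu: "Q x *v u x = vector [?q1 x * u1 x + ?q2 x * u2 x, ?q2 x * u1 x - ?q1 x * u2 x]"
        using Qv[of x "u x"] x by (simp add: u_nth)
      show "dirac_expr Q u x = \<zeta> *s u x"
        unfolding dirac_expr_def vd B_mat_mult Qu by (simp add: vec_eq_iff forall_2 u_nth)
    qed
    \<comment> \<open>The two summands of \<open>dirac_expr Q u\<close> need not be square
      integrable separately, but their sum equals \<open>\<zeta>\<close> times a continuous function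
      almost everywhere.\<close>
    have "dirac_expr Q u \<in> HH"
      unfolding HH_def
    proof (clarify)
      fix i
      show "(\<lambda>x. dirac_expr Q u x $ i) \<in> Lp 2"
      proof (rule continuous_AE_Lp)
        show "AE x in unit_meas. dirac_expr Q u x $ i = \<zeta> * u x $ i" using eq by eventually_elim simp
        show "continuous_on {0..1} (\<lambda>x. \<zeta> * u x $ i)"
        proof (rule continuous_on_mult_left)
          show "continuous_on {0..1} (\<lambda>x. u x $ i)"
            using exhaust_2[of i] c by (elim disjE) (simp_all only: u_nth)
        qed
      qed simp
    qed
    then have "u \<in> dirac_dom j Q"
      using S bc j by (auto simp: dirac_dom_def AC01_iff u_nth dest: indef_integral_abs_cont)
    \<comment> \<open>By continuity, a solution that is nonzero at some point cannot vanish almost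
      everywhere.\<close>
    moreover have "\<not> (AE x in unit_meas. u x = 0)"
    proof
      assume "AE x in unit_meas. u x = 0"
      then have "AE x in unit_meas. u x $ 1 = 0" "AE x in unit_meas. u x $ 2 = 0"
        by (auto elim: eventually_mono)
      then have "AE x in unit_meas. u1 x = 0" "AE x in unit_meas. u2 x = 0" unfolding u_nth .
      then show False using nz continuous_AE_eq_0[OF c(1)] continuous_AE_eq_0[OF c(2)] by blast
    qed
    ultimately show "\<zeta> \<in> dirac_eigenvalues j Q" using eq unfolding dirac_eigenvalues_def by blast
  qed
  show ?thesis by (rule set_eqI) (simp only: ev dirac_system_eigenvalue_iff image_iff, blast)
qed

end

section \<open>Asymptotics\<close>

context dirac_kernel
begin

text \<open>The prescribed angle makes \<open>c n\<close> the negative argument of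
  \<open>sol (lam n) 1\<close>, so \<open>exp (\<i> * of_real (c n)) * sol (lam n) 1\<close> is
  positive. Its imaginary part gives the equation of \<open>Lp_coeffs_implicit\<close>. The offset
  \<open>\<sigma>\<close> treats both operators at once.\<close>

lemma Theta_inverse_coeffs:
  fixes lam :: "int \<Rightarrow> real" and \<sigma> :: real
  assumes lam: "\<And>n. Theta (lam n) = pi * (of_int n + \<sigma>)"
  obtains B g where "Lp_le p B g"
    "\<And>n. of_real (lam n - pi * (of_int n + \<sigma>)) = (\<integral>x. fexp n x * g x \<partial>unit_lborel)"
proof -
  define c where "c n = lam n - pi * (of_int n + \<sigma>)" for n
  have c_Theta: "c n = - Im (log_sol (lam n) 1)" for n
    using lam[of n] by (simp add: c_def theta_def)
  \<comment> \<open>\<open>c n\<close> is small once \<open>lam n\<close> is large. If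
    \<open>lam n\<close> stays below \<open>M\<close>, then so does its angle up to
    \<open>mass 1\<close>, which confines \<open>n\<close> to a bounded range.\<close>
  have small: "finite {n. r < norm (complex_of_real (c n))}" if r: "0 < r" for r
  proof -
    obtain M where M: "\<And>l. M \<le> \<bar>l\<bar> \<Longrightarrow> \<bar>Theta l - l\<bar> < r" using Theta_limit[OF r] by blast
    let ?K = "\<lceil>(\<bar>M\<bar> + mass 1) / pi + \<bar>\<sigma>\<bar>\<rceil>"
    have "n \<in> {- ?K..?K}" if n: "r < \<bar>c n\<bar>" for n
    proof -
      have "\<bar>Theta (lam n) - lam n\<bar> = \<bar>c n\<bar>" using lam[of n] by (simp add: c_def abs_minus_commute)
      then have "\<bar>lam n\<bar> < M" using M[of "lam n"] n by linarith
      then have "\<bar>Theta (lam n)\<bar> \<le> \<bar>M\<bar> + mass 1" using abs_Theta_diff_le[of "lam n"] by linarith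
      then have "pi * \<bar>of_int n + \<sigma>\<bar> \<le> \<bar>M\<bar> + mass 1" unfolding lam by (simp add: abs_mult)
      then have "\<bar>of_int n + \<sigma>\<bar> \<le> (\<bar>M\<bar> + mass 1) / pi" by (simp add: pos_le_divide_eq mult.commute)
      then have "\<bar>real_of_int n\<bar> \<le> (\<bar>M\<bar> + mass 1) / pi + \<bar>\<sigma>\<bar>" by linarith
      then show ?thesis by (simp add: abs_le_iff) linarith
    qed
    then have "{n. r < norm (complex_of_real (c n))} \<subseteq> {- ?K..?K}" by auto
    then show ?thesis by (rule finite_subset) simp
  qed
  show ?thesis
  proof (rule sol_transform[of 1])
    fix D G assume G: "Lp_le p D G" and ZG: "\<And>l. sol l 1 = 1 + (\<integral>r. wave l r * G r \<partial>unit_lborel)"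
    note [measurable] = Lp_le_measurable[OF G]
    \<comment> \<open>In \<open>wave (lam n) r\<close> the frequency splits into an integer part,
      the offset and the remainder \<open>c n\<close>. The part due to \<open>\<sigma>\<close> is
      independent of \<open>n\<close> and is absorbed into the function.\<close>
    define H where "H r = exp (\<i> * of_real (- 2 * pi * \<sigma> * r)) * G r" for r
    have [measurable]: "H \<in> borel_measurable borel" unfolding H_def by measurable
    have H: "Lp_le p D H"
      unfolding H_def by (rule Lp_le_mult_bounded[OF p G zero_less_one]) auto
    have Hr: "Lp_le p D (\<lambda>r. cnj (H (1 - r)))"
    proof -
      have "(\<integral>\<^sup>+r. ennreal (norm (H r) powr p) \<partial>unit_lborel) = (\<integral>\<^sup>+r. ennreal (norm (H (1 - r)) powr p) \<partial>unit_lborel)"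
        by (subst distr_reflect_unit_lborel[symmetric]) (simp add: nn_integral_distr)
      then show ?thesis using H by (simp add: Lp_le_def)
    qed
    \<comment> \<open>Chosen so that the integral against \<open>h\<close> is the imaginary part of
      the integral against \<open>H\<close>.\<close>
    define h where "h r = (1 / (2 * \<i>)) * (H r + (- 1) * cnj (H (1 - r)))" for r
    have "Lp_le p (1 * D) (\<lambda>r. (- 1) * cnj (H (1 - r)))"
      by (rule Lp_le_mult_bounded[OF p Hr zero_less_one]) auto
    from Lp_le_add[OF p H this] have "Lp_le p (D + 1 * D) (\<lambda>r. H r + (- 1) * cnj (H (1 - r)))" .
    from Lp_le_mult_bounded[OF p this zero_less_one order_refl, of "\<lambda>_. 1 / (2 * \<i>)"]
    have h: "Lp_le p (1 * (D + 1 * D)) h" unfolding h_def by (simp add: norm_mult norm_divide)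
    have eq: "sin (complex_of_real (c n)) + (\<integral>t. fexp n t * (h t * exp (\<i> * of_real (c n) * of_real (1 - 2 * t))) \<partial>unit_lborel) = 0" for n
    proof -
      let ?e = "\<lambda>t. exp (\<i> * of_real (c n) * of_real (1 - 2 * t))"
      let ?J = "\<integral>t. fexp n t * (H t * ?e t) \<partial>unit_lborel"
      have bound: "integrable unit_lborel (\<lambda>t. fexp n t * (F t * ?e t))" if F: "Lp_le p D F" for F
      proof (rule Bochner_Integration.integrable_bound[OF Lp_le_L1(1)[OF p F]])
        have "norm (?e t) = 1" for t by (simp add: mult.assoc flip: of_real_mult)
        then show "AE t in unit_lborel. norm (fexp n t * (F t * ?e t)) \<le> norm (F t)" by (simp add: norm_mult)
      qed (use Lp_le_measurable[OF F] in measurable)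
      \<comment> \<open>Conjugation and the reflection of \<open>t\<close> to \<open>1 - t\<close>
        have the same effect on \<open>fexp n\<close> and on the phase \<open>?e\<close>: the former
        has period one, the latter depends on \<open>1 - 2 * t\<close>.\<close>
      have J': "(\<integral>t. fexp n t * (cnj (H (1 - t)) * ?e t) \<partial>unit_lborel) = cnj ?J"
      proof -
        have "fexp n t * (cnj (H (1 - t)) * ?e t) = cnj (fexp n (1 - t) * (H (1 - t) * ?e (1 - t)))" for t
        proof -
          have "fexp n (1 - t) * fexp n t = 1" using fexp_add[of n "1 - t" t] fexp_int[of n 1] by simp
          moreover have "cnj (fexp n (1 - t)) * fexp n (1 - t) = 1"
            using complex_norm_square[of "fexp n (1 - t)"] by (simp add: mult.commute)
          ultimately have "cnj (fexp n (1 - t)) = fexp n t"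
            by (metis mult.commute mult_cancel_left zero_neq_one mult_zero_left)
          moreover have "cnj (?e (1 - t)) = ?e t" by (simp add: exp_cnj algebra_simps)
          ultimately show ?thesis by simp
        qed
        then have "(\<integral>t. fexp n t * (cnj (H (1 - t)) * ?e t) \<partial>unit_lborel) = cnj (\<integral>t. fexp n (1 - t) * (H (1 - t) * ?e (1 - t)) \<partial>unit_lborel)"
          by (simp only: Bochner_Integration.integral_cnj)
        also have "(\<integral>t. fexp n (1 - t) * (H (1 - t) * ?e (1 - t)) \<partial>unit_lborel) = ?J"
          by (subst (2) distr_reflect_unit_lborel[symmetric]) (simp add: integral_distr)
        finally show ?thesis .
      qed
      have "(\<integral>t. fexp n t * (h t * ?e t) \<partial>unit_lborel)
         = (\<integral>t. (1 / (2 * \<i>)) * (fexp n t * (H t * ?e t) - fexp n t * (cnj (H (1 - t)) * ?e t)) \<partial>unit_lborel)"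
        by (intro Bochner_Integration.integral_cong refl) (simp only: h_def, simp add: algebra_simps)
      also have "\<dots> = (1 / (2 * \<i>)) * (\<integral>t. fexp n t * (H t * ?e t) - fexp n t * (cnj (H (1 - t)) * ?e t) \<partial>unit_lborel)"
        by (rule integral_mult_right_zero)
      also have "\<dots> = (1 / (2 * \<i>)) * (?J - cnj ?J)"
        unfolding J'[symmetric] by (intro arg_cong2[where f="(*)"] refl Bochner_Integration.integral_diff bound H Hr)
      also have "\<dots> = of_real (Im ?J)" by (simp add: complex_eq_iff)
      finally have hJ: "(\<integral>t. fexp n t * (h t * ?e t) \<partial>unit_lborel) = of_real (Im ?J)" .
      have "exp (\<i> * of_real (c n)) * sol (lam n) 1 = exp (\<i> * of_real (c n)) + (\<integral>r. exp (\<i> * of_real (c n)) * (wave (lam n) r * G r) \<partial>unit_lborel)"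
        unfolding ZG by (simp add: distrib_left)
      also have "(\<integral>r. exp (\<i> * of_real (c n)) * (wave (lam n) r * G r) \<partial>unit_lborel) = ?J"
      proof (rule Bochner_Integration.integral_cong[OF refl])
        fix r
        have "exp (\<i> * of_real (c n)) * wave (lam n) r = fexp n r * exp (\<i> * of_real (- 2 * pi * \<sigma> * r)) * ?e r"
          unfolding wave_def fexp_def c_def by (simp add: algebra_simps flip: exp_add)
        then show "exp (\<i> * of_real (c n)) * (wave (lam n) r * G r) = fexp n r * (H r * ?e r)"
          unfolding H_def by (simp add: mult_ac)
      qed
      finally have "Im (exp (\<i> * of_real (c n)) * sol (lam n) 1) = sin (c n) + Im ?J" by (simp add: Im_exp)
      moreover have "exp (\<i> * of_real (c n)) * sol (lam n) 1 = of_real (exp (Re (log_sol (lam n) 1)))"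
      proof -
        have "exp (\<i> * of_real (c n)) * sol (lam n) 1 = exp (\<i> * of_real (c n) + log_sol (lam n) 1)"
          by (simp add: sol_eq_exp exp_add)
        also have "\<i> * of_real (c n) + log_sol (lam n) 1 = of_real (Re (log_sol (lam n) 1))"
          by (simp add: c_Theta complex_eq_iff)
        finally show ?thesis by (simp add: exp_of_real)
      qed
      ultimately have "sin (c n) + Im ?J = 0" by simp
      then show ?thesis unfolding hJ by (simp add: sin_of_real flip: of_real_add)
    qed
    obtain B where "Lp_coeffs p B (\<lambda>n. complex_of_real (c n))"
      using Lp_coeffs_implicit[OF p h eq small] by blast
    then show ?thesis using that unfolding Lp_coeffs_def c_def by blast
  qed auto
qed

end

section \<open>Transfer to Lebesgue measurable representatives\<close>

lemma integral_unit_meas: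
  fixes f :: "real \<Rightarrow> 'a::{banach, second_countable_topology}"
  assumes [measurable]: "f \<in> borel_measurable borel"
  shows "integral\<^sup>L unit_meas f = integral\<^sup>L unit_lborel f"
    and "integrable unit_meas f \<longleftrightarrow> integrable unit_lborel f"
  by (simp_all add: integral_restrict_space integrable_restrict_space integral_completion integrable_completion integral_unit_lborel set_integrable_def)

lemma Lp_le_Lp:
  assumes "Lp_le p C g" shows "g \<in> Lp p"
proof -
  note [measurable] = Lp_le_measurable[OF assms]
  have "integrable unit_lborel (\<lambda>x. norm (g x) powr p)"
  proof (rule integrableI_nonneg)
    have "(\<integral>\<^sup>+x. ennreal (norm (g x) powr p) \<partial>unit_lborel) \<le> ennreal (C powr p)" using assms by (simp add: Lp_le_def)
    also have "\<dots> < \<infinity>" by simp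
    finally show "(\<integral>\<^sup>+x. ennreal (norm (g x) powr p) \<partial>unit_lborel) < \<infinity>" .
  qed auto
  moreover have "g \<in> borel_measurable unit_meas"
    by (rule measurable_restrict_space1) (rule measurable_completion, simp)
  ultimately show ?thesis by (simp add: Lp_wrt_def integral_unit_meas)
qed

lemma fourier_coeff_eq:
  assumes [measurable]: "g \<in> borel_measurable borel"
  shows "fourier_coeff n g = (\<integral>x. fexp n x * g x \<partial>unit_lborel)"
  unfolding fourier_coeff_def fexp_def by (rule integral_unit_meas(1)) measurable

text \<open>Replacing a coefficient by a Borel function changes it on a null set, which the
  eigenvalue problem does not notice.\<close>

lemma Lp_borel_representative:
  fixes f :: "real \<Rightarrow> real"
  assumes p: "1 \<le> p" and f: "f \<in> Lp p"
  obtains C g where "Lp_le p C (\<lambda>x. complex_of_real (g x))" "AE x in unit_meas. f x = g x"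
proof -
  have fm: "f \<in> borel_measurable unit_meas" and fi: "integrable unit_meas (\<lambda>x. norm (f x) powr p)"
    using f by (auto simp: Lp_wrt_def)
  have "(\<lambda>x. if x \<in> {0<..<1} then f x else 0) \<in> borel_measurable (completion lborel)"
    by (rule borel_measurable_if_I[OF fm]) auto
  from completion_ex_borel_measurable_real[OF this]
  obtain g where g: "g \<in> borel_measurable lborel" "AE x in lborel. (if x \<in> {0<..<1} then f x else 0) = g x" by blast
  have [measurable]: "g \<in> borel_measurable borel" using g(1) by simp
  have ae: "AE x in unit_meas. f x = g x"
  proof (subst AE_restrict_space_iff)
    show "AE x in lebesgue. x \<in> {0<..<1} \<longrightarrow> f x = g x"
      using AE_completion[OF g(2)] by eventually_elim auto
  qed simp
  have gm: "g \<in> borel_measurable unit_meas"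
    by (rule measurable_restrict_space1) (rule measurable_completion, simp)
  have "integrable unit_meas (\<lambda>x. norm (g x) powr p)"
  proof (rule integrable_cong_AE_imp[OF fi])
    show "AE x in unit_meas. norm (f x) powr p = norm (g x) powr p" using ae by eventually_elim simp
  qed (use gm in measurable)
  then have "integrable unit_lborel (\<lambda>x. norm (complex_of_real (g x)) powr p)" by (simp add: integral_unit_meas)
  then obtain C where "Lp_le p C (\<lambda>x. complex_of_real (g x))"
    using Lp_le_exists[OF p, of "\<lambda>x. complex_of_real (g x)"] by auto
  then show ?thesis using that ae by blast
qed

theorem theorem3p1:
  fixes p :: real
    and Q :: "real \<Rightarrow> complex^2^2"
    and q1 q2 :: "real \<Rightarrow> real"
  assumes "1 \<le> p"
    and "Q \<in> Lp_M2 p"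
    and "q1 \<in> Lp p"
    and "q2 \<in> Lp p"
    and "AE x in unit_meas. Q x =
           vector [vector [complex_of_real (q1 x), complex_of_real (q2 x)],
                   vector [complex_of_real (q2 x), - complex_of_real (q1 x)]]"
  shows "\<exists>(lam :: int \<Rightarrow> real) (mu :: int \<Rightarrow> real).
           bij_betw (\<lambda>n. complex_of_real (lam n)) UNIV (dirac_eigenvalues 1 Q) \<and>
           bij_betw (\<lambda>n. complex_of_real (mu n)) UNIV (dirac_eigenvalues 2 Q) \<and>
           (\<forall>n. lam (n - 1) < mu n \<and> mu n < lam n) \<and>
           (\<exists>(g1 :: real \<Rightarrow> complex) (g2 :: real \<Rightarrow> complex).
              g1 \<in> Lp p \<and> g2 \<in> Lp p \<and>
              (\<forall>n. complex_of_real (lam n)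
                     = complex_of_real (pi * (real_of_int n + 1 / 2)) + fourier_coeff n g1) \<and>
              (\<forall>n. complex_of_real (mu n)
                     = complex_of_real (pi * real_of_int n) + fourier_coeff n g2))"
proof -
  obtain C1 r1 where r1: "Lp_le p C1 (\<lambda>x. complex_of_real (r1 x))" "AE x in unit_meas. q1 x = r1 x"
    by (rule Lp_borel_representative[OF assms(1,3)])
  obtain C2 r2 where r2: "Lp_le p C2 (\<lambda>x. complex_of_real (r2 x))" "AE x in unit_meas. q2 x = r2 x"
    by (rule Lp_borel_representative[OF assms(1,4)])
  define q where "q x = complex_of_real (r1 x) + \<i> * complex_of_real (r2 x)" for x
  have "Lp_le p (1 * C2) (\<lambda>x. \<i> * complex_of_real (r2 x))"
    by (rule Lp_le_mult_bounded[OF assms(1) r2(1) zero_less_one]) auto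
  from Lp_le_add[OF assms(1) r1(1) this] have q: "Lp_le p (C1 + 1 * C2) q" unfolding q_def[abs_def] .
  interpret dirac_kernel p "C1 + 1 * C2" q by unfold_locales (fact assms(1) q)+
  have Q: "AE x in unit_meas. Q x =
      vector [vector [complex_of_real (Re (q x)), complex_of_real (Im (q x))],
              vector [complex_of_real (Im (q x)), - complex_of_real (Re (q x))]]"
    using assms(5) r1(2) r2(2) by eventually_elim (simp add: q_def)
  \<comment> \<open>The inverse function of the angle; eigenvalues are its values at the prescribed
    angles, and monotonicity provides both the enumeration and the interlacing.\<close>
  obtain T where T: "\<And>c. Theta (T c) = c" using Theta_surj by metis
  have T_Theta: "T (Theta l) = l" for l
    using T[of "Theta l"] Theta_strict_mono[of "T (Theta l)" l] Theta_strict_mono[of l "T (Theta l)"]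
    by (cases "T (Theta l)" l rule: linorder_cases) auto
  have T_mono: "T a < T b" if "a < b" for a b
    using that T[of a] T[of b] Theta_strict_mono[of "T b" "T a"]
    by (cases "T a" "T b" rule: linorder_cases) auto
  define lam mu :: "int \<Rightarrow> real" where "lam n = T (pi * (of_int n + 1 / 2))" and "mu n = T (pi * of_int n)" for n
  have bij: "bij_betw (\<lambda>n. complex_of_real (T (pi * (of_int n + \<sigma>)))) UNIV (of_real ` {l. \<exists>n::int. Theta l = pi * (of_int n + \<sigma>)})" for \<sigma>
  proof (rule bij_betw_imageI)
    show "inj (\<lambda>n::int. complex_of_real (T (pi * (of_int n + \<sigma>))))"
    proof (rule injI)
      fix m n :: int assume "complex_of_real (T (pi * (of_int m + \<sigma>))) = complex_of_real (T (pi * (of_int n + \<sigma>)))"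
      then have "Theta (T (pi * (of_int m + \<sigma>))) = Theta (T (pi * (of_int n + \<sigma>)))" by simp
      then show "m = n" unfolding T by simp
    qed
    show "range (\<lambda>n::int. complex_of_real (T (pi * (of_int n + \<sigma>)))) = of_real ` {l. \<exists>n::int. Theta l = pi * (of_int n + \<sigma>)}"
    proof (intro equalityI subsetI)
      fix z assume "z \<in> complex_of_real ` {l. \<exists>n::int. Theta l = pi * (of_int n + \<sigma>)}"
      then obtain l and n :: int where "z = complex_of_real l" "Theta l = pi * (of_int n + \<sigma>)" by auto
      then have "z = complex_of_real (T (pi * (of_int n + \<sigma>)))" using T_Theta[of l] by simp
      then show "z \<in> range (\<lambda>n::int. complex_of_real (T (pi * (of_int n + \<sigma>))))" by blast
    qed (use T in auto)
  qed
  have "dirac_eigenvalues 1 Q = of_real ` {l. \<exists>n::int. Theta l = pi * (of_int n + 1 / 2)}"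
    unfolding dirac_eigenvalues_eq[OF Q] by (simp add: cos_zero_iff_int2 algebra_simps)
  then have bij1: "bij_betw (\<lambda>n. complex_of_real (lam n)) UNIV (dirac_eigenvalues 1 Q)"
    using bij[of "1 / 2"] by (simp add: lam_def)
  have "dirac_eigenvalues 2 Q = of_real ` {l. \<exists>n::int. Theta l = pi * (of_int n + 0)}"
    unfolding dirac_eigenvalues_eq[OF Q] by (simp add: sin_zero_iff_int2 mult.commute)
  then have bij2: "bij_betw (\<lambda>n. complex_of_real (mu n)) UNIV (dirac_eigenvalues 2 Q)"
    using bij[of 0] by (simp add: mu_def)
  \<comment> \<open>The angles in question are \<open>pi\<close> times \<open>n - 1 / 2\<close>,
    \<open>n\<close> and \<open>n + 1 / 2\<close>.\<close>
  have inter: "lam (n - 1) < mu n \<and> mu n < lam n" for n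
    unfolding lam_def mu_def by (intro conjI T_mono mult_strict_left_mono) auto
  obtain B1 g1 where g1: "Lp_le p B1 g1"
    "\<And>n. of_real (lam n - pi * (of_int n + 1 / 2)) = (\<integral>x. fexp n x * g1 x \<partial>unit_lborel)"
    by (rule Theta_inverse_coeffs[of lam "1 / 2"]) (simp_all add: lam_def T)
  obtain B2 g2 where g2: "Lp_le p B2 g2"
    "\<And>n. of_real (mu n - pi * (of_int n + 0)) = (\<integral>x. fexp n x * g2 x \<partial>unit_lborel)"
    by (rule Theta_inverse_coeffs[of mu 0]) (simp_all add: mu_def T)
  have "complex_of_real (lam n) = complex_of_real (pi * (real_of_int n + 1 / 2)) + fourier_coeff n g1"
    and "complex_of_real (mu n) = complex_of_real (pi * real_of_int n) + fourier_coeff n g2" for n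
    unfolding fourier_coeff_eq[OF Lp_le_measurable[OF g1(1)]] fourier_coeff_eq[OF Lp_le_measurable[OF g2(1)]]
      g1(2)[symmetric] g2(2)[symmetric] by (simp_all flip: of_real_add)
  then show ?thesis
    using bij1 bij2 inter Lp_le_Lp[OF g1(1)] Lp_le_Lp[OF g2(1)] by blast
qed

end
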